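(* Assume the standing assumptions of the convergence analysis listed in the context, for some $l\in\{0,\dots,\lfloor T/\tau\rfloor-1\}$. Then for every $0\le m\le l$, $$\big\|I_hN_*^m\big(e_h^{m+1}-\hat e_h^{m+1}-\tau I_hT_*^mv^m\big)\big\|_{H^1(\hat\Gamma_{h,*}^m)}\lesssim\tau^2 ,$$ $$\big\|I_hN_*^m\big(e_h^{m}-\hat e_h^{m}-\tau I_hT_*^mv^m\big)\big\|_{H^1(\hat\Gamma_{h,*}^m)}\lesssim\tau^2 ,$$ and, as a consequence, $$\big\|I_hN_*^me_h^m-\hat e_h^m\big\|_{H^1(\hat\Gamma_{h,*}^m)}\lesssim\tau^2 .$$
   Context: **Exact flow.** $\Gamma(t)\subset\mathbb R^2$, $t\in[0,T]$, is a smooth family of simple closed curves, $\Gamma^0=\Gamma(0)$, with outward unit normal $n$ and curvature $H$ given by $Hn=-\Delta_{\Gamma(t)}\mathrm{id}$, moving by curve-shortening flow: the flow map $X(\cdot,t):\Gamma^0\to\Gamma(t)$ satisfies $X(\cdot,0)=\mathrm{id}$ and $\partial_tX=-(Hn)\circ X$; $X(\cdot,t)$ and its inverse are sufficiently smooth uniformly in $t$. For each $t$, $(v,\kappa)$ is the unique smooth solution on $\Gamma=\Gamma(t)$ of $v\cdot n=-H$, $-\Delta_\Gamma v=\kappa n$. For a time step $\tau>0$, $t_m=m\tau$, $\Gamma^m=\Gamma(t_m)$, $n^m,H^m,v^m$ are $n,H,v$ at $t_m$; $X^m=X(\cdot,t_m)$ and $Y^{m+1}=X^{m+1}\circ(X^m)^{-1}:\Gamma^m\to\Gamma^{m+1}$.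 $a^m:U_\delta(\Gamma^m)\to\Gamma^m$ is the closest-point retraction from a tubular neighbourhood of fixed width $\delta$. **Polygonal curves and finite elements.** Polygonal curves are simple closed polygons whose edges $K$ are the elements; $\mathcal N(\cdot)$ is the set of vertices. $S_h(\Sigma)$ is the space of continuous, edgewise affine functions on the polygon $\Sigma$; $I_h$ is nodal interpolation. All polygons considered have corresponding nodes and edges, and a finite element function is identified with its nodal vector: the same nodal vector can be realized on each polygon, the domain of an integral or norm telling which realization is meant. Mass-lumped integral: $\int_\Sigma^hf=\sum_K\frac{|K|}2\sum_{p\in\mathcal N(K)}f|_K(p)$. $\nabla_\Sigma$ is the (edgewise) tangential gradient; dots between matrices denote the Frobenius product. **Scheme.** At a vertex $p$ with adjacent edges of lengths $\ell_-,\ell_+$ and outward unit edge normals $n(p-),n(p+)$, set $\bar n(p)=\frac{\ell_+n(p-)+\ell_-n(p+)}{\ell_-+\ell_+}$; these nodal values define $\bar n_h^m\in[S_h(\Gamma_h^m)]^2$ on $\Gamma_h^m$. Starting from an initial polygon $\Gamma_h^0$ of mesh size $h$ with $X_h^0=\mathrm{id}$, given $\Gamma_h^m$ find $X_h^{m+1}\in[S_h(\Gamma_h^m)]^2$ with $$\int_{\Gamma_h^m}^h\frac{X_h^{m+1}-\mathrm{id}}{\tau}\cdot\bar n_h^m\,\phi_h\cdot\bar n_h^m+\int_{\Gamma_h^m}\nabla_{\Gamma_h^m}X_h^{m+1}\cdot\nabla_{\Gamma_h^m}\phi_h=\int_{\Gamma_h^m}\nabla_{\Gamma_h^m}\mathrm{id}\cdot\nabla_{\Gamma_h^m}I_h[\phi_h-(\phi_h\cdot\bar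 n_h^m)\bar n_h^m]$$ for all $\phi_h\in[S_h(\Gamma_h^m)]^2$, and set $\Gamma_h^{m+1}=X_h^{m+1}(\Gamma_h^m)$. $X_h^m$ also denotes the finite element function whose nodal vector $(x_1^m,\dots,x_J^m)$ consists of the vertices of $\Gamma_h^m$. **Projected curve and errors.** $\hat X_{h,*}^m$ is the finite element function with nodal vector $(a^m(x_1^m),\dots,a^m(x_J^m))$; $\hat\Gamma_{h,*}^m=\hat X_{h,*}^m(\Gamma_h^0)$; $a^m|_{\hat\Gamma_{h,*}^m}:\hat\Gamma_{h,*}^m\to\Gamma^m$ is bijective. $X_{h,*}^{m+1}$ is the finite element function with $X_{h,*}^{m+1}(p)=Y^{m+1}(p)$ at the nodes $p\in\mathcal N(\hat\Gamma_{h,*}^m)$. $\hat e_h^m=X_h^m-\hat X_{h,*}^m$ (projection error), $e_h^{m+1}=X_h^{m+1}-X_{h,*}^{m+1}$ (one-step trajectory error), $e_h^0:=\hat e_h^0$. Mesh regularity constant: $\kappa_l=\max_{0\le m\le l}\big(\|\hat X_{h,*}^m\|_{W^{1,\infty}(\Gamma_h^0)}+\|(\hat X_{h,*}^m)^{-1}\|_{W^{1,\infty}(\hat\Gamma_{h,*}^m)}\big)$. **Projectors.** $n_*^m=n^m\circ a^m$, $N_*^m=n_*^m(n_*^m)^\top$, $T_*^m=I-N_*^m$. For a finite element function $\phi_h$, $I_hN_*^m\phi_h$ and $I_hT_*^m\phi_h$ denote the finite element functions with nodal values $N_*^m(p)\phi_h(p)$, $T_*^m(p)\phi_h(p)$ at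 the nodes $p$ of $\hat\Gamma_{h,*}^m$; $I_hT_*^mv^m$ means $I_h[T_*^m(v^m\circ a^m)]$ on $\hat\Gamma_{h,*}^m$. Quantities at level $m+1$ are realized on $\hat\Gamma_{h,*}^m$ through their nodal values. **Standing assumptions.** $\kappa_0\le C_{\rm sh}$; $c_{\rm q}h\le|K|\le C_{\rm q}h$ for all edges $K$ of $\Gamma_h^0$; $\hat e_h^0=0$; $\tau\le c_0h^2$; $h$ is sufficiently small (depending on $\kappa_l$ and the fixed constants); and for all $m=0,\dots,l$ the induction hypothesis holds: $$\|\hat e_h^m\|_{L^2}+\|e_h^m\|_{L^2}+\|\hat e_h^m\|_{L^\infty}+\|e_h^m\|_{L^\infty}+\|\hat e_h^m\|_{H^1}+\|e_h^m\|_{H^1}+h^{1/2}\big(\|\hat e_h^m\|_{W^{1,\infty}}+\|e_h^m\|_{W^{1,\infty}}\big)\le h^{7/4},$$ all norms over $\hat\Gamma_{h,*}^m$. $A\lesssim B$ means $A\le CB$ with $C$ independent of $h,\tau,m$, possibly depending on $\kappa_l$, $T$, $c_0,c_{\rm q},C_{\rm q},C_{\rm sh}$ and the exact solution. *)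

theory Defs
  imports "HOL-Analysis.Analysis"
begin

definition smooth_curve_fun :: "(real \<Rightarrow> 'a::real_normed_vector) \<Rightarrow> bool" where
  "smooth_curve_fun f \<longleftrightarrow>
     (\<exists>D. D 0 = f \<and> (\<forall>k \<theta>. (D k has_vector_derivative D (Suc k) \<theta>) (at \<theta>)))"

(* f is C-infinity on R x [0,T] (one-sided in time at 0 and T): D i j is the mixed derivative of
   order i in the curve parameter and of order j in time. *)
definition smooth_family :: "real \<Rightarrow> (real \<Rightarrow> real \<Rightarrow> 'a::real_normed_vector) \<Rightarrow> bool" where
  "smooth_family T f \<longleftrightarrow>
     (\<exists>D. D 0 0 = f \<and>
       (\<forall>i j. continuous_on (UNIV \<times> {0..T}) (\<lambda>(\<theta>, t). D i j \<theta> t) \<and>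
         (\<forall>\<theta>. \<forall>t\<in>{0..T}.
            ((\<lambda>\<theta>'. D i j \<theta>' t) has_vector_derivative D (Suc i) j \<theta> t) (at \<theta>) \<and>
            ((\<lambda>t'. D i j \<theta> t') has_vector_derivative D i (Suc j) \<theta> t) (at t within {0..T}))))"

(* Derivative with respect to arc length of the curve parametrized by g. *)
definition arc_deriv ::
    "(real \<Rightarrow> real^2) \<Rightarrow> (real \<Rightarrow> 'a::real_normed_vector) \<Rightarrow> real \<Rightarrow> 'a" where
  "arc_deriv g F \<theta> = vector_derivative F (at \<theta>) /\<^sub>R norm (vector_derivative g (at \<theta>))"

(* Laplace-Beltrami operator of the curve parametrized by g, applied to a function f on that curve,
   at the point g(theta). *)
definition surf_laplacian ::
    "(real \<Rightarrow> real^2) \<Rightarrow> (real^2 \<Rightarrow> 'a::real_normed_vector) \<Rightarrow> real \<Rightarrow> 'a" where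
  "surf_laplacian g f = arc_deriv g (arc_deriv g (f \<circ> g))"

(* \<nu> is the outward unit normal, at the point p, of the Jordan curve S with tangent direction d
   at p. *)
definition outward_unit_normal ::
    "(real^2) set \<Rightarrow> real^2 \<Rightarrow> real^2 \<Rightarrow> real^2 \<Rightarrow> bool" where
  "outward_unit_normal S d p \<nu> \<longleftrightarrow>
     norm \<nu> = 1 \<and> \<nu> \<bullet> d = 0 \<and> (\<forall>\<^sub>F \<epsilon> in at_right 0. p + \<epsilon> *\<^sub>R \<nu> \<in> outside S)"

definition curve_at :: "(real \<Rightarrow> real^2) \<Rightarrow> (real^2 \<Rightarrow> real \<Rightarrow> real^2) \<Rightarrow> real \<Rightarrow> (real^2) set" where
  "curve_at c X t = (\<lambda>p. X p t) ` range c"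

(* c is a 1-periodic parametrization of the initial curve and X the flow map, so that
   \<theta> \<mapsto> X (c \<theta>) t parametrizes the curve at time t.  Smoothness of X(.,t) and of its inverse,
   uniformly in t, is joint smoothness of X (c \<theta>) t together with injectivity and regularity
   (the parameter domain is compact modulo the period).  The functions n t, H t, v t, kap t matter
   only on the curve at time t.  The last clause says that \<delta> is a width for which the closest-point
   retraction is well defined. *)
definition exact_flow ::
    "real \<Rightarrow> real \<Rightarrow> (real \<Rightarrow> real^2) \<Rightarrow> (real^2 \<Rightarrow> real \<Rightarrow> real^2) \<Rightarrow>
     (real \<Rightarrow> real^2 \<Rightarrow> real^2) \<Rightarrow> (real \<Rightarrow> real^2 \<Rightarrow> real) \<Rightarrow>
     (real \<Rightarrow> real^2 \<Rightarrow> real^2) \<Rightarrow> (real \<Rightarrow> real^2 \<Rightarrow> real) \<Rightarrow> bool" where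
  "exact_flow T \<delta> c X n H v kap \<longleftrightarrow>
     smooth_family T (\<lambda>\<theta> t. X (c \<theta>) t) \<and>
     (\<forall>\<theta>. c (\<theta> + 1) = c \<theta>) \<and>
     (\<forall>\<theta> \<theta>'. c \<theta> = c \<theta>' \<longrightarrow> \<theta> - \<theta>' \<in> \<int>) \<and>
     (\<forall>p\<in>range c. X p 0 = p) \<and>
     (\<forall>t\<in>{0..T}. let g = (\<lambda>\<theta>. X (c \<theta>) t); G = curve_at c X t in
        inj_on (\<lambda>p. X p t) (range c) \<and>
        (\<forall>\<theta>. vector_derivative g (at \<theta>) \<noteq> 0) \<and>
        (\<forall>\<theta>. outward_unit_normal G (vector_derivative g (at \<theta>)) (g \<theta>) (n t (g \<theta>))) \<and>
        (\<forall>\<theta>. H t (g \<theta>) *\<^sub>R n t (g \<theta>) = - surf_laplacian g id \<theta>) \<and>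
        (\<forall>p\<in>range c. ((\<lambda>t'. X p t') has_vector_derivative
             - (H t (X p t) *\<^sub>R n t (X p t))) (at t within {0..T})) \<and>
        smooth_curve_fun (v t \<circ> g) \<and> smooth_curve_fun (kap t \<circ> g) \<and>
        (\<forall>p\<in>G. v t p \<bullet> n t p = - H t p) \<and>
        (\<forall>\<theta>. - surf_laplacian g (v t) \<theta> = kap t (g \<theta>) *\<^sub>R n t (g \<theta>)) \<and>
        (\<forall>x. infdist x G < \<delta> \<longrightarrow> (\<exists>!p. p \<in> G \<and> dist x p = infdist x G)))"

(* A polygon with J vertices is its vertex vector q 0, ..., q (J - 1), indices being cyclic; edge j
   joins q j to its successor.  A finite element function is its nodal vector u; on edge j its value
   at (1 - s) q j + s q (j+1) is fe J u j s, for every polygon on which it is realized. *)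
type_synonym nodal = "nat \<Rightarrow> real^2"

definition nxt :: "nat \<Rightarrow> nat \<Rightarrow> nat" where "nxt J j = (j + 1) mod J"

definition prv :: "nat \<Rightarrow> nat \<Rightarrow> nat" where "prv J j = (j + J - 1) mod J"

definition fe :: "nat \<Rightarrow> nodal \<Rightarrow> nat \<Rightarrow> real \<Rightarrow> real^2" where
  "fe J u j s = (1 - s) *\<^sub>R u j + s *\<^sub>R u (nxt J j)"

definition polygon :: "nat \<Rightarrow> nodal \<Rightarrow> (real^2) set" where
  "polygon J q = (\<Union>j<J. closed_segment (q j) (q (nxt J j)))"

definition simple_polygon :: "nat \<Rightarrow> nodal \<Rightarrow> bool" where
  "simple_polygon J q \<longleftrightarrow> 3 \<le> J \<and>
     inj_on (\<lambda>(j, s). fe J q j s) ({..<J} \<times> {0..<1})"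

definition elen :: "nat \<Rightarrow> nodal \<Rightarrow> nat \<Rightarrow> real" where
  "elen J q j = dist (q j) (q (nxt J j))"

definition outer :: "real^2 \<Rightarrow> real^2 \<Rightarrow> real^2^2" where
  "outer a b = (\<chi> i k. a $ i * b $ k)"

(* Tangential gradient on edge j: arc-length derivative (outer) unit tangent.  The inner product and
   the norm of real^2^2 are the Frobenius ones. *)
definition tgrad :: "nat \<Rightarrow> nodal \<Rightarrow> nodal \<Rightarrow> nat \<Rightarrow> real^2^2" where
  "tgrad J q u j =
     outer ((u (nxt J j) - u j) /\<^sub>R elen J q j) ((q (nxt J j) - q j) /\<^sub>R elen J q j)"

(* Integrands are given edgewise: f j s is the value at the point with parameter s of edge j. *)
definition poly_int :: "nat \<Rightarrow> nodal \<Rightarrow> (nat \<Rightarrow> real \<Rightarrow> real) \<Rightarrow> real" where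
  "poly_int J q f = (\<Sum>j<J. elen J q j * integral {0..1} (f j))"

definition lumped_int :: "nat \<Rightarrow> nodal \<Rightarrow> (nat \<Rightarrow> real \<Rightarrow> real) \<Rightarrow> real" where
  "lumped_int J q f = (\<Sum>j<J. elen J q j / 2 * (f j 0 + f j 1))"

definition L2_nrm :: "nat \<Rightarrow> nodal \<Rightarrow> nodal \<Rightarrow> real" where
  "L2_nrm J q u = sqrt (poly_int J q (\<lambda>j s. (norm (fe J u j s))\<^sup>2))"

definition H1_nrm :: "nat \<Rightarrow> nodal \<Rightarrow> nodal \<Rightarrow> real" where
  "H1_nrm J q u = sqrt ((L2_nrm J q u)\<^sup>2 + poly_int J q (\<lambda>j s. (norm (tgrad J q u j))\<^sup>2))"

definition Linf_nrm :: "nat \<Rightarrow> nodal \<Rightarrow> real" where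
  "Linf_nrm J u = (SUP (j, s)\<in>{..<J} \<times> {0..1}. norm (fe J u j s))"

definition W1inf_nrm :: "nat \<Rightarrow> nodal \<Rightarrow> nodal \<Rightarrow> real" where
  "W1inf_nrm J q u = max (Linf_nrm J u) (SUP j\<in>{..<J}. norm (tgrad J q u j))"

definition outward_edge_normals :: "nat \<Rightarrow> nodal \<Rightarrow> nodal \<Rightarrow> bool" where
  "outward_edge_normals J q \<nu> \<longleftrightarrow>
     (\<forall>j<J. \<forall>p\<in>open_segment (q j) (q (nxt J j)).
        outward_unit_normal (polygon J q) (q (nxt J j) - q j) p (\<nu> j))"

(* Edge j follows vertex j and edge (prv J j) precedes it; each normal is weighted by the length of
   the other edge. *)
definition avg_normal :: "nat \<Rightarrow> nodal \<Rightarrow> nodal \<Rightarrow> nodal" where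
  "avg_normal J q \<nu> j =
     (elen J q j *\<^sub>R \<nu> (prv J j) + elen J q (prv J j) *\<^sub>R \<nu> j) /\<^sub>R (elen J q (prv J j) + elen J q j)"

(* One time step from the polygon q (with outward edge normals \<nu>) to the nodal vector y; the nodal
   vector of the identity on q is q itself. *)
definition scheme_step :: "nat \<Rightarrow> real \<Rightarrow> nodal \<Rightarrow> nodal \<Rightarrow> nodal \<Rightarrow> bool" where
  "scheme_step J \<tau> q \<nu> y \<longleftrightarrow>
     (let nb = avg_normal J q \<nu> in
      \<forall>\<phi> :: nodal.
        lumped_int J q (\<lambda>j s. (fe J (\<lambda>i. (y i - q i) /\<^sub>R \<tau>) j s \<bullet> fe J nb j s)
                              * (fe J \<phi> j s \<bullet> fe J nb j s))
        + poly_int J q (\<lambda>j s. tgrad J q y j \<bullet> tgrad J q \<phi> j)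
        = poly_int J q (\<lambda>j s. tgrad J q q j
                              \<bullet> tgrad J q (\<lambda>i. \<phi> i - (\<phi> i \<bullet> nb i) *\<^sub>R nb i) j))"

(* From here on x m is the vertex vector of the numerical polygon at time level m. *)

definition retr :: "(real \<Rightarrow> real^2) \<Rightarrow> (real^2 \<Rightarrow> real \<Rightarrow> real^2) \<Rightarrow> real \<Rightarrow> nat \<Rightarrow> real^2 \<Rightarrow> real^2" where
  "retr c X \<tau> m = closest_point (curve_at c X (real m * \<tau>))"

definition proj_nodes ::
    "(real \<Rightarrow> real^2) \<Rightarrow> (real^2 \<Rightarrow> real \<Rightarrow> real^2) \<Rightarrow> real \<Rightarrow> (nat \<Rightarrow> nodal) \<Rightarrow> nat \<Rightarrow> nodal" where
  "proj_nodes c X \<tau> x m j = retr c X \<tau> m (x m j)"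

(* step_map c X \<tau> m is Y^(m+1). *)
definition step_map ::
    "(real \<Rightarrow> real^2) \<Rightarrow> (real^2 \<Rightarrow> real \<Rightarrow> real^2) \<Rightarrow> real \<Rightarrow> nat \<Rightarrow> real^2 \<Rightarrow> real^2" where
  "step_map c X \<tau> m =
     (\<lambda>p. X p (real (Suc m) * \<tau>)) \<circ> inv_into (range c) (\<lambda>p. X p (real m * \<tau>))"

definition proj_err ::
    "(real \<Rightarrow> real^2) \<Rightarrow> (real^2 \<Rightarrow> real \<Rightarrow> real^2) \<Rightarrow> real \<Rightarrow> (nat \<Rightarrow> nodal) \<Rightarrow> nat \<Rightarrow> nodal" where
  "proj_err c X \<tau> x m j = x m j - proj_nodes c X \<tau> x m j"

primrec traj_err ::
    "(real \<Rightarrow> real^2) \<Rightarrow> (real^2 \<Rightarrow> real \<Rightarrow> real^2) \<Rightarrow> real \<Rightarrow> (nat \<Rightarrow> nodal) \<Rightarrow> nat \<Rightarrow> nodal" where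
  "traj_err c X \<tau> x 0 = proj_err c X \<tau> x 0"
| "traj_err c X \<tau> x (Suc m) = (\<lambda>j. x (Suc m) j - step_map c X \<tau> m (proj_nodes c X \<tau> x m j))"

(* The inverse of the map from the initial polygon to the projected one has nodal vector x 0 on the
   projected polygon. *)
definition mesh_const ::
    "(real \<Rightarrow> real^2) \<Rightarrow> (real^2 \<Rightarrow> real \<Rightarrow> real^2) \<Rightarrow> real \<Rightarrow> nat \<Rightarrow> (nat \<Rightarrow> nodal) \<Rightarrow> nat \<Rightarrow> real" where
  "mesh_const c X \<tau> J x l =
     (MAX m\<in>{..l}. W1inf_nrm J (x 0) (proj_nodes c X \<tau> x m)
                   + W1inf_nrm J (proj_nodes c X \<tau> x m) (x 0))"

definition N_star ::
    "(real \<Rightarrow> real^2) \<Rightarrow> (real^2 \<Rightarrow> real \<Rightarrow> real^2) \<Rightarrow> (real \<Rightarrow> real^2 \<Rightarrow> real^2) \<Rightarrow> real \<Rightarrow> nat \<Rightarrow>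
     real^2 \<Rightarrow> real^2^2" where
  "N_star c X n \<tau> m p =
     (let ns = n (real m * \<tau>) (retr c X \<tau> m p) in outer ns ns)"

definition T_star ::
    "(real \<Rightarrow> real^2) \<Rightarrow> (real^2 \<Rightarrow> real \<Rightarrow> real^2) \<Rightarrow> (real \<Rightarrow> real^2 \<Rightarrow> real^2) \<Rightarrow> real \<Rightarrow> nat \<Rightarrow>
     real^2 \<Rightarrow> real^2^2" where
  "T_star c X n \<tau> m p = mat 1 - N_star c X n \<tau> m p"

definition Ih_N ::
    "(real \<Rightarrow> real^2) \<Rightarrow> (real^2 \<Rightarrow> real \<Rightarrow> real^2) \<Rightarrow> (real \<Rightarrow> real^2 \<Rightarrow> real^2) \<Rightarrow> real \<Rightarrow>
     (nat \<Rightarrow> nodal) \<Rightarrow> nat \<Rightarrow> nodal \<Rightarrow> nodal" where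
  "Ih_N c X n \<tau> x m u j = N_star c X n \<tau> m (proj_nodes c X \<tau> x m j) *v u j"

definition Ih_Tv ::
    "(real \<Rightarrow> real^2) \<Rightarrow> (real^2 \<Rightarrow> real \<Rightarrow> real^2) \<Rightarrow> (real \<Rightarrow> real^2 \<Rightarrow> real^2) \<Rightarrow>
     (real \<Rightarrow> real^2 \<Rightarrow> real^2) \<Rightarrow> real \<Rightarrow> (nat \<Rightarrow> nodal) \<Rightarrow> nat \<Rightarrow> nodal" where
  "Ih_Tv c X n v \<tau> x m j =
     (let p = proj_nodes c X \<tau> x m j
      in T_star c X n \<tau> m p *v v (real m * \<tau>) (retr c X \<tau> m p))"

definition induction_hyp ::
    "(real \<Rightarrow> real^2) \<Rightarrow> (real^2 \<Rightarrow> real \<Rightarrow> real^2) \<Rightarrow> real \<Rightarrow> real \<Rightarrow> nat \<Rightarrow> (nat \<Rightarrow> nodal) \<Rightarrow>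
     nat \<Rightarrow> bool" where
  "induction_hyp c X h \<tau> J x m \<longleftrightarrow>
     (let q = proj_nodes c X \<tau> x m; eh = proj_err c X \<tau> x m; e = traj_err c X \<tau> x m in
      L2_nrm J q eh + L2_nrm J q e + Linf_nrm J eh + Linf_nrm J e + H1_nrm J q eh + H1_nrm J q e
      + h powr (1/2) * (W1inf_nrm J q eh + W1inf_nrm J q e) \<le> h powr (7/4))"

(* \<nu> m j is the outward unit normal of edge j of the polygon x m. *)
definition standing_assumptions ::
    "real \<Rightarrow> (real \<Rightarrow> real^2) \<Rightarrow> (real^2 \<Rightarrow> real \<Rightarrow> real^2) \<Rightarrow> real \<Rightarrow> real \<Rightarrow> real \<Rightarrow> real \<Rightarrow>
     real \<Rightarrow> real \<Rightarrow> nat \<Rightarrow> nat \<Rightarrow> (nat \<Rightarrow> nodal) \<Rightarrow> (nat \<Rightarrow> nodal) \<Rightarrow> bool" where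
  "standing_assumptions T c X c0 cq Cq Csh h \<tau> l J x \<nu> \<longleftrightarrow>
     0 < h \<and> 0 < \<tau> \<and> \<tau> \<le> c0 * h\<^sup>2 \<and> int l \<le> \<lfloor>T / \<tau>\<rfloor> - 1 \<and>
     (\<forall>j<J. cq * h \<le> elen J (x 0) j \<and> elen J (x 0) j \<le> Cq * h) \<and>
     (\<forall>j<J. proj_err c X \<tau> x 0 j = 0) \<and>
     mesh_const c X \<tau> J x 0 \<le> Csh \<and>
     (\<forall>m\<le>l.
        simple_polygon J (x m) \<and> outward_edge_normals J (x m) (\<nu> m) \<and>
        scheme_step J \<tau> (x m) (\<nu> m) (x (Suc m)) \<and>
        simple_polygon J (proj_nodes c X \<tau> x m) \<and>
        bij_betw (retr c X \<tau> m) (polygon J (proj_nodes c X \<tau> x m)) (curve_at c X (real m * \<tau>)) \<and>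
        induction_hyp c X h \<tau> J x m)"

end

theory Submission
  imports Defs
begin

text \<open>
  The tangential term disappears under the normal projection, and the difference of the two errors
  at the new time is, node by node, the jump between two points of the new curve: the new projected
  node and the transported old one.  If these differ by a parameter shift \<open>\<eta>\<close>, the normal component
  of the jump is quadratic in \<open>\<eta>\<close> and \<open>\<tau>\<close>, so it suffices to show that \<open>\<eta>\<close> and its discrete derivative are \<open>O(\<tau>)\<close>.

  This is a statement about the nodal displacement \<open>d\<close> in one step of the scheme.  Testing with
  \<open>d - \<tau> K\<close>, where \<open>K\<close> is the exact curvature vector at the projected nodes, bounds the normal part
  of \<open>d\<close>; the tangential part of \<open>d\<close>, used as a test function, makes the mass term vanish, and
  summation by parts together with a discrete Poincare inequality bounds it as well.

  Two geometric facts enter.  Injectivity of the retraction on the projected polygon makes all arcs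
  between consecutive nodes equally oriented and disjoint, whence \<open>J h\<close> is bounded.  The Jordan curve
  theorem makes the outward normals of consecutive edges lie on the same side of the polygon, so
  that averaging them does not cancel.
\<close>

section \<open>Plane vectors and nodal functions\<close>

text \<open>The obstacle is regularity along the polygon. The induction hypothesis bounds the sum of
  the squared curvature errors of the numerical polygon only by a constant; hence the normal error
  of the displacement is O(\<tau>) at every node, but its differences between neighbours gain no
  factor \<open>h\<close>. The \<open>H^1\<close> bound of the jump needs the squared differences of
  \<eta> to sum to O(h \<tau>^2), so this rough part must stay out of \<eta> to leading order. Two
  facts achieve it. Normal and tangential parts couple only through the turning of the polygon,
  whose smooth part admits summation by parts and whose rough part is square summable. And \<eta>
  sees the displacement, to leading order, only through its product with the exact tangent, to which
  the discrete normal is orthogonal up to O(h). The estimate at the old level is the jump made by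
  the preceding step, measured with the normal of the curve reached; at level 0 both errors
  coincide. The third estimate holds because the projection error is normal at the projected node,
  hence fixed by the nodal projector.\<close>

definition perp :: "real^2 \<Rightarrow> real^2" where
  "perp a = vector [- a $ 2, a $ 1]"

lemma perp_nth [simp]: "perp a $ 1 = - a $ 2" "perp a $ 2 = a $ 1"
  by (simp_all add: perp_def)

lemma inner_real2: "(a::real^2) \<bullet> b = a $ 1 * b $ 1 + a $ 2 * b $ 2"
  by (simp add: inner_vec_def sum_2)

lemma eq_real2_iff: "(a::real^2) = b \<longleftrightarrow> a $ 1 = b $ 1 \<and> a $ 2 = b $ 2"
  by (simp add: vec_eq_iff forall_2)

lemma perp_add: "perp (a + b) = perp a + perp b"
  and perp_diff: "perp (a - b) = perp a - perp b"
  and perp_scaleR: "perp (r *\<^sub>R a) = r *\<^sub>R perp a"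
  by (simp_all add: eq_real2_iff algebra_simps)

lemma inner_perp_perp [simp]: "perp a \<bullet> perp b = a \<bullet> b"
  by (simp add: inner_real2)

lemma inner_perp_self [simp]: "perp a \<bullet> a = 0" "a \<bullet> perp a = 0"
  by (simp_all add: inner_real2)

lemma inner_perp_swap: "perp a \<bullet> b = - (a \<bullet> perp b)"
  by (simp add: inner_real2)

lemma norm_perp [simp]: "norm (perp a) = norm a"
  by (simp add: norm_eq_sqrt_inner)

lemma perp_eq_0 [simp]: "perp a = 0 \<longleftrightarrow> a = 0"
  by (metis norm_eq_zero norm_perp)

lemma perp_decomposition:
  assumes "a \<noteq> 0"
  shows "y = ((y \<bullet> perp a) / (norm a)\<^sup>2) *\<^sub>R perp a + ((y \<bullet> a) / (norm a)\<^sup>2) *\<^sub>R a"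
proof -
  have n: "(norm a)\<^sup>2 = a$1 * a$1 + a$2 * a$2"
    by (simp add: power2_norm_eq_inner inner_real2)
  have z: "(norm a)\<^sup>2 \<noteq> 0" using assms by simp
  have "(norm a)\<^sup>2 *\<^sub>R y = (y \<bullet> perp a) *\<^sub>R perp a + (y \<bullet> a) *\<^sub>R a"
    unfolding n eq_real2_iff by (simp add: inner_real2 algebra_simps)
  then have "y = (1 / (norm a)\<^sup>2) *\<^sub>R ((y \<bullet> perp a) *\<^sub>R perp a + (y \<bullet> a) *\<^sub>R a)"
    using z by (metis divide_self_if one_divide_eq_0_iff scaleR_one scaleR_scaleR times_divide_eq_left mult_1)
  then show ?thesis by (simp add: scaleR_add_right)
qed

lemma perp_pythagoras: "(a \<bullet> b)\<^sup>2 + (a \<bullet> perp b)\<^sup>2 = (norm a)\<^sup>2 * (norm b)\<^sup>2"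
  unfolding power2_norm_eq_inner by (simp add: inner_real2 power2_eq_square algebra_simps)

lemma orthogonal_unit_cases:
  assumes "norm \<nu> = 1" "norm d = 1" "\<nu> \<bullet> d = 0"
  shows "\<nu> = perp d \<or> \<nu> = - perp d"
proof -
  have "d \<noteq> 0" using assms by auto
  have e: "\<nu> = (\<nu> \<bullet> perp d) *\<^sub>R perp d"
    using perp_decomposition[OF \<open>d \<noteq> 0\<close>, of \<nu>] assms by simp
  have "(\<nu> \<bullet> perp d)\<^sup>2 = 1" using perp_pythagoras[of \<nu> d] assms by simp
  then have "\<nu> \<bullet> perp d = 1 \<or> \<nu> \<bullet> perp d = -1" by (simp add: power2_eq_1_iff)
  then show ?thesis using e by (metis scaleR_one scaleR_minus1_left)
qed

lemma norm_outer: "norm (outer a b) = norm a * norm b"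
  by (simp add: norm_eq_sqrt_inner outer_def inner_vec_def sum_2 real_sqrt_mult[symmetric] algebra_simps)

lemma inner_outer: "outer a b \<bullet> outer a' b' = (a \<bullet> a') * (b \<bullet> b')"
  by (simp add: outer_def inner_vec_def sum_2 algebra_simps)

lemma outer_mult_vec: "outer a b *v y = (b \<bullet> y) *\<^sub>R a"
  by (simp add: eq_real2_iff outer_def matrix_vector_mult_def sum_2 inner_real2 algebra_simps)


section \<open>Cyclic indices and sums around the polygon\<close>

lemma nxt_less [simp]: "j < J \<Longrightarrow> nxt J j < J"
  by (simp add: nxt_def)

lemma prv_less [simp]: "j < J \<Longrightarrow> prv J j < J"
  by (simp add: prv_def)

lemma nxt_cases: "j < J \<Longrightarrow> nxt J j = (if Suc j = J then 0 else Suc j)"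
  by (simp add: nxt_def)

lemma prv_cases: "j < J \<Longrightarrow> prv J j = (if j = 0 then J - 1 else j - 1)"
  by (cases j) (auto simp: prv_def)

lemma nxt_prv [simp]: "j < J \<Longrightarrow> nxt J (prv J j) = j"
  by (cases j) (auto simp: nxt_cases prv_cases)

lemma prv_nxt [simp]: "j < J \<Longrightarrow> prv J (nxt J j) = j"
  by (auto simp: nxt_cases prv_cases)

lemma bij_nxt: "bij_betw (nxt J) {..<J} {..<J}"
  by (rule bij_betw_byWitness[of _ "prv J"]) auto

lemma sum_nxt: "(\<Sum>j<J. f (nxt J j)) = (\<Sum>j<J. f j)"
  by (rule sum.reindex_bij_betw[OF bij_nxt])

lemma sum_prv: "(\<Sum>j<J. f (prv J j)) = (\<Sum>j<J. f j)"
  using sum_nxt[of "\<lambda>j. f (prv J j)" J] by (simp cong: sum.cong_simp)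

lemma cyclic_induct:
  assumes "P i" "i < J" "j < J" and step: "\<And>k. k < J \<Longrightarrow> P k \<Longrightarrow> P (nxt J k)"
  shows "P j"
proof -
  have up: "P b" if "P a" "a \<le> b" "b < J" for a b
    using that(2,1,3)
  proof (induction rule: dec_induct)
    case (step k)
    then show ?case using assms(4)[of k] by (simp add: nxt_cases)
  qed auto
  have "P (J - 1)" using up[of i "J - 1"] assms by simp
  then have "P 0" using step[of "J - 1"] assms by (simp add: nxt_cases)
  then show ?thesis using up[of 0 j] assms by simp
qed

text \<open>Telescoping from the smaller to the larger index never uses the edge that closes the
  polygon; the full sum on the right is generous but independent of the pair.\<close>

lemma cyclic_dist_le_sum:
  fixes a :: "nat \<Rightarrow> 'a::real_normed_vector"
  assumes "i < J" "j < J"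
  shows "norm (a j - a i) \<le> (\<Sum>k<J. norm (a (nxt J k) - a k))"
proof -
  have *: "norm (a j - a i) \<le> (\<Sum>k<J. norm (a (nxt J k) - a k))" if "i \<le> j" "j < J" for i j
  proof -
    have "a j - a i = (\<Sum>k=i..<j. a (Suc k) - a k)" using that by (simp add: sum_Suc_diff')
    also have "norm \<dots> \<le> (\<Sum>k=i..<j. norm (a (Suc k) - a k))" by (rule norm_sum)
    also have "\<dots> = (\<Sum>k=i..<j. norm (a (nxt J k) - a k))"
      using that by (intro sum.cong) (auto simp: nxt_cases)
    also have "\<dots> \<le> (\<Sum>k<J. norm (a (nxt J k) - a k))"
      using that by (intro sum_mono2) auto
    finally show ?thesis .
  qed
  show ?thesis
    by (cases "i \<le> j") (use *[of i j] *[of j i] assms in \<open>auto simp: norm_minus_commute\<close>)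
qed

section \<open>Discrete forms and norms as sums over nodes and edges\<close>

lemma poly_int_const: "poly_int J q (\<lambda>j s. f j) = (\<Sum>j<J. elen J q j * f j)"
  by (simp add: poly_int_def)

lemma inner_tgrad:
  assumes "elen J q j \<noteq> 0"
  shows "tgrad J q y j \<bullet> tgrad J q \<phi> j = ((y (nxt J j) - y j) \<bullet> (\<phi> (nxt J j) - \<phi> j)) / (elen J q j)\<^sup>2"
proof -
  have "(q (nxt J j) - q j) \<bullet> (q (nxt J j) - q j) = (elen J q j)\<^sup>2"
    by (metis elen_def dist_norm norm_minus_commute power2_norm_eq_inner)
  then show ?thesis using assms
    by (simp add: tgrad_def inner_outer divide_simps power2_eq_square)
qed

lemma norm_tgrad:
  assumes "elen J q j \<noteq> 0"
  shows "norm (tgrad J q u j) = norm (u (nxt J j) - u j) / elen J q j"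
proof -
  have "elen J q j = norm (q (nxt J j) - q j)" by (simp add: elen_def dist_norm norm_minus_commute)
  then show ?thesis using assms by (simp add: tgrad_def norm_outer divide_simps)
qed

text \<open>Lumping evaluates only at edge ends, where every factor takes its nodal value, so the
  form is diagonal. Reindexing the far ends gathers half of both adjacent edge lengths at each
  node.\<close>

lemma lumped_int_nodal:
  "lumped_int J q (\<lambda>j s. (fe J a j s \<bullet> fe J n j s) * (fe J b j s \<bullet> fe J n j s))
    = (\<Sum>j<J. (elen J q j + elen J q (prv J j)) / 2 * ((a j \<bullet> n j) * (b j \<bullet> n j)))"
proof -
  let ?A = "\<lambda>j. (a j \<bullet> n j) * (b j \<bullet> n j)"
  have "lumped_int J q (\<lambda>j s. (fe J a j s \<bullet> fe J n j s) * (fe J b j s \<bullet> fe J n j s))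
      = (\<Sum>j<J. elen J q j / 2 * ?A j) + (\<Sum>j<J. elen J q j / 2 * ?A (nxt J j))"
    by (simp add: lumped_int_def fe_def algebra_simps sum.distrib)
  also have "(\<Sum>j<J. elen J q j / 2 * ?A (nxt J j)) = (\<Sum>j<J. elen J q (prv J j) / 2 * ?A j)"
    using sum_nxt[of "\<lambda>j. elen J q (prv J j) / 2 * ?A j" J] by (simp cong: sum.cong_simp)
  finally show ?thesis by (simp add: sum.distrib[symmetric] algebra_simps add_divide_distrib)
qed

lemma H1_nrm_le:
  assumes "\<And>j. j < J \<Longrightarrow> norm (u j) \<le> A" and "\<And>j. j < J \<Longrightarrow> 0 < elen J q j"
    and len: "(\<Sum>j<J. elen J q j) \<le> L" and D: "(\<Sum>j<J. (norm (u (nxt J j) - u j))\<^sup>2 / elen J q j) \<le> D"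
  shows "H1_nrm J q u \<le> sqrt (L * A\<^sup>2 + D)"
proof -
  have integral_le: "0 \<le> integral {0..1} (\<lambda>s. (norm (fe J u j s))\<^sup>2) \<and>
      integral {0..1} (\<lambda>s. (norm (fe J u j s))\<^sup>2) \<le> A\<^sup>2" if j: "j < J" for j
  proof -
    have int: "(\<lambda>s. (norm (fe J u j s))\<^sup>2) integrable_on {0..1}"
      unfolding fe_def by (intro integrable_continuous_interval continuous_intros)
    have "(norm (fe J u j s))\<^sup>2 \<le> A\<^sup>2" if "s \<in> {0..1}" for s
    proof -
      have "norm (fe J u j s) \<le> (1 - s) * norm (u j) + s * norm (u (nxt J j))"
        unfolding fe_def using that by (intro norm_triangle_le) auto
      also have "\<dots> \<le> (1 - s) * A + s * A"
        using that assms(1) j by (intro add_mono mult_left_mono) auto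
      finally show ?thesis by (intro power_mono) (auto simp: algebra_simps)
    qed
    then have "integral {0..1} (\<lambda>s. (norm (fe J u j s))\<^sup>2) \<le> integral {0..1} (\<lambda>s::real. A\<^sup>2)"
      by (intro integral_le int) auto
    moreover have "0 \<le> integral {0..1} (\<lambda>s. (norm (fe J u j s))\<^sup>2)"
      by (intro integral_nonneg int) auto
    ultimately show ?thesis by simp
  qed
  have nn: "0 \<le> poly_int J q (\<lambda>j s. (norm (fe J u j s))\<^sup>2)"
    unfolding poly_int_def using integral_le assms(2) by (intro sum_nonneg mult_nonneg_nonneg) (auto simp: elen_def)
  have "poly_int J q (\<lambda>j s. (norm (fe J u j s))\<^sup>2) \<le> (\<Sum>j<J. elen J q j * A\<^sup>2)"
    unfolding poly_int_def using integral_le by (intro sum_mono mult_left_mono) (auto simp: elen_def)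
  also have "\<dots> \<le> L * A\<^sup>2"
    using len by (simp add: sum_distrib_right[symmetric] mult_right_mono)
  finally have 1: "(L2_nrm J q u)\<^sup>2 \<le> L * A\<^sup>2" using nn by (simp add: L2_nrm_def)
  have "poly_int J q (\<lambda>j s. (norm (tgrad J q u j))\<^sup>2)
      = (\<Sum>j<J. (norm (u (nxt J j) - u j))\<^sup>2 / elen J q j)"
    unfolding poly_int_const using assms(2)
    by (intro sum.cong refl) (force simp: norm_tgrad power_divide power2_eq_square)
  then show ?thesis unfolding H1_nrm_def using 1 D by (intro real_sqrt_le_mono) auto
qed

section \<open>Stability of one step of the scheme\<close>

text \<open>The distance formula for inversion in the unit circle. Being exact, it gives a Lipschitz
  bound for \<open>N j\<close> divided by its squared length, the vector whose product with
  \<open>d j\<close> is the normal coordinate \<open>u j\<close>.\<close>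

lemma inversion_dist:
  fixes a b :: "'a::real_inner"
  assumes "a \<noteq> 0" "b \<noteq> 0"
  shows "norm (a /\<^sub>R (norm a)\<^sup>2 - b /\<^sub>R (norm b)\<^sup>2) = norm (a - b) / (norm a * norm b)"
proof -
  define x y where "x = 1 / (norm a)\<^sup>2" and "y = 1 / (norm b)\<^sup>2"
  have A: "(norm a)\<^sup>2 * x = 1" and B: "(norm b)\<^sup>2 * y = 1" using assms by (auto simp: x_def y_def)
  have expand: "(norm (r *\<^sub>R a - s *\<^sub>R b))\<^sup>2 = r\<^sup>2 * (norm a)\<^sup>2 - 2 * r * s * (a \<bullet> b) + s\<^sup>2 * (norm b)\<^sup>2" for r s
    unfolding power2_norm_eq_inner
    by (simp add: inner_diff_left inner_diff_right inner_commute power2_eq_square)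
  have "(norm (x *\<^sub>R a - y *\<^sub>R b))\<^sup>2 = x * ((norm a)\<^sup>2 * x) - 2 * x * y * (a \<bullet> b) + y * ((norm b)\<^sup>2 * y)"
    unfolding expand by (simp add: power2_eq_square)
  also have "\<dots> = x * ((norm b)\<^sup>2 * y) - 2 * x * y * (a \<bullet> b) + y * ((norm a)\<^sup>2 * x)"
    by (simp add: A B)
  also have "\<dots> = x * y * (norm (1 *\<^sub>R a - 1 *\<^sub>R b))\<^sup>2"
    unfolding expand by (simp add: algebra_simps)
  also have "\<dots> = (norm (a - b) / (norm a * norm b))\<^sup>2"
    by (simp add: x_def y_def power_divide power_mult_distrib)
  finally show ?thesis
    by (simp add: x_def y_def power2_eq_iff_nonneg divide_inverse)
qed

definition edge_tangent :: "nat \<Rightarrow> nodal \<Rightarrow> nodal" where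
  "edge_tangent J q j = (q (nxt J j) - q j) /\<^sub>R elen J q j"

definition node_mass :: "nat \<Rightarrow> nodal \<Rightarrow> nat \<Rightarrow> real" where
  "node_mass J q j = (elen J q j + elen J q (prv J j)) / 2"

text \<open>The cross weights are those of \<open>avg_normal\<close>, so a quarter turn of this
  vector is the averaged normal once both edge normals are known to be quarter turns of the edge
  tangents with a common sign.\<close>

definition node_tangent :: "nat \<Rightarrow> nodal \<Rightarrow> nodal" where
  "node_tangent J q j =
     (elen J q j *\<^sub>R edge_tangent J q (prv J j) + elen J q (prv J j) *\<^sub>R edge_tangent J q j)
       /\<^sub>R (elen J q (prv J j) + elen J q j)"

text \<open>Discrete curvature vector: the change of the edge direction over
  \<open>node_mass\<close>, the distance between adjacent edge midpoints measured along the
  polygon.\<close>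

definition node_curvature :: "nat \<Rightarrow> nodal \<Rightarrow> nodal" where
  "node_curvature J q j = (edge_tangent J q j - edge_tangent J q (prv J j)) /\<^sub>R node_mass J q j"

text \<open>\<open>K\<close> stands for the exact curvature vector at the projected nodes, \<open>d\<close> for the displacement.
  The scheme is quadratic in the averaged normal, so its sign is immaterial in \<open>weak\<close>.\<close>

locale polygon_step =
  fixes J :: nat and q K d :: nodal and h \<tau> M :: real
  assumes M: "1 \<le> M" and h: "0 < h" and tau: "0 < \<tau>" and J: "0 < J"
    and len: "\<And>j. j < J \<Longrightarrow> h / M \<le> elen J q j" "\<And>j. j < J \<Longrightarrow> elen J q j \<le> M * h"
    and Jh: "real J * h \<le> M"
    and K: "\<And>j. j < J \<Longrightarrow> norm (K j) \<le> M"
    and K_diff: "\<And>j. j < J \<Longrightarrow> norm (K (nxt J j) - K j) \<le> M * h"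
    and K_err: "(\<Sum>j<J. (norm (node_curvature J q j - K j))\<^sup>2) \<le> M"
    and tau_le: "\<tau> \<le> M * h\<^sup>2"
    and h_small: "100 * (M ^ 4 * h) \<le> 1"
    and weak: "\<And>\<phi>. (\<Sum>j<J. node_mass J q j * ((d j \<bullet> perp (node_tangent J q j)) * (\<phi> j \<bullet> perp (node_tangent J q j)))) / \<tau>
        + (\<Sum>j<J. ((d (nxt J j) - d j) \<bullet> (\<phi> (nxt J j) - \<phi> j)) / elen J q j)
        = (\<Sum>j<J. node_mass J q j * ((perp (node_tangent J q j) \<bullet> node_curvature J q j) * (\<phi> j \<bullet> perp (node_tangent J q j))))"
begin

abbreviation "l \<equiv> elen J q"
abbreviation "m \<equiv> node_mass J q"
abbreviation "t \<equiv> edge_tangent J q"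
abbreviation "T \<equiv> node_tangent J q"
abbreviation "N j \<equiv> perp (T j)"
abbreviation "kv \<equiv> node_curvature J q"
abbreviation "nx \<equiv> nxt J"
abbreviation "pv \<equiv> prv J"

section \<open>Geometry of the numerical polygon\<close>

lemma M_powers:
  "M * h \<le> 1/100" "M\<^sup>2 * h \<le> 1/100" "M^3 * h \<le> 1/100" "M^4 * h \<le> 1/100"
proof -
  have "M^k * h \<le> 1/100" if "k \<le> 4" for k
  proof -
    have "M^k * h \<le> M^4 * h" using M h that by (intro mult_right_mono power_increasing) auto
    then show ?thesis using h_small by simp
  qed
  from this[of 1] this[of 2] this[of 3] this[of 4] show "M * h \<le> 1/100" "M\<^sup>2 * h \<le> 1/100" "M^3 * h \<le> 1/100" "M^4 * h \<le> 1/100"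
    by auto
qed

lemma l_pos: "j < J \<Longrightarrow> 0 < l j"
  using len(1)[of j] M h by (smt (verit) divide_pos_pos)

lemma m_bounds:
  assumes "j < J"
  shows "h / M \<le> m j" "m j \<le> M * h" "0 < m j"
  using len[of j] len[of "pv j"] l_pos[of j] l_pos[of "pv j"] assms by (auto simp: node_mass_def)

lemma norm_t: "j < J \<Longrightarrow> norm (t j) = 1"
proof -
  assume j: "j < J"
  have "l j = norm (q (nx j) - q j)" by (simp add: elen_def dist_norm norm_minus_commute)
  then show ?thesis using l_pos[OF j] by (simp add: edge_tangent_def)
qed

lemma kv_K: assumes "j < J" shows "norm (kv j - K j) \<le> M"
proof -
  have "(norm (kv j - K j))\<^sup>2 \<le> (\<Sum>j<J. (norm (kv j - K j))\<^sup>2)"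
    using assms by (intro member_le_sum) auto
  also have "\<dots> \<le> M" by (rule K_err)
  also have "\<dots> \<le> M\<^sup>2" using M by (simp add: power2_eq_square)
  finally show ?thesis using M power2_le_imp_le by fastforce
qed

lemma kv_le: assumes "j < J" shows "norm (kv j) \<le> 2 * M"
  using kv_K[OF assms] K[OF assms] norm_triangle_ineq[of "kv j - K j" "K j"] by simp

lemma t_diff_eq: "j < J \<Longrightarrow> t j - t (pv j) = m j *\<^sub>R kv j"
  using m_bounds(3)[of j] by (simp add: node_curvature_def)

lemma t_diff: assumes "j < J" shows "norm (t j - t (pv j)) \<le> 2 * M\<^sup>2 * h"
proof -
  have "norm (t j - t (pv j)) = m j * norm (kv j)"
    using m_bounds(3)[OF assms] by (simp add: t_diff_eq[OF assms])
  also have "\<dots> \<le> (M * h) * (2 * M)"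
    using m_bounds[OF assms] kv_le[OF assms] by (intro mult_mono) auto
  finally show ?thesis by (simp add: power2_eq_square mult_ac)
qed

text \<open>With the cross weights the node tangent is the linear interpolation, at the vertex, of
  edge tangents placed at the edge midpoints. It is reached from either midpoint by half an edge
  length along \<open>kv\<close>; in \<open>T (nx j) - T j\<close> the shared edge tangent then
  cancels and an exact formula remains.\<close>

lemma T_eq:
  assumes "j < J"
  shows "T j = t j - (l j / 2) *\<^sub>R kv j" "T j = t (pv j) + (l (pv j) / 2) *\<^sub>R kv j"
proof -
  have p: "0 < l j + l (pv j)" using l_pos[of j] l_pos[of "pv j"] assms by simp
  have "(l (pv j) + l j) *\<^sub>R T j = l j *\<^sub>R t (pv j) + l (pv j) *\<^sub>R t j"
    using p by (simp add: node_tangent_def)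
  moreover have kv: "(l (pv j) + l j) *\<^sub>R kv j = 2 *\<^sub>R (t j - t (pv j))"
    using t_diff_eq[OF assms] by (simp add: node_mass_def add.commute)
  ultimately have "(l (pv j) + l j) *\<^sub>R T j = (l (pv j) + l j) *\<^sub>R (t j - (l j / 2) *\<^sub>R kv j)"
    "(l (pv j) + l j) *\<^sub>R T j = (l (pv j) + l j) *\<^sub>R (t (pv j) + (l (pv j) / 2) *\<^sub>R kv j)"
    unfolding scaleR_diff_right scaleR_add_right scaleR_left_commute[of "l (pv j) + l j" "_ / 2"] kv
    by (auto simp: algebra_simps)
  then show "T j = t j - (l j / 2) *\<^sub>R kv j" "T j = t (pv j) + (l (pv j) / 2) *\<^sub>R kv j"
    using p by (auto simp: scaleR_cancel_left)
qed

lemma T_diff: assumes "j < J" shows "T (nx j) - T j = (l j / 2) *\<^sub>R (kv j + kv (nx j))"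
  using T_eq(1)[OF assms] T_eq(2)[of "nx j"] assms by (simp add: algebra_simps)

lemma T_diff_le: assumes "j < J" shows "norm (T (nx j) - T j) \<le> 2 * M\<^sup>2 * h"
proof -
  have "norm (T (nx j) - T j) = l j / 2 * norm (kv j + kv (nx j))"
    using l_pos[OF assms] by (simp add: T_diff[OF assms])
  also have "\<dots> \<le> (M * h) / 2 * (2 * M + 2 * M)"
    using len(2)[OF assms] l_pos[OF assms] kv_le[OF assms] kv_le[of "nx j"] assms
    by (intro mult_mono norm_triangle_le) auto
  finally show ?thesis by (simp add: power2_eq_square mult_ac)
qed

lemma T_t: assumes "j < J" shows "norm (T j - t j) \<le> M\<^sup>2 * h"
proof -
  have "norm (T j - t j) = l j / 2 * norm (kv j)" using l_pos[OF assms] by (simp add: T_eq(1)[OF assms])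
  also have "\<dots> \<le> (M * h) / 2 * (2 * M)"
    using len(2)[OF assms] l_pos[OF assms] kv_le[OF assms] by (intro mult_mono) auto
  finally show ?thesis by (simp add: power2_eq_square mult_ac)
qed

lemma norm_T_ge: assumes "j < J" shows "9/10 \<le> norm (T j)"
  using T_t[OF assms] M_powers(2) norm_t[OF assms] norm_triangle_ineq2[of "t j" "T j"]
  by (simp add: norm_minus_commute)

lemma norm_T_le: assumes "j < J" shows "norm (T j) \<le> 1"
proof -
  have p: "0 < l j" "0 < l (pv j)" using l_pos assms by auto
  have "(l (pv j) + l j) * norm (T j) = norm (l j *\<^sub>R t (pv j) + l (pv j) *\<^sub>R t j)"
    using p by (simp add: node_tangent_def)
  also have "\<dots> \<le> l j * 1 + l (pv j) * 1"
    using p norm_t[of "pv j"] norm_t[OF assms] assms by (intro norm_triangle_le) auto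
  finally have "(l (pv j) + l j) * norm (T j) \<le> (l (pv j) + l j) * 1" by simp
  then show ?thesis by (rule mult_left_le_imp_le) (use p in simp)
qed

lemma norm_T_sq: assumes "j < J" shows "1/2 \<le> (norm (T j))\<^sup>2" "(norm (T j))\<^sup>2 \<le> 1" "T j \<noteq> 0"
proof -
  have "(9/10)\<^sup>2 \<le> (norm (T j))\<^sup>2" by (rule power_mono[OF norm_T_ge[OF assms]]) simp
  then show "1/2 \<le> (norm (T j))\<^sup>2" by (simp add: power2_eq_square)
  then show "T j \<noteq> 0" by auto
  show "(norm (T j))\<^sup>2 \<le> 1" using norm_T_le[OF assms] by (simp add: power_le_one)
qed

section \<open>Normal component of the displacement\<close>

definition "w j = d j - \<tau> *\<^sub>R K j"

text \<open>Testing with \<open>w\<close> itself, the mass term yields the left side divided by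
  \<tau> and the stiffness term a nonnegative Dirichlet sum. Young's inequality spends half of the
  former on the consistency error \<open>kv j - K j\<close> and all of the latter on the differences
  of \<open>K\<close>. The factor \<open>h\<close> on the right is the size of the node
  masses.\<close>

lemma normal_energy: "(\<Sum>j<J. m j * (w j \<bullet> N j)\<^sup>2) \<le> 2 * M\<^sup>2 * h * \<tau>\<^sup>2"
proof -
  let ?W = "\<Sum>j<J. m j * (w j \<bullet> N j)\<^sup>2"
  let ?Dw = "\<Sum>j<J. (norm (w (nx j) - w j))\<^sup>2 / l j"
  have dw: "d j = w j + \<tau> *\<^sub>R K j" for j by (simp add: w_def)
  have a: "(\<Sum>j<J. m j * ((d j \<bullet> N j) * (w j \<bullet> N j))) / \<tau>
      = ?W / \<tau> + (\<Sum>j<J. m j * ((K j \<bullet> N j) * (w j \<bullet> N j)))"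
    unfolding sum_divide_distrib sum.distrib[symmetric] using tau
    by (intro sum.cong refl) (simp add: dw inner_add_left power2_eq_square field_simps)
  have b: "(\<Sum>j<J. ((d (nx j) - d j) \<bullet> (w (nx j) - w j)) / l j)
      = ?Dw + (\<Sum>j<J. \<tau> * ((K (nx j) - K j) \<bullet> (w (nx j) - w j)) / l j)"
    unfolding sum.distrib[symmetric]
    by (intro sum.cong refl) (simp add: dw power2_norm_eq_inner inner_diff_left inner_add_left algebra_simps add_divide_distrib[symmetric] diff_divide_distrib[symmetric])
  have "?W / \<tau> + ?Dw = (\<Sum>j<J. m j * ((N j \<bullet> kv j) * (w j \<bullet> N j)) - m j * ((K j \<bullet> N j) * (w j \<bullet> N j))
      - \<tau> * ((K (nx j) - K j) \<bullet> (w (nx j) - w j)) / l j)"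
    using weak[of w] unfolding a b sum_subtractf by simp
  also have "\<dots> \<le> (\<Sum>j<J. m j * (w j \<bullet> N j)\<^sup>2 / (2 * \<tau>) + \<tau> / 2 * (m j * (norm (kv j - K j))\<^sup>2)
      + ((norm (w (nx j) - w j))\<^sup>2 / l j + \<tau>\<^sup>2 * ((norm (K (nx j) - K j))\<^sup>2 / l j)))"
  proof (rule sum_mono)
    fix j assume "j \<in> {..<J}"
    then have j: "j < J" by simp
    have "\<bar>N j \<bullet> (kv j - K j)\<bar> \<le> 1 * norm (kv j - K j)"
      using norm_T_le[OF j] by (intro order_trans[OF Cauchy_Schwarz_ineq2] mult_right_mono) auto
    then have "(N j \<bullet> (kv j - K j))\<^sup>2 \<le> (norm (kv j - K j))\<^sup>2"
      by (metis abs_le_square_iff abs_norm_cancel mult_1)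
    moreover have "(N j \<bullet> (kv j - K j)) * (w j \<bullet> N j) \<le> (w j \<bullet> N j)\<^sup>2 / (2 * \<tau>) + \<tau> / 2 * (N j \<bullet> (kv j - K j))\<^sup>2"
    proof -
      have "0 \<le> ((w j \<bullet> N j) - \<tau> * (N j \<bullet> (kv j - K j)))\<^sup>2 / (2 * \<tau>)" using tau by simp
      also have "\<dots> = (w j \<bullet> N j)\<^sup>2 / (2 * \<tau>) + \<tau> / 2 * (N j \<bullet> (kv j - K j))\<^sup>2 - (N j \<bullet> (kv j - K j)) * (w j \<bullet> N j)"
        using tau by (simp add: power2_eq_square field_simps)
      finally show ?thesis by simp
    qed
    ultimately have "(N j \<bullet> (kv j - K j)) * (w j \<bullet> N j) \<le> (w j \<bullet> N j)\<^sup>2 / (2 * \<tau>) + \<tau> / 2 * (norm (kv j - K j))\<^sup>2"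
      using tau by (smt (verit) mult_left_mono divide_pos_pos)
    then have 1: "m j * ((N j \<bullet> (kv j - K j)) * (w j \<bullet> N j)) \<le> m j * ((w j \<bullet> N j)\<^sup>2 / (2 * \<tau>) + \<tau> / 2 * (norm (kv j - K j))\<^sup>2)"
      using m_bounds(3)[OF j] by (intro mult_left_mono) auto
    let ?dK = "K (nx j) - K j" and ?dw = "w (nx j) - w j"
    have "0 \<le> (norm (\<tau> *\<^sub>R ?dK + ?dw))\<^sup>2" by simp
    then have "- (\<tau> * (?dK \<bullet> ?dw)) * 2 \<le> (norm ?dw)\<^sup>2 + \<tau>\<^sup>2 * (norm ?dK)\<^sup>2"
      by (simp only: power2_norm_eq_inner) (simp add: inner_simps inner_commute power2_eq_square algebra_simps)
    moreover have "0 \<le> (norm ?dw)\<^sup>2 + \<tau>\<^sup>2 * (norm ?dK)\<^sup>2" by simp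
    ultimately have "- (\<tau> * (?dK \<bullet> ?dw)) \<le> (norm ?dw)\<^sup>2 + \<tau>\<^sup>2 * (norm ?dK)\<^sup>2" by linarith
    then have "- (\<tau> * (?dK \<bullet> ?dw)) / l j \<le> ((norm ?dw)\<^sup>2 + \<tau>\<^sup>2 * (norm ?dK)\<^sup>2) / l j"
      using l_pos[OF j] by (intro divide_right_mono) auto
    then have 2: "- (\<tau> * (?dK \<bullet> ?dw) / l j) \<le> (norm ?dw)\<^sup>2 / l j + \<tau>\<^sup>2 * ((norm ?dK)\<^sup>2 / l j)"
      by (simp add: add_divide_distrib)
    have "m j * ((N j \<bullet> kv j) * (w j \<bullet> N j)) - m j * ((K j \<bullet> N j) * (w j \<bullet> N j))
      \<le> m j * (w j \<bullet> N j)\<^sup>2 / (2 * \<tau>) + \<tau> / 2 * (m j * (norm (kv j - K j))\<^sup>2)"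
      using 1 by (simp add: inner_diff_right inner_commute algebra_simps)
    with 2 show "m j * ((N j \<bullet> kv j) * (w j \<bullet> N j)) - m j * ((K j \<bullet> N j) * (w j \<bullet> N j))
        - \<tau> * (?dK \<bullet> ?dw) / l j
      \<le> m j * (w j \<bullet> N j)\<^sup>2 / (2 * \<tau>) + \<tau> / 2 * (m j * (norm (kv j - K j))\<^sup>2)
      + ((norm ?dw)\<^sup>2 / l j + \<tau>\<^sup>2 * ((norm ?dK)\<^sup>2 / l j))"
      by linarith
  qed
  also have "\<dots> = ?W / (2 * \<tau>) + \<tau> / 2 * (\<Sum>j<J. m j * (norm (kv j - K j))\<^sup>2)
      + (?Dw + \<tau>\<^sup>2 * (\<Sum>j<J. (norm (K (nx j) - K j))\<^sup>2 / l j))"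
    by (simp add: sum.distrib sum_distrib_left sum_divide_distrib)
  finally have "?W / \<tau> - ?W / (2 * \<tau>) \<le> \<tau> / 2 * (\<Sum>j<J. m j * (norm (kv j - K j))\<^sup>2)
      + \<tau>\<^sup>2 * (\<Sum>j<J. (norm (K (nx j) - K j))\<^sup>2 / l j)" by simp
  moreover have "?W / \<tau> - ?W / (2 * \<tau>) = ?W / (2 * \<tau>)" using tau by (simp add: field_simps)
  ultimately have W: "?W / (2 * \<tau>) \<le> \<tau> / 2 * (\<Sum>j<J. m j * (norm (kv j - K j))\<^sup>2)
      + \<tau>\<^sup>2 * (\<Sum>j<J. (norm (K (nx j) - K j))\<^sup>2 / l j)" by simp
  have "(\<Sum>j<J. m j * (norm (kv j - K j))\<^sup>2) \<le> (\<Sum>j<J. (M * h) * (norm (kv j - K j))\<^sup>2)"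
    using m_bounds by (intro sum_mono mult_right_mono) auto
  also have "\<dots> \<le> (M * h) * M" unfolding sum_distrib_left[symmetric]
    using K_err M h by (intro mult_left_mono) auto
  finally have 1: "(\<Sum>j<J. m j * (norm (kv j - K j))\<^sup>2) \<le> M\<^sup>2 * h" by (simp add: power2_eq_square mult_ac)
  have "(\<Sum>j<J. (norm (K (nx j) - K j))\<^sup>2 / l j) \<le> (\<Sum>j<J. (M * h)\<^sup>2 / (h / M))"
    using K_diff len M h by (intro sum_mono frac_le power_mono) auto
  also have "\<dots> = M^3 * (real J * h)" using M h by (simp add: power2_eq_square power3_eq_cube)
  also have "\<dots> \<le> M^3 * M" using Jh M by (intro mult_left_mono) auto
  finally have 2: "(\<Sum>j<J. (norm (K (nx j) - K j))\<^sup>2 / l j) \<le> M^4" by (simp add: power_eq_if)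
  have "?W / (2 * \<tau>) \<le> \<tau> / 2 * (M\<^sup>2 * h) + \<tau>\<^sup>2 * M^4"
    using W 1 2 tau by (smt (verit) mult_left_mono zero_le_power2 divide_pos_pos)
  then have "?W \<le> (\<tau> / 2 * (M\<^sup>2 * h) + \<tau>\<^sup>2 * M^4) * (2 * \<tau>)"
    using tau by (simp add: pos_divide_le_eq)
  also have "\<dots> = \<tau>\<^sup>2 * (M\<^sup>2 * h) + \<tau>\<^sup>2 * (2 * M^4 * \<tau>)" by (simp add: power2_eq_square algebra_simps)
  also have "\<dots> \<le> \<tau>\<^sup>2 * (M\<^sup>2 * h) + \<tau>\<^sup>2 * (M\<^sup>2 * h)"
  proof -
    \<comment> \<open>The contribution of the differences of \<open>K\<close> is of order \<tau>^3
      without a factor \<open>h\<close>; the restriction of \<tau> by \<open>h^2\<close> supplies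
      that factor.\<close>
    have "2 * M^4 * \<tau> \<le> 2 * M^4 * (M * h\<^sup>2)" using tau_le M by (intro mult_left_mono) auto
    also have "\<dots> = (2 * (M^3 * h)) * (M\<^sup>2 * h)" by (simp add: power2_eq_square power_eq_if)
    also have "\<dots> \<le> 1 * (M\<^sup>2 * h)" using M_powers(3) M h by (intro mult_right_mono) auto
    finally have "2 * M^4 * \<tau> \<le> M\<^sup>2 * h" by simp
      then have "\<tau>\<^sup>2 * (2 * M^4 * \<tau>) \<le> \<tau>\<^sup>2 * (M\<^sup>2 * h)" by (rule mult_left_mono) simp
      then show ?thesis by linarith
  qed
  finally show ?thesis by (simp add: algebra_simps)
qed

text \<open>The node masses are at least \<open>h / M\<close>, so dividing by them uses up the
  factor \<open>h\<close> of the energy bound. This still suffices for a pointwise O(\<tau>) bound,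
  but leaves no smallness for differences.\<close>

lemma w_normal_sum: "(\<Sum>j<J. (w j \<bullet> N j)\<^sup>2) \<le> 2 * M^3 * \<tau>\<^sup>2"
proof -
  have "h / M * (\<Sum>j<J. (w j \<bullet> N j)\<^sup>2) \<le> (\<Sum>j<J. m j * (w j \<bullet> N j)\<^sup>2)"
    unfolding sum_distrib_left using m_bounds by (intro sum_mono mult_right_mono) auto
  also have "\<dots> \<le> h / M * (2 * M^3 * \<tau>\<^sup>2)"
    using normal_energy M by (simp add: power2_eq_square power3_eq_cube field_simps)
  finally show ?thesis by (rule mult_left_le_imp_le) (use M h in simp)
qed

lemma w_normal: assumes "j < J" shows "\<bar>w j \<bullet> N j\<bar> \<le> 2 * M\<^sup>2 * \<tau>"
proof -
  have "(w j \<bullet> N j)\<^sup>2 \<le> (\<Sum>j<J. (w j \<bullet> N j)\<^sup>2)" using assms by (intro member_le_sum) auto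
  also have "\<dots> \<le> 2 * M^3 * \<tau>\<^sup>2" by (rule w_normal_sum)
  also have "\<dots> \<le> 4 * M^4 * \<tau>\<^sup>2" using M power_increasing[of 3 4 M]
    by (intro mult_right_mono mult_mono) auto
  also have "\<dots> = (2 * M\<^sup>2 * \<tau>)\<^sup>2" by (simp add: power_mult_distrib flip: power_mult)
  finally show ?thesis using tau M by (simp add: abs_le_square_iff[symmetric] abs_of_nonneg)
qed

text \<open>Coordinates of \<open>d j\<close> in the frame \<open>N j\<close>, \<open>T j\<close>,
  which is orthogonal but not normalised.\<close>

definition "u j = (d j \<bullet> N j) / (norm (T j))\<^sup>2"
definition "s j = (d j \<bullet> T j) / (norm (T j))\<^sup>2"

lemma decomp: "j < J \<Longrightarrow> d j = u j *\<^sub>R N j + s j *\<^sub>R T j"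
  unfolding u_def s_def using norm_T_sq(3) by (rule perp_decomposition)

lemma u_le: assumes j: "j < J" shows "\<bar>u j\<bar> \<le> 6 * M\<^sup>2 * \<tau>"
proof -
  have "\<bar>K j \<bullet> N j\<bar> \<le> M * 1"
    using K[OF j] norm_T_le[OF j] M by (intro order_trans[OF Cauchy_Schwarz_ineq2] mult_mono) auto
  then have "\<bar>\<tau> * (K j \<bullet> N j)\<bar> \<le> \<tau> * M" using tau by (simp add: abs_mult)
  moreover have "\<tau> * M \<le> \<tau> * M\<^sup>2" using tau M by (simp add: power2_eq_square)
  moreover have "d j \<bullet> N j = w j \<bullet> N j + \<tau> * (K j \<bullet> N j)" by (simp add: w_def inner_diff_left)
  ultimately have "\<bar>d j \<bullet> N j\<bar> \<le> 3 * M\<^sup>2 * \<tau>" using w_normal[OF j] by (simp add: mult_ac)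
  moreover have "0 \<le> 3 * M\<^sup>2 * \<tau>" using tau by simp
  ultimately have "\<bar>d j \<bullet> N j\<bar> / (norm (T j))\<^sup>2 \<le> (3 * M\<^sup>2 * \<tau>) / (1/2)"
    using norm_T_sq[OF j] by (intro frac_le) auto
  then show ?thesis by (simp add: u_def abs_divide)
qed

text \<open>The exact part \<tau> \<open>K\<close> is Lipschitz along the polygon; for the error
  part differences are simply bounded by values. Hence there is no factor \<open>h\<close> here, in
  contrast to the corresponding bound for \<open>s\<close>.\<close>

lemma u_diff_sum: "(\<Sum>j<J. (u (nx j) - u j)\<^sup>2) \<le> 144 * M^3 * \<tau>\<^sup>2"
proof -
  define \<xi> where "\<xi> j = N j /\<^sub>R (norm (T j))\<^sup>2" for j
  define \<omega> where "\<omega> j = (w j \<bullet> N j) / (norm (T j))\<^sup>2" for j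
  have u: "u j = \<tau> * (K j \<bullet> \<xi> j) + \<omega> j" for j
    by (simp add: u_def \<xi>_def \<omega>_def w_def inner_diff_left diff_divide_distrib field_simps)
  have \<xi>_le: "norm (\<xi> j) \<le> 2" if "j < J" for j
  proof -
    have "norm (\<xi> j) = norm (T j) / (norm (T j))\<^sup>2" by (simp add: \<xi>_def divide_inverse)
    also have "\<dots> \<le> 1 / (1/2)" using norm_T_le[OF that] norm_T_sq[OF that] by (intro frac_le) auto
    finally show ?thesis by simp
  qed
  have \<xi>_diff: "norm (\<xi> (nx j) - \<xi> j) \<le> 4 * M\<^sup>2 * h" if j: "j < J" for j
  proof -
    let ?a = "T (nx j)" and ?b = "T j"
    have ab: "?a \<noteq> 0" "?b \<noteq> 0" using norm_T_sq(3) j by auto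
    have "norm (\<xi> (nx j) - \<xi> j) = norm (?a - ?b) / (norm ?a * norm ?b)"
      unfolding \<xi>_def using inversion_dist[of "N (nx j)" "N j"] ab by (simp add: perp_diff[symmetric])
    also have "\<dots> \<le> (2 * M\<^sup>2 * h) / (9/10 * (9/10))"
      using T_diff_le[OF j] norm_T_ge[OF j] norm_T_ge[of "nx j"] j M h
      by (intro frac_le mult_mono) auto
    also have "\<dots> \<le> 4 * M\<^sup>2 * h" using h by simp
    finally show ?thesis .
  qed
  have \<omega>_sq: "(\<omega> j)\<^sup>2 \<le> 4 * (w j \<bullet> N j)\<^sup>2" if j: "j < J" for j
  proof -
    have "\<bar>\<omega> j\<bar> \<le> \<bar>w j \<bullet> N j\<bar> / (1/2)"
      unfolding \<omega>_def abs_divide using norm_T_sq[OF j] by (intro frac_le) auto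
    then have "\<bar>\<omega> j\<bar>\<^sup>2 \<le> (2 * \<bar>w j \<bullet> N j\<bar>)\<^sup>2" by (intro power_mono) auto
    then show ?thesis by (simp add: power_mult_distrib)
  qed
  have pt: "(u (nx j) - u j)\<^sup>2 \<le> 2 * (\<tau> * (6 * M^3 * h))\<^sup>2 + (16 * (w (nx j) \<bullet> N (nx j))\<^sup>2 + 16 * (w j \<bullet> N j)\<^sup>2)"
    if j: "j < J" for j
  proof -
    let ?A = "K (nx j) \<bullet> \<xi> (nx j) - K j \<bullet> \<xi> j"
    have "?A = (K (nx j) - K j) \<bullet> \<xi> (nx j) + K j \<bullet> (\<xi> (nx j) - \<xi> j)"
      by (simp add: inner_simps)
    then have "\<bar>?A\<bar> \<le> norm (K (nx j) - K j) * norm (\<xi> (nx j)) + norm (K j) * norm (\<xi> (nx j) - \<xi> j)"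
      by (smt (verit) Cauchy_Schwarz_ineq2)
    also have "\<dots> \<le> (M * h) * 2 + M * (4 * M\<^sup>2 * h)"
      using K_diff[OF j] \<xi>_le[of "nx j"] K[OF j] \<xi>_diff[OF j] j M h by (intro add_mono mult_mono) auto
    also have "\<dots> \<le> 6 * M^3 * h"
    proof -
      have "M * h \<le> M^3 * h" using M h power_increasing[of 1 3 M] by (intro mult_right_mono) auto
      then show ?thesis by (simp add: power2_eq_square power3_eq_cube)
    qed
    finally have "\<bar>\<tau> * ?A\<bar> \<le> \<tau> * (6 * M^3 * h)" using tau by (simp add: abs_mult)
    then have A: "(\<tau> * ?A)\<^sup>2 \<le> (\<tau> * (6 * M^3 * h))\<^sup>2"
      by (meson abs_ge_self abs_le_square_iff order_trans)
    have "(u (nx j) - u j)\<^sup>2 = (\<tau> * ?A + (\<omega> (nx j) - \<omega> j))\<^sup>2" by (simp add: u algebra_simps)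
    also have "\<dots> \<le> 2 * (\<tau> * ?A)\<^sup>2 + 2 * (\<omega> (nx j) - \<omega> j)\<^sup>2"
      using sum_squares_ge_zero[of "\<tau> * ?A - (\<omega> (nx j) - \<omega> j)" 0] by (simp add: power2_eq_square algebra_simps)
    also have "(\<omega> (nx j) - \<omega> j)\<^sup>2 \<le> 2 * (\<omega> (nx j))\<^sup>2 + 2 * (\<omega> j)\<^sup>2"
      using sum_squares_ge_zero[of "\<omega> (nx j) + \<omega> j" 0] by (simp add: power2_eq_square algebra_simps)
    finally show ?thesis using A \<omega>_sq[OF j] \<omega>_sq[of "nx j"] j by simp
  qed
  have "(\<Sum>j<J. (u (nx j) - u j)\<^sup>2) \<le> (\<Sum>j<J. 2 * (\<tau> * (6 * M^3 * h))\<^sup>2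
      + (16 * (w (nx j) \<bullet> N (nx j))\<^sup>2 + 16 * (w j \<bullet> N j)\<^sup>2))"
    using pt by (intro sum_mono) auto
  also have "\<dots> = real J * (2 * (\<tau> * (6 * M^3 * h))\<^sup>2) + 32 * (\<Sum>j<J. (w j \<bullet> N j)\<^sup>2)"
    using sum_nxt[of "\<lambda>j. (w j \<bullet> N j)\<^sup>2" J] by (simp add: sum.distrib sum_distrib_left[symmetric])
  also have "\<dots> \<le> 72 * M^3 * \<tau>\<^sup>2 + 32 * (2 * M^3 * \<tau>\<^sup>2)"
  proof -
    have "real J * (2 * (\<tau> * (6 * M^3 * h))\<^sup>2) = (real J * h) * (72 * \<tau>\<^sup>2 * M\<^sup>2 * (M^4 * h))"
      by (simp add: power2_eq_square power_eq_if)
    also have "\<dots> \<le> M * (72 * \<tau>\<^sup>2 * M\<^sup>2 * 1)"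
      using Jh M_powers(4) M h by (intro mult_mono mult_left_mono) auto
    finally show ?thesis using w_normal_sum by (simp add: power2_eq_square power3_eq_cube mult_ac)
  qed
  also have "\<dots> \<le> 144 * M^3 * \<tau>\<^sup>2" using M by simp
  finally show ?thesis .
qed

section \<open>Tangential component of the displacement\<close>

definition "a j = s j *\<^sub>R T j"
definition "D = sqrt (\<Sum>j<J. (norm (a (nx j) - a j))\<^sup>2 / l j)"
definition "A = (\<Sum>j<J. norm (a (nx j) - a j))"
definition "S = Max ((\<lambda>j. \<bar>s j\<bar>) ` {..<J})"
text \<open>\<open>b j + r j\<close> is \<open>N j \<bullet> T (nx j)\<close> divided by the edge
  length, that is, the turning. \<open>b\<close> comes from the exact curvature and has differences
  O(h); \<open>r\<close> comes from the consistency error and is only square summable.\<close>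

definition "b j = (N j \<bullet> (K j + K (nx j))) / 2"
definition "r j = (N j \<bullet> ((kv j - K j) + (kv (nx j) - K (nx j)))) / 2"

lemma D_nonneg: "0 \<le> D"
  using l_pos by (auto simp: D_def intro!: sum_nonneg divide_nonneg_pos)

lemma D_sq: "D\<^sup>2 = (\<Sum>j<J. (norm (a (nx j) - a j))\<^sup>2 / l j)"
  unfolding D_def using l_pos by (intro real_sqrt_pow2 sum_nonneg divide_nonneg_pos) auto

lemma A_nonneg: "0 \<le> A"
  by (simp add: A_def sum_nonneg)

lemma s_le_S: "j < J \<Longrightarrow> \<bar>s j\<bar> \<le> S"
  unfolding S_def by (intro Max_ge) auto

lemma S_nonneg: "0 \<le> S"
  using s_le_S[OF J] by linarith

lemma A_le_D: "A \<le> M * D"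
proof -
  have "A\<^sup>2 = (\<Sum>j<J. (norm (a (nx j) - a j) / sqrt (l j)) * sqrt (l j))\<^sup>2"
    unfolding A_def using l_pos by (intro arg_cong[of _ _ "\<lambda>x. x\<^sup>2"] sum.cong) (auto simp: less_imp_neq[symmetric])
  also have "\<dots> \<le> (\<Sum>j<J. (norm (a (nx j) - a j) / sqrt (l j))\<^sup>2) * (\<Sum>j<J. (sqrt (l j))\<^sup>2)"
    by (rule Cauchy_Schwarz_ineq_sum)
  also have "(\<Sum>j<J. (norm (a (nx j) - a j) / sqrt (l j))\<^sup>2) = D\<^sup>2"
    unfolding D_sq using l_pos by (intro sum.cong) (auto simp: power_divide less_imp_le)
  also have "(\<Sum>j<J. (sqrt (l j))\<^sup>2) = (\<Sum>j<J. l j)"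
    using l_pos by (intro sum.cong) (auto simp: less_imp_le)
  also have "D\<^sup>2 * (\<Sum>j<J. l j) \<le> D\<^sup>2 * M\<^sup>2"
  proof (rule mult_left_mono)
    have "(\<Sum>j<J. l j) \<le> (\<Sum>j<J. M * h)" using len by (intro sum_mono) auto
    also have "\<dots> = M * (real J * h)" by simp
    also have "\<dots> \<le> M * M" using Jh M by (intro mult_left_mono) auto
    finally show "(\<Sum>j<J. l j) \<le> M\<^sup>2" by (simp add: power2_eq_square)
  qed simp
  finally have "A\<^sup>2 \<le> (M * D)\<^sup>2" unfolding power_mult_distrib by (simp only: mult.commute)
  then show ?thesis by (rule power2_le_imp_le) (use M D_nonneg in simp)
qed

text \<open>A Poincare inequality without a zero-mean condition: a tangential field on a closed
  polygon cannot be a nonzero constant vector. Some vertex \<open>i\<close> has its tangent almost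
  orthogonal to \<open>T j\<close>; taking the component of \<open>a j - a i\<close> along
  \<open>N i\<close> removes \<open>a i\<close> and keeps a fixed fraction of
  \<open>s j\<close>.\<close>

lemma s_le_A: assumes j: "j < J" shows "\<bar>s j\<bar> \<le> 4 * A"
proof -
  let ?e = "T j"
  \<comment> \<open>If the sign never changed, every edge would advance in direction
    \<open>T j\<close> and the polygon could not close.\<close>
  have "\<exists>k<J. 0 < t k \<bullet> ?e \<and> t (nx k) \<bullet> ?e \<le> 0"
  proof (rule ccontr)
    assume neg: "\<not> ?thesis"
    have "1/2 \<le> T j \<bullet> T j" using norm_T_sq(1)[OF j] by (simp add: power2_norm_eq_inner)
    moreover have "\<bar>(T j - t j) \<bullet> T j\<bar> \<le> 1/100 * 1"
      using T_t[OF j] norm_T_le[OF j] M_powers(2)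
      by (intro order_trans[OF Cauchy_Schwarz_ineq2] mult_mono) auto
    ultimately have Pj: "0 < t j \<bullet> ?e" unfolding inner_diff_left by arith
    have pos: "0 < t k \<bullet> ?e" if "k < J" for k
    proof (rule cyclic_induct[where P = "\<lambda>k. 0 < t k \<bullet> ?e", OF Pj j that])
      fix k assume "k < J" "0 < t k \<bullet> ?e"
      then show "0 < t (nx k) \<bullet> ?e" using neg by (meson not_le)
    qed
    have "(\<Sum>k<J. l k * (t k \<bullet> ?e)) = (\<Sum>k<J. q (nx k) \<bullet> ?e) - (\<Sum>k<J. q k \<bullet> ?e)"
      unfolding sum_subtractf[symmetric] using l_pos
      by (intro sum.cong) (auto simp: edge_tangent_def inner_diff_left less_imp_neq[symmetric])
    then have "(\<Sum>k<J. l k * (t k \<bullet> ?e)) = 0" using sum_nxt[of "\<lambda>k. q k \<bullet> ?e" J] by simp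
    moreover have "0 < (\<Sum>k<J. l k * (t k \<bullet> ?e))"
      using pos l_pos J by (intro sum_pos) auto
    ultimately show False by simp
  qed
  then obtain k where k: "k < J" "0 < t k \<bullet> ?e" "t (nx k) \<bullet> ?e \<le> 0" by blast
  define i where "i = nx k"
  have i: "i < J" and pvi: "pv i = k" using k by (auto simp: i_def)
  have "\<bar>(t i - t k) \<bullet> ?e\<bar> \<le> 2/100 * 1"
    using t_diff[OF i] pvi norm_T_le[OF j] M_powers(2)
    by (intro order_trans[OF Cauchy_Schwarz_ineq2] mult_mono) auto
  then have "\<bar>t i \<bullet> ?e\<bar> \<le> 2/100" using k by (simp add: i_def inner_diff_left)
  moreover have "\<bar>(T i - t i) \<bullet> ?e\<bar> \<le> 1/100 * 1"
    using T_t[OF i] norm_T_le[OF j] M_powers(2)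
    by (intro order_trans[OF Cauchy_Schwarz_ineq2] mult_mono) auto
  ultimately have "\<bar>T i \<bullet> T j\<bar> \<le> 3/100" unfolding inner_diff_left by arith
  then have "\<bar>T j \<bullet> T i\<bar> \<le> 3/100" by (simp only: inner_commute)
  then have "\<bar>T j \<bullet> T i\<bar>\<^sup>2 \<le> (3/100)\<^sup>2" by (intro power_mono) auto
  then have "(T j \<bullet> T i)\<^sup>2 \<le> (3/100)\<^sup>2" by simp
  moreover have "1/2 * (1/2) \<le> (norm (T j))\<^sup>2 * (norm (T i))\<^sup>2"
    using norm_T_sq(1)[OF i] norm_T_sq(1)[OF j] by (intro mult_mono) auto
  \<comment> \<open>The part of \<open>T j\<close> along \<open>T i\<close> is tiny, so by
    Pythagoras almost all of \<open>T j\<close> lies along \<open>N i\<close>.\<close>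
  ultimately have "(1/4)\<^sup>2 \<le> (T j \<bullet> N i)\<^sup>2"
    using perp_pythagoras[of "T j" "T i"] by (simp add: power2_eq_square)
  then have "\<bar>1/4\<bar> \<le> \<bar>T j \<bullet> N i\<bar>" by (simp only: abs_le_square_iff)
  then have "\<bar>s j\<bar> * (1/4) \<le> \<bar>s j\<bar> * \<bar>T j \<bullet> N i\<bar>" by (intro mult_left_mono) auto
  also have "\<dots> = \<bar>(a j - a i) \<bullet> N i\<bar>" by (simp add: a_def inner_diff_left abs_mult)
  also have "\<dots> \<le> norm (a j - a i) * 1"
    using norm_T_le[OF i] by (intro order_trans[OF Cauchy_Schwarz_ineq2] mult_left_mono) auto
  also have "\<dots> \<le> A" unfolding A_def using cyclic_dist_le_sum[OF i j, of a] by simp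
  finally show ?thesis by simp
qed

lemma S_le_A: "S \<le> 4 * A"
  unfolding S_def using s_le_A J by (intro Max.boundedI) auto

lemma s_diff: assumes j: "j < J" shows "\<bar>s (nx j) - s j\<bar> \<le> 2 * norm (a (nx j) - a j) + 4 * M\<^sup>2 * h * S"
proof -
  have "a (nx j) - a j = (s (nx j) - s j) *\<^sub>R T j + s (nx j) *\<^sub>R (T (nx j) - T j)"
    by (simp add: a_def algebra_simps)
  then have "(s (nx j) - s j) *\<^sub>R T j = (a (nx j) - a j) - s (nx j) *\<^sub>R (T (nx j) - T j)"
    by simp
  then have "norm ((s (nx j) - s j) *\<^sub>R T j) \<le> norm (a (nx j) - a j) + norm (s (nx j) *\<^sub>R (T (nx j) - T j))"
    by (metis norm_triangle_ineq4)
  moreover have "norm (s (nx j) *\<^sub>R (T (nx j) - T j)) \<le> S * (2 * M\<^sup>2 * h)"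
    using s_le_S[of "nx j"] T_diff_le[OF j] j S_nonneg by (simp add: mult_mono)
  moreover have "\<bar>s (nx j) - s j\<bar> * (9/10) \<le> norm ((s (nx j) - s j) *\<^sub>R T j)"
    unfolding norm_scaleR using norm_T_ge[OF j] by (intro mult_left_mono) auto
  ultimately have "\<bar>s (nx j) - s j\<bar> * (9/10) \<le> norm (a (nx j) - a j) + S * (2 * M\<^sup>2 * h)" by linarith
  then have "\<bar>s (nx j) - s j\<bar> \<le> 2 * (norm (a (nx j) - a j) + S * (2 * M\<^sup>2 * h))"
    using abs_ge_zero[of "s (nx j) - s j"] by argo
  then show ?thesis by (simp add: algebra_simps)
qed

lemma s_diff_sum: "(\<Sum>j<J. \<bar>s (nx j) - s j\<bar>) \<le> 2 * A + 4 * M^3 * S"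
proof -
  have "(\<Sum>j<J. \<bar>s (nx j) - s j\<bar>) \<le> (\<Sum>j<J. 2 * norm (a (nx j) - a j) + 4 * M\<^sup>2 * h * S)"
    using s_diff by (intro sum_mono) auto
  also have "\<dots> = 2 * A + 4 * M\<^sup>2 * S * (real J * h)"
    by (simp add: sum.distrib A_def sum_distrib_left)
  also have "\<dots> \<le> 2 * A + 4 * M\<^sup>2 * S * M" using Jh S_nonneg M by (intro add_left_mono mult_left_mono) auto
  finally show ?thesis by (simp add: power2_eq_square power3_eq_cube mult_ac)
qed

text \<open>Tangential test functions do not see the mass term, and the coupling with the normal
  component only involves the turning of the polygon.\<close>

lemma tangential_energy:
  "D\<^sup>2 = - (\<Sum>j<J. (b j + r j) * (s j * u (nx j) - s (nx j) * u j))"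
proof -
  have orth: "a j \<bullet> N j = 0" for j by (simp add: a_def)
  have "(\<Sum>j<J. ((d (nx j) - d j) \<bullet> (a (nx j) - a j)) / l j) = 0"
    using weak[of a] unfolding orth by simp
  moreover have "((d (nx j) - d j) \<bullet> (a (nx j) - a j)) / l j
      = (norm (a (nx j) - a j))\<^sup>2 / l j + (b j + r j) * (s j * u (nx j) - s (nx j) * u j)" if j: "j < J" for j
  proof -
    have "N j \<bullet> T (nx j) = N j \<bullet> (T (nx j) - T j)" by (simp add: inner_diff_right)
    also have "\<dots> = l j * (b j + r j)"
      unfolding T_diff[OF j] b_def r_def
      by (simp add: inner_add_right inner_diff_right add_divide_distrib diff_divide_distrib algebra_simps)
    finally have NT: "N j \<bullet> T (nx j) = l j * (b j + r j)" .
    \<comment> \<open>The products at equal nodes vanish, and rotation is antisymmetric: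
      \<open>N (nx j) \<bullet> T j\<close> is the negative of
      \<open>N j \<bullet> T (nx j)\<close>. One scalar therefore carries the whole
      coupling.\<close>
    have "(u (nx j) *\<^sub>R N (nx j) - u j *\<^sub>R N j) \<bullet> (a (nx j) - a j)
        = (s j * u (nx j) - s (nx j) * u j) * (N j \<bullet> T (nx j))"
      by (simp add: a_def inner_diff_left inner_diff_right inner_perp_swap[of "T (nx j)"] inner_commute[of "T (nx j)"] algebra_simps)
    moreover have "d (nx j) - d j = (u (nx j) *\<^sub>R N (nx j) - u j *\<^sub>R N j) + (a (nx j) - a j)"
      using decomp[OF j] decomp[of "nx j"] j by (simp add: a_def)
    ultimately have "(d (nx j) - d j) \<bullet> (a (nx j) - a j)
        = (s j * u (nx j) - s (nx j) * u j) * (l j * (b j + r j)) + (norm (a (nx j) - a j))\<^sup>2"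
      unfolding NT power2_norm_eq_inner by (simp only: inner_add_left)
    then show ?thesis using l_pos[OF j] by (simp add: field_simps)
  qed
  ultimately have "(\<Sum>j<J. (norm (a (nx j) - a j))\<^sup>2 / l j
      + (b j + r j) * (s j * u (nx j) - s (nx j) * u j)) = 0" by simp
  then show ?thesis unfolding D_sq by (simp add: sum.distrib)
qed

lemma b_le: assumes j: "j < J" shows "\<bar>b j\<bar> \<le> M"
proof -
  have "\<bar>N j \<bullet> (K j + K (nx j))\<bar> \<le> 1 * (M + M)"
    using norm_T_le[OF j] K[OF j] K[of "nx j"] j M
    by (intro order_trans[OF Cauchy_Schwarz_ineq2] mult_mono norm_triangle_le) auto
  then show ?thesis by (simp add: b_def)
qed

lemma b_diff: assumes j: "j < J" shows "\<bar>b (nx j) - b j\<bar> \<le> 3 * M^3 * h"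
proof -
  let ?i = "nx j"
  have i: "?i < J" "nx ?i < J" using j by auto
  have "2 * (b ?i - b j) = perp (T ?i - T j) \<bullet> (K ?i + K (nx ?i)) + N j \<bullet> ((K ?i - K j) + (K (nx ?i) - K ?i))"
    by (simp add: b_def perp_diff inner_add_right inner_diff_right inner_diff_left add_divide_distrib)
  moreover have "\<bar>perp (T ?i - T j) \<bullet> (K ?i + K (nx ?i))\<bar> \<le> (2 * M\<^sup>2 * h) * (M + M)"
    using T_diff_le[OF j] K[of ?i] K[of "nx ?i"] i M h
    by (intro order_trans[OF Cauchy_Schwarz_ineq2] mult_mono norm_triangle_le) auto
  moreover have "\<bar>N j \<bullet> ((K ?i - K j) + (K (nx ?i) - K ?i))\<bar> \<le> 1 * (M * h + M * h)"
    using norm_T_le[OF j] K_diff[OF j] K_diff[of ?i] i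
    by (intro order_trans[OF Cauchy_Schwarz_ineq2] mult_mono norm_triangle_le) auto
  ultimately have "\<bar>b ?i - b j\<bar> \<le> 2 * M\<^sup>2 * h * M + M * h" by (simp add: abs_le_iff)
  also have "\<dots> \<le> 3 * M^3 * h"
  proof -
    have "M * h \<le> M^3 * h" using M h power_increasing[of 1 3 M] by (intro mult_right_mono) auto
    then show ?thesis by (simp add: power2_eq_square power3_eq_cube)
  qed
  finally show ?thesis .
qed

lemma r_le: assumes j: "j < J" shows "\<bar>r j\<bar> \<le> M"
proof -
  have "\<bar>N j \<bullet> ((kv j - K j) + (kv (nx j) - K (nx j)))\<bar> \<le> 1 * (M + M)"
    using norm_T_le[OF j] kv_K[OF j] kv_K[of "nx j"] j M
    by (intro order_trans[OF Cauchy_Schwarz_ineq2] mult_mono norm_triangle_le) auto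
  then show ?thesis by (simp add: r_def)
qed

lemma r_sum: "(\<Sum>j<J. (r j)\<^sup>2) \<le> M"
proof -
  have "(r j)\<^sup>2 \<le> ((norm (kv j - K j))\<^sup>2 + (norm (kv (nx j) - K (nx j)))\<^sup>2) / 2" if j: "j < J" for j
  proof -
    let ?x = "norm (kv j - K j)" and ?y = "norm (kv (nx j) - K (nx j))"
    have "\<bar>N j \<bullet> ((kv j - K j) + (kv (nx j) - K (nx j)))\<bar> \<le> 1 * (?x + ?y)"
      using norm_T_le[OF j]
      by (intro order_trans[OF Cauchy_Schwarz_ineq2] mult_mono norm_triangle_le) auto
    then have "\<bar>r j\<bar>\<^sup>2 \<le> ((?x + ?y) / 2)\<^sup>2" by (intro power_mono) (auto simp: r_def)
    moreover have "((?x + ?y) / 2)\<^sup>2 \<le> (?x\<^sup>2 + ?y\<^sup>2) / 2"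
      using zero_le_power2[of "?x - ?y"] by (simp add: power2_eq_square field_simps)
    ultimately show ?thesis by simp
  qed
  then have "(\<Sum>j<J. (r j)\<^sup>2) \<le> (\<Sum>j<J. ((norm (kv j - K j))\<^sup>2 + (norm (kv (nx j) - K (nx j)))\<^sup>2) / 2)"
    by (intro sum_mono) auto
  also have "\<dots> = (\<Sum>j<J. (norm (kv j - K j))\<^sup>2)"
    using sum_nxt[of "\<lambda>j. (norm (kv j - K j))\<^sup>2" J] by (simp add: sum.distrib add_divide_distrib sum_divide_distrib[symmetric])
  finally show ?thesis using K_err by simp
qed

text \<open>Since the differences of \<open>u\<close> are square summable without a factor
  \<open>h\<close>, Cauchy-Schwarz may be applied to them only against the square summable
  \<open>r\<close>. Against the merely bounded \<open>b\<close> it would lose the square root of the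
  number of nodes, so there the differences are shifted onto \<open>b\<close> and
  \<open>s\<close>.\<close>

lemma D_sq_le: "D\<^sup>2 \<le> \<tau> * (30 * M^6 * S + 18 * M^3 * (2 * A + 4 * M^3 * S))"
proof -
  let ?A1 = "\<Sum>j<J. \<bar>s (nx j) - s j\<bar>"
  \<comment> \<open>Rough turning against differences of \<open>u\<close>: both factors are in l2,
    and \<open>s\<close> is replaced by its maximum.\<close>
  have 1: "\<bar>\<Sum>j<J. r j * (s j * (u (nx j) - u j))\<bar> \<le> 12 * M\<^sup>2 * \<tau> * S"
  proof -
    have "(\<Sum>j<J. \<bar>r j\<bar> * \<bar>u (nx j) - u j\<bar>)\<^sup>2 \<le> (\<Sum>j<J. \<bar>r j\<bar>\<^sup>2) * (\<Sum>j<J. \<bar>u (nx j) - u j\<bar>\<^sup>2)"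
      by (rule Cauchy_Schwarz_ineq_sum)
    also have "\<dots> \<le> M * (144 * M^3 * \<tau>\<^sup>2)"
      using r_sum u_diff_sum M by (intro mult_mono sum_nonneg) auto
    also have "\<dots> = (12 * M\<^sup>2 * \<tau>)\<^sup>2" by (simp add: power_eq_if)
    finally have "(\<Sum>j<J. \<bar>r j\<bar> * \<bar>u (nx j) - u j\<bar>) \<le> 12 * M\<^sup>2 * \<tau>"
      by (rule power2_le_imp_le) (use tau in simp)
    then have "S * (\<Sum>j<J. \<bar>r j\<bar> * \<bar>u (nx j) - u j\<bar>) \<le> S * (12 * M\<^sup>2 * \<tau>)"
      using S_nonneg by (rule mult_left_mono)
    moreover have "\<bar>\<Sum>j<J. r j * (s j * (u (nx j) - u j))\<bar> \<le> (\<Sum>j<J. S * (\<bar>r j\<bar> * \<bar>u (nx j) - u j\<bar>))"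
    proof (intro order_trans[OF sum_abs] sum_mono)
      fix j assume "j \<in> {..<J}"
      then have "\<bar>s j\<bar> * (\<bar>r j\<bar> * \<bar>u (nx j) - u j\<bar>) \<le> S * (\<bar>r j\<bar> * \<bar>u (nx j) - u j\<bar>)"
        using s_le_S by (intro mult_right_mono) auto
      then show "\<bar>r j * (s j * (u (nx j) - u j))\<bar> \<le> S * (\<bar>r j\<bar> * \<bar>u (nx j) - u j\<bar>)"
        by (simp add: abs_mult mult_ac)
    qed
    ultimately show ?thesis by (simp add: sum_distrib_left mult_ac)
  qed
  have 2: "\<bar>\<Sum>j<J. r j * (u j * (s (nx j) - s j))\<bar> \<le> 6 * M^3 * \<tau> * ?A1"
    unfolding sum_distrib_left
  proof (intro order_trans[OF sum_abs] sum_mono)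
    fix j assume j: "j \<in> {..<J}"
    have "\<bar>r j\<bar> * \<bar>u j\<bar> \<le> M * (6 * M\<^sup>2 * \<tau>)"
      using r_le u_le j M by (intro mult_mono) auto
    then have "\<bar>r j\<bar> * \<bar>u j\<bar> * \<bar>s (nx j) - s j\<bar> \<le> M * (6 * M\<^sup>2 * \<tau>) * \<bar>s (nx j) - s j\<bar>"
      by (rule mult_right_mono) simp
    then show "\<bar>r j * (u j * (s (nx j) - s j))\<bar> \<le> 6 * M^3 * \<tau> * \<bar>s (nx j) - s j\<bar>"
      by (simp add: abs_mult power2_eq_square power3_eq_cube mult_ac)
  qed
  \<comment> \<open>Summation by parts. After reindexing the second sum, every term has the factor
    \<open>u (nx j)\<close>, which is O(\<tau>) pointwise, and a difference of \<open>b\<close> or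
    of \<open>s\<close>.\<close>
  have "(\<Sum>j<J. b j * (s j * u (nx j) - s (nx j) * u j))
      = (\<Sum>j<J. b j * s j * u (nx j)) - (\<Sum>j<J. b j * s (nx j) * u j)"
    by (simp add: sum_subtractf[symmetric] algebra_simps)
  also have "(\<Sum>j<J. b j * s (nx j) * u j) = (\<Sum>j<J. b (nx j) * s (nx (nx j)) * u (nx j))"
    by (rule sum_nxt[symmetric])
  finally have "(\<Sum>j<J. b j * (s j * u (nx j) - s (nx j) * u j))
     = (\<Sum>j<J. u (nx j) * ((b j - b (nx j)) * s j - b (nx j) * ((s (nx j) - s j) + (s (nx (nx j)) - s (nx j)))))"
    by (simp add: sum_subtractf[symmetric] algebra_simps)
  moreover have "\<bar>u (nx j) * ((b j - b (nx j)) * s j - b (nx j) * ((s (nx j) - s j) + (s (nx (nx j)) - s (nx j))))\<bar>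
      \<le> 6 * M\<^sup>2 * \<tau> * (3 * M^3 * h * S + M * (\<bar>s (nx j) - s j\<bar> + \<bar>s (nx (nx j)) - s (nx j)\<bar>))" if j: "j < J" for j
  proof -
    have "\<bar>(b j - b (nx j)) * s j\<bar> \<le> 3 * M^3 * h * S"
      unfolding abs_mult using b_diff[OF j] s_le_S[OF j] M h by (intro mult_mono) auto
    moreover have "\<bar>b (nx j) * ((s (nx j) - s j) + (s (nx (nx j)) - s (nx j)))\<bar>
        \<le> M * (\<bar>s (nx j) - s j\<bar> + \<bar>s (nx (nx j)) - s (nx j)\<bar>)"
      unfolding abs_mult using b_le[of "nx j"] j M by (intro mult_mono abs_triangle_ineq) auto
    ultimately have "\<bar>(b j - b (nx j)) * s j - b (nx j) * ((s (nx j) - s j) + (s (nx (nx j)) - s (nx j)))\<bar>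
        \<le> 3 * M^3 * h * S + M * (\<bar>s (nx j) - s j\<bar> + \<bar>s (nx (nx j)) - s (nx j)\<bar>)" by linarith
    then show ?thesis unfolding abs_mult[of "u (nx j)"]
      using u_le[of "nx j"] j tau M by (intro mult_mono) auto
  qed
  ultimately have "\<bar>\<Sum>j<J. b j * (s j * u (nx j) - s (nx j) * u j)\<bar>
      \<le> (\<Sum>j<J. 6 * M\<^sup>2 * \<tau> * (3 * M^3 * h * S + M * (\<bar>s (nx j) - s j\<bar> + \<bar>s (nx (nx j)) - s (nx j)\<bar>)))"
    by (auto intro!: order_trans[OF sum_abs] sum_mono)
  also have "\<dots> = 6 * M\<^sup>2 * \<tau> * (3 * M^3 * S * (real J * h) + M * (?A1 + ?A1))"
    unfolding sum_distrib_left[symmetric] sum.distrib sum_nxt[of "\<lambda>j. \<bar>s (nx j) - s j\<bar>" J] by (simp add: mult_ac)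
  also have "\<dots> \<le> 6 * M\<^sup>2 * \<tau> * (3 * M^3 * S * M + M * (?A1 + ?A1))"
    using Jh S_nonneg M tau by (intro mult_left_mono add_right_mono) auto
  finally have 3: "\<bar>\<Sum>j<J. b j * (s j * u (nx j) - s (nx j) * u j)\<bar> \<le> 18 * M^6 * \<tau> * S + 12 * M^3 * \<tau> * ?A1"
    by (simp add: power_eq_if algebra_simps)
  have "D\<^sup>2 = - ((\<Sum>j<J. b j * (s j * u (nx j) - s (nx j) * u j))
      + (\<Sum>j<J. r j * (s j * (u (nx j) - u j))) - (\<Sum>j<J. r j * (u j * (s (nx j) - s j))))"
    unfolding tangential_energy sum.distrib[symmetric] sum_subtractf[symmetric]
    by (intro arg_cong[of _ _ uminus] sum.cong refl) (simp add: algebra_simps)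
  then have "D\<^sup>2 \<le> 12 * M\<^sup>2 * \<tau> * S + 6 * M^3 * \<tau> * ?A1 + (18 * M^6 * \<tau> * S + 12 * M^3 * \<tau> * ?A1)"
    using 1 2 3 by linarith
  also have "12 * M\<^sup>2 * \<tau> * S \<le> 12 * M^6 * \<tau> * S"
    using M tau S_nonneg by (intro mult_right_mono mult_left_mono power_increasing) auto
  finally have "D\<^sup>2 \<le> 30 * M^6 * \<tau> * S + 18 * M^3 * \<tau> * ?A1" by (simp add: algebra_simps)
  also have "\<dots> \<le> 30 * M^6 * \<tau> * S + 18 * M^3 * \<tau> * (2 * A + 4 * M^3 * S)"
    using s_diff_sum M tau by (intro add_left_mono mult_left_mono) auto
  finally show ?thesis by (simp add: algebra_simps)
qed

text \<open>\<open>S\<close> is controlled by the total variation \<open>A\<close>, and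
  \<open>A\<close> by \<open>D\<close>, so the right side of the energy estimate is linear in
  \<open>D\<close> and one factor \<open>D\<close> can be divided out.\<close>

lemma D_le: "D \<le> 444 * M^7 * \<tau>"
proof -
  have "D\<^sup>2 \<le> \<tau> * (30 * M^6 * (4 * A) + 18 * M^3 * (2 * A + 4 * M^3 * (4 * A)))"
    using S_le_A M tau by (intro order_trans[OF D_sq_le] mult_left_mono add_mono) auto
  also have "\<dots> = \<tau> * A * (408 * M^6 + 36 * M^3)" by (simp add: power_eq_if algebra_simps)
  also have "\<dots> \<le> \<tau> * A * (408 * M^6 + 36 * M^6)"
    using M tau A_nonneg by (intro mult_left_mono add_left_mono power_increasing) auto
  also have "\<dots> = (444 * M^6 * \<tau>) * A" by simp
  also have "\<dots> \<le> (444 * M^6 * \<tau>) * (M * D)" using A_le_D tau by (intro mult_left_mono) auto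
  finally have "D * D \<le> (444 * M^7 * \<tau>) * D" by (simp add: power_eq_if mult_ac)
  then show ?thesis using D_nonneg tau M by (cases "D = 0") auto
qed

lemma s_le: assumes "j < J" shows "\<bar>s j\<bar> \<le> 1776 * M^8 * \<tau>"
proof -
  have "\<bar>s j\<bar> \<le> 4 * (M * (444 * M^7 * \<tau>))"
    using s_le_A[OF assms] A_le_D D_le M by (smt (verit, best) mult_left_mono)
  then show ?thesis by (simp add: power_eq_if mult_ac)
qed

text \<open>The factor \<open>h\<close> appears because the Dirichlet sum \<open>D\<close> carries
  the inverse edge lengths. The constant rounds up 520 times the square of 444.\<close>

lemma s_diff_sq_sum: "(\<Sum>j<J. (s (nx j) - s j)\<^sup>2) \<le> 110000000 * M^21 * h * \<tau>\<^sup>2"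
proof -
  have S: "S \<le> 4 * M * D" using S_le_A A_le_D by simp
  have "(s (nx j) - s j)\<^sup>2 \<le> 8 * (M * h) * ((norm (a (nx j) - a j))\<^sup>2 / l j) + 32 * M^4 * h\<^sup>2 * S\<^sup>2" if j: "j < J" for j
  proof -
    have "\<bar>s (nx j) - s j\<bar>\<^sup>2 \<le> (2 * norm (a (nx j) - a j) + 4 * M\<^sup>2 * h * S)\<^sup>2"
      using s_diff[OF j] by (intro power_mono) auto
    also have "\<dots> \<le> 2 * (2 * norm (a (nx j) - a j))\<^sup>2 + 2 * (4 * M\<^sup>2 * h * S)\<^sup>2"
      using zero_le_power2[of "2 * norm (a (nx j) - a j) - 4 * M\<^sup>2 * h * S"]
      by (simp add: power2_eq_square algebra_simps)
    finally have "(s (nx j) - s j)\<^sup>2 \<le> 8 * (norm (a (nx j) - a j))\<^sup>2 + 32 * M^4 * h\<^sup>2 * S\<^sup>2"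
      by (simp add: power_mult_distrib flip: power_mult)
    also have "(norm (a (nx j) - a j))\<^sup>2 = l j * ((norm (a (nx j) - a j))\<^sup>2 / l j)"
      using l_pos[OF j] by simp
    also have "\<dots> \<le> (M * h) * ((norm (a (nx j) - a j))\<^sup>2 / l j)"
      using len[OF j] l_pos[OF j] by (intro mult_right_mono) auto
    finally show ?thesis by simp
  qed
  then have "(\<Sum>j<J. (s (nx j) - s j)\<^sup>2) \<le> (\<Sum>j<J. 8 * (M * h) * ((norm (a (nx j) - a j))\<^sup>2 / l j) + 32 * M^4 * h\<^sup>2 * S\<^sup>2)"
    by (intro sum_mono) auto
  also have "\<dots> = 8 * (M * h) * D\<^sup>2 + 32 * M^4 * h * S\<^sup>2 * (real J * h)"
    unfolding sum.distrib sum_distrib_left[symmetric] D_sq[symmetric] by (simp add: power2_eq_square)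
  also have "\<dots> \<le> 8 * (M * h) * D\<^sup>2 + 32 * M^4 * h * (4 * M * D)\<^sup>2 * M"
    using Jh S S_nonneg M h by (intro add_left_mono mult_mono power_mono) auto
  also have "\<dots> = (8 * M + 512 * M^7) * (h * D\<^sup>2)" by (simp add: power_eq_if algebra_simps)
  also have "\<dots> \<le> (8 * M^7 + 512 * M^7) * (h * (444 * M^7 * \<tau>)\<^sup>2)"
    using M h D_le D_nonneg power_increasing[of 1 7 M]
    by (intro mult_mono add_mono power_mono) auto
  also have "\<dots> = 102510720 * M^21 * h * \<tau>\<^sup>2" by (simp add: power_mult_distrib power_eq_if)
  also have "\<dots> \<le> 110000000 * M^21 * h * \<tau>\<^sup>2" using M h by (intro mult_right_mono) auto
  finally show ?thesis .
qed

end

section \<open>Outward normals of a simple polygon\<close>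

lemma simple_polygon_inj:
  assumes "simple_polygon J q" "i < J" "j < J" "0 \<le> r" "r < 1" "0 \<le> s" "s < 1" "fe J q i r = fe J q j s"
  shows "i = j \<and> r = s"
proof -
  have "inj_on (\<lambda>(j, s). fe J q j s) ({..<J} \<times> {0..<1})" using assms(1) by (simp add: simple_polygon_def)
  then have "(i, r) = (j, s)" by (rule inj_onD) (use assms in auto)
  then show ?thesis by simp
qed

lemma fe_0 [simp]: "fe J q j 0 = q j" and fe_1 [simp]: "fe J q j 1 = q (nxt J j)"
  by (simp_all add: fe_def)

lemma simple_polygon_vertices_distinct:
  assumes "simple_polygon J q" "i < J" "j < J" "q i = q j"
  shows "i = j"
  using simple_polygon_inj[OF assms(1-3), of 0 0] assms(4) by simp

lemma simple_polygon_elen_pos: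
  assumes "simple_polygon J q" "j < J"
  shows "0 < elen J q j"
proof -
  have "nxt J j \<noteq> j" using assms by (auto simp: nxt_cases simple_polygon_def)
  then show ?thesis
    using simple_polygon_vertices_distinct[of J q j "nxt J j"] assms by (auto simp: elen_def)
qed

lemma closed_segment_fe: "closed_segment (q j) (q (nxt J j)) = fe J q j ` {0..1}"
  by (auto simp: closed_segment_def fe_def)

lemma in_polygon_iff: "y \<in> polygon J q \<longleftrightarrow> (\<exists>j<J. \<exists>s\<in>{0..1}. y = fe J q j s)"
  by (auto simp: polygon_def closed_segment_fe)

lemma simple_polygon_path:
  assumes q: "simple_polygon J q"
  obtains \<gamma> where "simple_path \<gamma>" "path_image \<gamma> = polygon J q" "pathfinish \<gamma> = pathstart \<gamma>"
proof
  have J: "3 \<le> J" using q by (simp add: simple_polygon_def)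
  \<comment> \<open>A sum of clamped ramps: edge \<open>j\<close> is traversed while
    \<open>real J * s\<close> runs from \<open>j\<close> to \<open>j + 1\<close>. Continuity is then
    immediate, with no joining of pieces.\<close>
  define \<gamma> :: "real \<Rightarrow> real^2" where
    "\<gamma> s = q 0 + (\<Sum>j<J. max 0 (min 1 (real J * s - real j)) *\<^sub>R (q (nxt J j) - q j))" for s
  have on_edge: "\<gamma> ((real i + r) / real J) = fe J q i r" if i: "i < J" and r: "0 \<le> r" "r < 1" for i r
  proof -
    let ?c = "\<lambda>j. max 0 (min 1 (real i + r - real j)) *\<^sub>R (q (nxt J j) - q j)"
    have "(\<Sum>j<J. ?c j) = (\<Sum>j<Suc i. ?c j)"
      using i r by (intro sum.mono_neutral_right) (auto simp: max_def min_def)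
    also have "\<dots> = (\<Sum>j<i. q (Suc j) - q j) + r *\<^sub>R (q (nxt J i) - q i)"
      using i r by (simp add: nxt_cases max_def min_def)
    also have "(\<Sum>j<i. q (Suc j) - q j) = q i - q 0" by (rule sum_lessThan_telescope)
    finally have "(\<Sum>j<J. ?c j) = q i - q 0 + r *\<^sub>R (q (nxt J i) - q i)" .
    moreover have "real J * ((real i + r) / real J) = real i + r" using J by simp
    ultimately have "\<gamma> ((real i + r) / real J) = q 0 + (q i - q 0 + r *\<^sub>R (q (nxt J i) - q i))"
      unfolding \<gamma>_def by simp
    then show ?thesis by (simp add: fe_def algebra_simps)
  qed
  have param: "\<exists>i r. i < J \<and> 0 \<le> r \<and> r < 1 \<and> s = (real i + r) / real J" if s: "0 \<le> s" "s < 1" for s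
  proof (intro exI conjI)
    let ?i = "nat \<lfloor>real J * s\<rfloor>"
    have nn: "0 \<le> real J * s" and lt: "real J * s < real J" using s J by auto
    have fl: "real ?i \<le> real J * s" "real J * s < real ?i + 1" using nn by linarith+
    from fl(1) show "0 \<le> real J * s - ?i" by simp
    from fl(2) show "real J * s - ?i < 1" by linarith
    show "?i < J" using nn lt by linarith
    show "s = (real ?i + (real J * s - ?i)) / real J" using J by simp
  qed
  have g0: "\<gamma> 0 = q 0" using on_edge[of 0 0] J by simp
  have g1: "\<gamma> 1 = q 0"
  proof -
    have "(\<Sum>j<J. max 0 (min 1 (real J * 1 - real j)) *\<^sub>R (q (nxt J j) - q j)) = (\<Sum>j<J. q (nxt J j) - q j)"
      by (intro sum.cong) (auto simp: max_def min_def)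
    then show ?thesis using sum_nxt[of q J] by (simp add: \<gamma>_def sum_subtractf)
  qed
  have inj: "x = y" if xy: "0 \<le> x" "x < 1" "0 \<le> y" "y < 1" "\<gamma> x = \<gamma> y" for x y
  proof -
    obtain i r where "i < J" "0 \<le> r" "r < 1" "x = (real i + r) / real J"
      using param[of x] xy by blast
    moreover obtain k s where "k < J" "0 \<le> s" "s < 1" "y = (real k + s) / real J"
      using param[of y] xy by blast
    ultimately
    show ?thesis using simple_polygon_inj[OF q, of i k r s] on_edge xy by simp
  qed
  have "continuous_on {0..1} \<gamma>" unfolding \<gamma>_def by (intro continuous_intros)
  moreover have "loop_free \<gamma>"
    unfolding loop_free_def
  proof (intro ballI impI)
    fix x y :: real assume xy: "x \<in> {0..1}" "y \<in> {0..1}" "\<gamma> x = \<gamma> y"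
    then have "x < 1 \<or> x = 1" "y < 1 \<or> y = 1" by auto
    then consider "x < 1" "y < 1" | "x = 1" "y = 1" | "x = 1" "y < 1" | "x < 1" "y = 1" by blast
    then show "x = y \<or> x = 0 \<and> y = 1 \<or> x = 1 \<and> y = 0"
    proof cases
      case 1
      then show ?thesis using inj[OF _ 1(1) _ 1(2) xy(3)] xy(1,2) by simp
    next
      case 3
      then have "\<gamma> 0 = \<gamma> y" using xy(3) g0 g1 by simp
      then show ?thesis using inj[OF _ _ _ 3(2), of 0] xy(2) 3(1) by simp
    next
      case 4
      then have "\<gamma> x = \<gamma> 0" using xy(3) g0 g1 by simp
      then show ?thesis using inj[OF _ 4(1), of 0] xy(1) 4(2) by simp
    qed simp
  qed
  ultimately show "simple_path \<gamma>" by (simp add: simple_path_def path_def)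
  show "pathfinish \<gamma> = pathstart \<gamma>" by (simp add: pathfinish_def pathstart_def g0 g1)
  show "path_image \<gamma> = polygon J q"
  proof (intro equalityI subsetI)
    fix y assume "y \<in> path_image \<gamma>"
    then obtain s where s: "0 \<le> s" "s \<le> 1" "y = \<gamma> s" by (auto simp: path_image_def)
    show "y \<in> polygon J q"
    proof (cases "s = 1")
      case True
      then have "y = fe J q 0 0" using s g1 by simp
      then show ?thesis unfolding in_polygon_iff using J by (intro exI[of _ 0] conjI bexI[of _ 0]) auto
    next
      case False
      then obtain i r where "i < J" "0 \<le> r" "r < 1" "s = (real i + r) / real J" using param[of s] s by auto
      then show ?thesis unfolding in_polygon_iff using on_edge[of i r] s by (intro exI[of _ i]) auto
    qed
  next
    fix y assume "y \<in> polygon J q"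
    then obtain j s where js: "j < J" "0 \<le> s" "s \<le> 1" "y = fe J q j s" by (auto simp: in_polygon_iff)
    \<comment> \<open>Injectivity is stated for half-open edges, so the end of an edge is reread as
      the start of the next one.\<close>
    define i where "i = (if s = 1 then nxt J j else j)"
    define r where "r = (if s = 1 then 0 else s)"
    have ir: "i < J" "0 \<le> r" "r < 1" "y = fe J q i r" using js by (auto simp: i_def r_def)
    have "real i + r \<le> real J" using ir by linarith
    then show "y \<in> path_image \<gamma>" unfolding path_image_def
      using ir on_edge[of i r] J by (intro image_eqI[of _ _ "(real i + r) / real J"]) auto
  qed
qed

text \<open>Every component of the complement of a Jordan curve has the whole curve as frontier. A
  component different from the outside exists by separation and thus comes arbitrarily close to each
  point of the polygon.\<close>

lemma simple_polygon_inside_near: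
  assumes q: "simple_polygon J q" and p: "p \<in> polygon J q" and e: "0 < e"
  obtains y where "dist y p < e" "y \<notin> polygon J q" "y \<notin> outside (polygon J q)"
proof -
  let ?S = "polygon J q"
  obtain \<gamma> where \<gamma>: "simple_path \<gamma>" "path_image \<gamma> = ?S" "pathfinish \<gamma> = pathstart \<gamma>"
    using simple_polygon_path[OF q] by blast
  have "path_image \<gamma> homeomorphic sphere (0::complex) 1"
    using \<gamma> by (intro homeomorphic_simple_path_image_circle) auto
  moreover have "sphere (0::complex) 1 homeomorphic sphere (0::real^2) 1"
    by (rule homeomorphic_spheres_gen) auto
  ultimately have hom: "?S homeomorphic sphere (0::real^2) 1"
    unfolding \<gamma>(2) by (rule homeomorphic_trans)
  have bdd: "bounded ?S" using \<gamma> by (metis bounded_simple_path_image)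
  have "\<not> connected (- ?S)" using Jordan_Brouwer_separation[OF hom] by simp
  then have "- ?S \<noteq> outside ?S" using connected_outside[OF bdd] by auto
  then obtain y0 where y0: "y0 \<notin> ?S" "y0 \<notin> outside ?S"
    using outside_no_overlap by fastforce
  let ?C = "connected_component_set (- ?S) y0"
  have "?C \<in> components (- ?S)" using y0 by (simp add: componentsI)
  then have "frontier ?C = ?S" using Jordan_Brouwer_frontier[OF hom] by simp
  then have "p \<in> closure ?C" using p by (auto simp: frontier_def)
  then obtain y where y: "y \<in> ?C" "dist y p < e" using e by (meson closure_approachable)
  then have cc: "connected_component (- ?S) y0 y" by simp
  then have "y \<notin> ?S" using connected_component_in by fastforce
  moreover have "y \<notin> outside ?S"
    using y0 outside_same_component[of ?S y y0] cc by (metis connected_component_sym)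
  ultimately show ?thesis using y that by blast
qed

lemma convex_open_halfplane: "convex {y::real^2. 0 < (y - V) \<bullet> a}"
  using convex_halfspace_gt[of "a \<bullet> V" a] by (simp add: inner_diff_left inner_diff_right inner_commute)

lemma convex_subset_outside:
  fixes C :: "'a::real_normed_vector set"
  assumes "convex C" "C \<inter> S = {}" "x \<in> C" "x \<in> outside S"
  shows "C \<subseteq> outside S"
proof
  fix y assume "y \<in> C"
  then have "connected_component (- S) x y"
    unfolding connected_component_def
    by (intro exI[of _ C] conjI convex_connected[OF assms(1)]) (use assms in auto)
  then show "y \<in> outside S" using assms(4) outside_same_component by blast
qed

text \<open>The edges that do not meet at the vertex form a closed set missing it, so a small disc
  sees only the two adjacent edges, written here as rays.\<close>

lemma simple_polygon_near_vertex:
  assumes q: "simple_polygon J q" and j: "j < J"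
  obtains r where "0 < r"
    "\<And>y. y \<in> polygon J q \<Longrightarrow> dist (q j) y < r \<Longrightarrow>
      (\<exists>a\<ge>0. y = q j - a *\<^sub>R edge_tangent J q (prv J j)) \<or> (\<exists>a\<ge>0. y = q j + a *\<^sub>R edge_tangent J q j)"
proof -
  let ?i = "prv J j"
  let ?F = "\<Union>k\<in>{..<J} - {?i, j}. closed_segment (q k) (q (nxt J k))"
  have "q j \<notin> ?F"
  proof
    assume "q j \<in> ?F"
    then obtain k s where k: "k < J" "k \<noteq> ?i" "k \<noteq> j" "0 \<le> s" "s \<le> 1" "q j = fe J q k s"
      by (auto simp: fe_def closed_segment_def)
    show False
    proof (cases "s = 1")
      case True
      then have "j = nxt J k" using simple_polygon_vertices_distinct[OF q j, of "nxt J k"] k by simp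
      then show False using k by simp
    next
      case False
      then show False using simple_polygon_inj[OF q j, of k 0 s] k by simp
    qed
  qed
  then have "q j \<in> - ?F" by simp
  moreover have "open (- ?F)" by (intro open_Compl closed_UN) auto
  ultimately obtain r where r: "0 < r" "ball (q j) r \<subseteq> - ?F"
    using openE by blast
  have et: "q (nxt J k) - q k = elen J q k *\<^sub>R edge_tangent J q k" if "k < J" for k
    using simple_polygon_elen_pos[OF q that] by (simp add: edge_tangent_def)
  show ?thesis
  proof (rule that[OF r(1)])
    fix y assume y: "y \<in> polygon J q" "dist (q j) y < r"
    then obtain k where k: "k < J" "y \<in> closed_segment (q k) (q (nxt J k))" by (auto simp: polygon_def)
    then have "k = ?i \<or> k = j" using r(2) y(2) by fastforce
    moreover obtain s where s: "0 \<le> s" "s \<le> 1" "y = (1 - s) *\<^sub>R q k + s *\<^sub>R q (nxt J k)"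
      using k by (auto simp: closed_segment_def)
    ultimately consider "k = ?i" "y = q j - (1 - s) *\<^sub>R (q (nxt J k) - q k)"
      | "k = j" "y = q j + s *\<^sub>R (q (nxt J k) - q k)"
      using j by (auto simp: algebra_simps)
    then show "(\<exists>a\<ge>0. y = q j - a *\<^sub>R edge_tangent J q ?i) \<or> (\<exists>a\<ge>0. y = q j + a *\<^sub>R edge_tangent J q j)"
    proof cases
      case 1
      then show ?thesis using s et[of k] k by (intro disjI1 exI[of _ "(1 - s) * elen J q k"]) (auto simp: elen_def)
    next
      case 2
      then show ?thesis using s et[of k] k by (intro disjI2 exI[of _ "s * elen J q k"]) (auto simp: elen_def)
    qed
  qed
qed

text \<open>If the normals of two consecutive edges pointed to different sides, then both sides of the
  second edge would belong to the outside, contradicting the Jordan curve theorem.  The left side of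
  the corner is covered by three overlapping convex sets that miss the polygon.\<close>

lemma outward_normals_consistent:
  assumes q: "simple_polygon J q" and \<nu>: "outward_edge_normals J q \<nu>" and j: "j < J"
    and turn: "9/10 \<le> edge_tangent J q (prv J j) \<bullet> edge_tangent J q j"
  obtains \<sigma> where "\<sigma> = 1 \<or> \<sigma> = (-1::real)"
    "\<nu> (prv J j) = \<sigma> *\<^sub>R perp (edge_tangent J q (prv J j))" "\<nu> j = \<sigma> *\<^sub>R perp (edge_tangent J q j)"
proof -
  let ?i = "prv J j" and ?S = "polygon J q"
  let ?s = "edge_tangent J q ?i" and ?t = "edge_tangent J q j" and ?V = "q j"
  have i: "?i < J" using j by simp
  have et: "q (nxt J k) - q k = elen J q k *\<^sub>R edge_tangent J q k" if "k < J" for k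
    using simple_polygon_elen_pos[OF q that] by (simp add: edge_tangent_def)
  have norm1: "norm (edge_tangent J q k) = 1" if "k < J" for k
  proof -
    have "elen J q k = norm (q (nxt J k) - q k)" by (simp add: elen_def dist_norm norm_minus_commute)
    then show ?thesis using simple_polygon_elen_pos[OF q that] by (simp add: edge_tangent_def)
  qed
  have out: "outward_unit_normal ?S (q (nxt J k) - q k) (q k + a *\<^sub>R edge_tangent J q k) (\<nu> k)"
    if k: "k < J" and a: "0 < a" "a < elen J q k" for k a
  proof -
    have e: "q k + a *\<^sub>R edge_tangent J q k = (1 - a / elen J q k) *\<^sub>R q k + (a / elen J q k) *\<^sub>R q (nxt J k)"
      by (simp add: edge_tangent_def algebra_simps divide_inverse)
    have "q k \<noteq> q (nxt J k)" using simple_polygon_elen_pos[OF q k] by (auto simp: elen_def)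
    then have "q k + a *\<^sub>R edge_tangent J q k \<in> open_segment (q k) (q (nxt J k))"
      unfolding e in_segment(2) using a by (intro conjI exI[of _ "a / elen J q k"]) auto
    then show ?thesis using \<nu> k by (auto simp: outward_edge_normals_def)
  qed
  have cases: "\<nu> k = perp (edge_tangent J q k) \<or> \<nu> k = - perp (edge_tangent J q k)" if k: "k < J" for k
  proof -
    have "outward_unit_normal ?S (q (nxt J k) - q k) (q k + (elen J q k / 2) *\<^sub>R edge_tangent J q k) (\<nu> k)"
      using simple_polygon_elen_pos[OF q k] by (intro out[OF k]) auto
    then have "norm (\<nu> k) = 1" "\<nu> k \<bullet> edge_tangent J q k = 0"
      using simple_polygon_elen_pos[OF q k] by (auto simp: outward_unit_normal_def et[OF k])
    then show ?thesis using orthogonal_unit_cases[OF _ norm1[OF k]] by blast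
  qed
  have "False" if sg: "\<sigma> = 1 \<or> \<sigma> = (-1::real)" and ni: "\<nu> ?i = \<sigma> *\<^sub>R perp ?s" and nj: "\<nu> j = - (\<sigma> *\<^sub>R perp ?t)" for \<sigma>
  proof -
    define A where "A = \<sigma> *\<^sub>R perp ?s"
    define B where "B = \<sigma> *\<^sub>R perp ?t"
    have sg2: "\<sigma> * \<sigma> = 1" using sg by auto
    have ip: "?s \<bullet> ?s = 1" "?t \<bullet> ?t = 1" "A \<bullet> ?s = 0" "B \<bullet> ?t = 0" "A \<bullet> A = 1" "B \<bullet> B = 1"
        "A \<bullet> B = ?s \<bullet> ?t" "norm A = 1" "norm B = 1"
      using norm1[OF i] norm1[OF j] sg2 sg by (auto simp: A_def B_def dot_square_norm)
    \<comment> \<open>The cosine of the turning angle exceeds the modulus of its sine; this makes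
      neighbouring sectors overlap below. The bound 9/10 leaves ample room.\<close>
    have cross: "\<bar>?s \<bullet> B\<bar> < ?s \<bullet> ?t" "\<bar>?t \<bullet> A\<bar> < ?s \<bullet> ?t"
    proof -
      have "(9/10)\<^sup>2 \<le> (?s \<bullet> ?t)\<^sup>2" using turn by (intro power_mono) auto
      moreover have "(?s \<bullet> ?t)\<^sup>2 + (?s \<bullet> perp ?t)\<^sup>2 = 1"
        using perp_pythagoras[of ?s ?t] norm1[OF i] norm1[OF j] by simp
      ultimately have "(?s \<bullet> perp ?t)\<^sup>2 \<le> (1/2)\<^sup>2" by (simp add: power2_eq_square)
      then have "\<bar>?s \<bullet> perp ?t\<bar> \<le> \<bar>1/2\<bar>" by (simp only: abs_le_square_iff)
      then have *: "\<bar>?s \<bullet> perp ?t\<bar> < ?s \<bullet> ?t" using turn by linarith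
      have "?t \<bullet> perp ?s = - (?s \<bullet> perp ?t)" by (simp add: inner_real2)
      with * sg show "\<bar>?s \<bullet> B\<bar> < ?s \<bullet> ?t" "\<bar>?t \<bullet> A\<bar> < ?s \<bullet> ?t"
        by (auto simp: A_def B_def)
    qed
    obtain r where r: "0 < r" and near: "\<And>y. y \<in> ?S \<Longrightarrow> dist ?V y < r \<Longrightarrow>
        (\<exists>a\<ge>0. y = ?V - a *\<^sub>R ?s) \<or> (\<exists>a\<ge>0. y = ?V + a *\<^sub>R ?t)"
      using simple_polygon_near_vertex[OF q j] by blast
    \<comment> \<open>Part of a small disc at the vertex cut out by two half-planes. The sectors
      used lie beside the incoming edge (\<open>- ?s\<close>, \<open>A\<close>), beside both edges
      (\<open>A\<close>, \<open>B\<close>) and on either side of the outgoing edge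
      (\<open>?t\<close> with \<open>B\<close> or \<open>- B\<close>).\<close>
    define R where "R a b = ball ?V r \<inter> {y. 0 < (y - ?V) \<bullet> a} \<inter> {y. 0 < (y - ?V) \<bullet> b}" for a b
    have conv: "convex (R a b)" for a b
      unfolding R_def by (intro convex_Int convex_open_halfplane convex_ball)
    \<comment> \<open>A sector misses the polygon as soon as, for each of the two rays at the
      vertex, one of its half-planes excludes that ray.\<close>
    have R_S: "R a b \<inter> ?S = {}"
      if "?s \<bullet> a \<ge> 0 \<or> ?s \<bullet> b \<ge> 0" "?t \<bullet> a \<le> 0 \<or> ?t \<bullet> b \<le> 0" for a b
    proof -
      have False if y: "y \<in> R a b" "y \<in> ?S" for y
      proof -
        have y': "dist ?V y < r" "0 < (y - ?V) \<bullet> a" "0 < (y - ?V) \<bullet> b" using y(1) by (auto simp: R_def)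
        from near[OF y(2) y'(1)] show False
        proof (elim disjE exE conjE)
          fix c assume "0 \<le> c" "y = ?V - c *\<^sub>R ?s"
          then show False using y' \<open>?s \<bullet> a \<ge> 0 \<or> ?s \<bullet> b \<ge> 0\<close>
            by (auto simp: mult_less_0_iff)
        next
          fix c assume "0 \<le> c" "y = ?V + c *\<^sub>R ?t"
          then show False using y' \<open>?t \<bullet> a \<le> 0 \<or> ?t \<bullet> b \<le> 0\<close>
            by (auto simp: zero_less_mult_iff)
        qed
      qed
      then show ?thesis by blast
    qed
    have small: "\<exists>\<mu>>0. \<mu> < c \<and> \<mu> < r / 2" if "0 < c" for c
      using that r by (intro exI[of _ "min c (r/2) / 2"]) auto
    have in_ball: "?V + (\<alpha> *\<^sub>R a + \<beta> *\<^sub>R b) \<in> ball ?V r"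
      if "\<bar>\<alpha>\<bar> < r/2" "\<bar>\<beta>\<bar> < r/2" "norm a = 1" "norm b = 1" for \<alpha> \<beta> a b
    proof -
      have "norm (\<alpha> *\<^sub>R a + \<beta> *\<^sub>R b) \<le> \<bar>\<alpha>\<bar> + \<bar>\<beta>\<bar>"
        using that norm_triangle_ineq[of "\<alpha> *\<^sub>R a" "\<beta> *\<^sub>R b"] by simp
      then have "norm (\<alpha> *\<^sub>R a + \<beta> *\<^sub>R b) < r" using that by linarith
      then show ?thesis unfolding mem_ball by (metis add_diff_cancel_left' dist_commute dist_norm)
    qed
    have outside_pt: "\<exists>\<epsilon>>0. \<epsilon> < r / 2 \<and> p + \<epsilon> *\<^sub>R \<nu>' \<in> outside ?S"
      if "outward_unit_normal ?S d p \<nu>'" for d p \<nu>'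
    proof -
      have "\<forall>\<^sub>F \<epsilon> in at_right 0. p + \<epsilon> *\<^sub>R \<nu>' \<in> outside ?S" using that by (simp add: outward_unit_normal_def)
      then obtain b where b: "0 < b" "\<And>\<epsilon>. 0 < \<epsilon> \<Longrightarrow> \<epsilon> < b \<Longrightarrow> p + \<epsilon> *\<^sub>R \<nu>' \<in> outside ?S"
        unfolding eventually_at_right_field by auto
      then show ?thesis using small[of b] by metis
    qed
    obtain la where lam: "0 < la" "la < elen J q ?i" "la < r / 2"
      using small[OF simple_polygon_elen_pos[OF q i]] by auto
    obtain \<mu> where mu: "0 < \<mu>" "\<mu> < elen J q j" "\<mu> < r / 2"
      using small[OF simple_polygon_elen_pos[OF q j]] by auto
    have Vi: "q ?i = ?V - elen J q ?i *\<^sub>R ?s" using et[OF i] j by (simp add: algebra_simps)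
    have "outward_unit_normal ?S (q (nxt J ?i) - q ?i) (q ?i + (elen J q ?i - la) *\<^sub>R ?s) A"
      using out[OF i, of "elen J q ?i - la"] lam ni by (simp add: A_def)
    then obtain \<epsilon> where eps: "0 < \<epsilon>" "\<epsilon> < r / 2" "q ?i + (elen J q ?i - la) *\<^sub>R ?s + \<epsilon> *\<^sub>R A \<in> outside ?S"
      using outside_pt by blast
    have "R (- ?s) A \<subseteq> outside ?S"
    proof (rule convex_subset_outside[OF conv])
      show "R (- ?s) A \<inter> ?S = {}" using turn ip by (intro R_S) (auto simp: inner_commute)
      have e: "q ?i + (elen J q ?i - la) *\<^sub>R ?s + \<epsilon> *\<^sub>R A = ?V + ((-la) *\<^sub>R ?s + \<epsilon> *\<^sub>R A)"
        unfolding Vi by (simp add: algebra_simps)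
      show "?V + ((-la) *\<^sub>R ?s + \<epsilon> *\<^sub>R A) \<in> outside ?S" using eps(3) unfolding e .
      show "?V + ((-la) *\<^sub>R ?s + \<epsilon> *\<^sub>R A) \<in> R (- ?s) A"
        unfolding R_def Int_iff using in_ball[of "-la" \<epsilon> ?s A] lam eps ip norm1[OF i]
        by (simp add: inner_simps inner_commute)
    qed
    \<comment> \<open>A point on the bisector of the first sector; \<open>cross\<close> makes its
      component along \<open>B\<close> positive, so it also belongs to the middle sector and passes
      the outside on.\<close>
    moreover have "?V + ((-r/4) *\<^sub>R ?s + (r/4) *\<^sub>R A) \<in> R (- ?s) A \<inter> R A B"
      unfolding R_def Int_iff using in_ball[of "-r/4" "r/4" ?s A] r ip norm1[OF i] cross(1)
      by (simp add: inner_simps inner_commute abs_less_iff)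
    ultimately have "R A B \<subseteq> outside ?S"
      using turn ip by (intro convex_subset_outside[OF conv R_S]) (auto simp: inner_commute)
    moreover have "0 < r * (?t \<bullet> A + ?s \<bullet> ?t)" using r cross(2) by (intro mult_pos_pos) (auto simp: abs_less_iff)
    then have "?V + ((r/4) *\<^sub>R ?t + (r/4) *\<^sub>R B) \<in> R ?t B \<inter> R A B"
      unfolding R_def Int_iff using in_ball[of "r/4" "r/4" ?t B] r ip norm1[OF j]
      by (simp add: inner_simps inner_commute algebra_simps)
    ultimately have left: "R ?t B \<subseteq> outside ?S"
      using turn ip by (intro convex_subset_outside[OF conv R_S]) (auto simp: inner_commute)
    have "outward_unit_normal ?S (q (nxt J j) - q j) (q j + \<mu> *\<^sub>R ?t) (- B)"
      using out[OF j, of \<mu>] mu nj by (simp add: B_def)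
    then obtain \<epsilon>' where eps': "0 < \<epsilon>'" "\<epsilon>' < r / 2" "q j + \<mu> *\<^sub>R ?t + \<epsilon>' *\<^sub>R (- B) \<in> outside ?S"
      using outside_pt by blast
    have right: "R ?t (- B) \<subseteq> outside ?S"
    proof (rule convex_subset_outside[OF conv])
      show "R ?t (- B) \<inter> ?S = {}" using turn ip by (intro R_S) (auto simp: inner_commute)
      show "?V + (\<mu> *\<^sub>R ?t + \<epsilon>' *\<^sub>R (- B)) \<in> outside ?S" using eps'(3) by (simp add: algebra_simps)
      show "?V + (\<mu> *\<^sub>R ?t + \<epsilon>' *\<^sub>R (- B)) \<in> R ?t (- B)"
        unfolding R_def Int_iff using in_ball[of \<mu> \<epsilon>' ?t "- B"] mu eps' ip norm1[OF j]
        by (simp add: inner_simps inner_commute)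
    qed
    have on: "?V + a *\<^sub>R ?t \<in> ?S" if "0 \<le> a" "a \<le> elen J q j" for a
    proof -
      have "a / elen J q j \<in> {0..1}" using that simple_polygon_elen_pos[OF q j] by simp
      moreover have "?V + a *\<^sub>R ?t = fe J q j (a / elen J q j)"
        by (simp add: fe_def edge_tangent_def algebra_simps divide_inverse)
      ultimately show ?thesis unfolding in_polygon_iff using j by blast
    qed
    \<comment> \<open>A point of the bounded side near an interior point of the outgoing edge. The
      three radii keep it ahead of the vertex, inside the disc, and before the end of the
      edge.\<close>
    obtain y where y: "dist y (?V + \<mu> *\<^sub>R ?t) < min \<mu> (min (r / 2) (elen J q j - \<mu>))" "y \<notin> ?S" "y \<notin> outside ?S"
      by (rule simple_polygon_inside_near[OF q on[of \<mu>], of "min \<mu> (min (r / 2) (elen J q j - \<mu>))"]) (use mu r in auto)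
    define z where "z = y - (?V + \<mu> *\<^sub>R ?t)"
    have yz: "y - ?V = \<mu> *\<^sub>R ?t + z" by (simp add: z_def)
    have nz: "norm z < \<mu>" "norm z < r / 2" "norm z < elen J q j - \<mu>" using y(1) by (auto simp: z_def dist_norm)
    have zt: "\<bar>z \<bullet> ?t\<bar> \<le> norm z" using Cauchy_Schwarz_ineq2[of z ?t] norm1[OF j] by simp
    have yt: "(y - ?V) \<bullet> ?t = \<mu> + z \<bullet> ?t" unfolding yz by (simp add: inner_add_left ip)
    have ypos: "0 < (y - ?V) \<bullet> ?t" "(y - ?V) \<bullet> ?t \<le> elen J q j" unfolding yt using zt nz by linarith+
    have ball: "y \<in> ball ?V r"
    proof -
      have "norm (y - ?V) \<le> \<mu> + norm z" unfolding yz using mu norm1[OF j] by (intro norm_triangle_le) auto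
      then show ?thesis using mu nz by (simp add: dist_norm norm_minus_commute)
    qed
    \<comment> \<open>Both sides of the outgoing edge are already known to be outside, so
      \<open>y\<close> could only lie on the edge itself.\<close>
    have "(y - ?V) \<bullet> B = 0"
    proof (rule ccontr)
      assume "(y - ?V) \<bullet> B \<noteq> 0"
      then have "y \<in> R ?t B \<or> y \<in> R ?t (- B)" using ypos ball by (auto simp: R_def linorder_neq_iff)
      then show False using left right y(3) by blast
    qed
    then have "(y - ?V) \<bullet> perp ?t = 0" using sg by (auto simp: B_def)
    moreover have "?t \<noteq> 0" using norm1[OF j] by auto
    ultimately have "y - ?V = ((y - ?V) \<bullet> ?t) *\<^sub>R ?t"
      using perp_decomposition[of ?t "y - ?V"] norm1[OF j] by simp
    then have "y = ?V + ((y - ?V) \<bullet> ?t) *\<^sub>R ?t" by (simp add: algebra_simps)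
    then show False using on ypos y(2) by (metis less_imp_le)
  qed
  from this[of 1] this[of "-1"] show ?thesis
    using that[of 1] that[of "-1"] cases[OF i] cases[OF j] by auto
qed

section \<open>Periodic curves depending on time\<close>

lemma periodic_of_int:
  fixes f :: "real \<Rightarrow> 'a"
  assumes "\<And>x. f (x + 1) = f x"
  shows "f (x + of_int z) = f x"
proof (induction z rule: int_induct[where k = 0])
  case (step1 i)
  then show ?case using assms[of "x + of_int i"] by (simp add: algebra_simps)
next
  case (step2 i)
  then show ?case using assms[of "x + of_int (i - 1)"] by (simp add: algebra_simps)
qed simp

lemma vector_mean_value_bound:
  fixes f :: "real \<Rightarrow> 'a::real_normed_vector"
  assumes "\<And>x. x \<in> closed_segment a b \<Longrightarrow> (f has_vector_derivative f' x) (at x)"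
    and "\<And>x. x \<in> closed_segment a b \<Longrightarrow> norm (f' x) \<le> L"
  shows "norm (f b - f a) \<le> L * \<bar>b - a\<bar>"
proof -
  have "norm (f b - f a) \<le> L * norm (b - a)"
  proof (rule differentiable_bound[of "closed_segment a b" f "\<lambda>x h. h *\<^sub>R f' x"])
    fix x assume x: "x \<in> closed_segment a b"
    show "(f has_derivative (\<lambda>h. h *\<^sub>R f' x)) (at x within closed_segment a b)"
      using assms(1)[OF x] unfolding has_vector_derivative_def by (rule has_derivative_at_withinI)
    show "onorm (\<lambda>h. h *\<^sub>R f' x) \<le> L"
      using assms(2)[OF x] by (intro onorm_le) (simp add: mult.commute[of L] mult_left_mono)
  qed auto
  then show ?thesis by simp
qed

lemma vector_linearization_bound:
  fixes f :: "real \<Rightarrow> 'a::real_normed_vector"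
  assumes f: "\<And>x. (f has_vector_derivative f' x) (at x)"
    and L: "\<And>x y. norm (f' x - f' y) \<le> L * \<bar>x - y\<bar>" "0 \<le> L"
  shows "norm (f x - f y - (x - y) *\<^sub>R f' y) \<le> L * (x - y)\<^sup>2"
proof -
  have "norm (f x - f y - (x - y) *\<^sub>R f' y) \<le> norm (x - y) * (L * \<bar>x - y\<bar>)"
  proof (rule vector_differentiable_bound_linearization[where S = "closed_segment y x"])
    fix z assume z: "z \<in> closed_segment y x"
    show "(f has_vector_derivative f' z) (at z within closed_segment y x)"
      by (rule has_vector_derivative_at_within[OF f])
    have "\<bar>z - y\<bar> \<le> \<bar>x - y\<bar>" using z by (auto simp: closed_segment_eq_real_ivl split: if_splits)
    then show "norm (f' z - f' y) \<le> L * \<bar>x - y\<bar>"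
      using L order_trans[OF L(1)] mult_left_mono by blast
  qed auto
  also have "norm (x - y) * (L * \<bar>x - y\<bar>) = L * \<bar>x - y\<bar>\<^sup>2"
    by (simp only: real_norm_def power2_eq_square mult.left_commute)
  finally show ?thesis by simp
qed

lemma affine_vector_chain:
  fixes f :: "real \<Rightarrow> 'a::real_normed_vector"
  assumes "(f has_vector_derivative f') (at (c + r * x))"
  shows "((\<lambda>x. f (c + r * x)) has_vector_derivative r *\<^sub>R f') (at x)"
proof -
  have "((\<lambda>x. c + r * x) has_vector_derivative r) (at x)"
    unfolding has_real_derivative_iff_has_vector_derivative[symmetric]
    by (auto intro!: derivative_eq_intros)
  from vector_diff_chain_at[OF this assms] show ?thesis by (simp add: o_def)
qed

lemma normalize_diff_le:
  fixes a b :: "'a::real_normed_vector"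
  assumes "b \<noteq> 0"
  shows "norm (a /\<^sub>R norm a - b /\<^sub>R norm b) \<le> 2 * norm (a - b) / norm b"
proof (cases "a = 0")
  case False
  have "a /\<^sub>R norm a - b /\<^sub>R norm b = (a - b) /\<^sub>R norm b + ((norm b - norm a) / norm b) *\<^sub>R (a /\<^sub>R norm a)"
  proof -
    have c: "inverse (norm a) = inverse (norm b) + (norm b - norm a) / norm b * inverse (norm a)"
      using assms False by (simp add: field_simps)
    have "a /\<^sub>R norm a = a /\<^sub>R norm b + ((norm b - norm a) / norm b) *\<^sub>R (a /\<^sub>R norm a)"
      by (subst c) (simp add: scaleR_add_left)
    then have "a /\<^sub>R norm b = a /\<^sub>R norm a - ((norm b - norm a) / norm b) *\<^sub>R (a /\<^sub>R norm a)"
      by (simp only: eq_diff_eq)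
    then show ?thesis unfolding scaleR_diff_right[of "inverse (norm b)"] by simp
  qed
  also have "norm \<dots> \<le> norm (a - b) / norm b + \<bar>norm b - norm a\<bar> / norm b"
  proof (rule norm_triangle_mono)
    show "norm ((a - b) /\<^sub>R norm b) \<le> norm (a - b) / norm b" by (simp add: divide_inverse mult.commute)
    have "norm (a /\<^sub>R norm a) = 1" using False by simp
    then have "norm (((norm b - norm a) / norm b) *\<^sub>R (a /\<^sub>R norm a)) = \<bar>(norm b - norm a) / norm b\<bar>"
      by (metis norm_scaleR mult.right_neutral)
    then show "norm (((norm b - norm a) / norm b) *\<^sub>R (a /\<^sub>R norm a)) \<le> \<bar>norm b - norm a\<bar> / norm b"
      by (simp only: abs_divide abs_norm_cancel order_refl)
  qed
  also have "\<dots> \<le> norm (a - b) / norm b + norm (a - b) / norm b"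
    using norm_triangle_ineq3[of b a] by (intro add_left_mono divide_right_mono) (auto simp: norm_minus_commute)
  finally show ?thesis by simp
qed (use assms in simp)

lemma inner_diff_le:
  fixes a b c d :: "'a::real_inner"
  shows "\<bar>a \<bullet> b - c \<bullet> d\<bar> \<le> norm (a - c) * norm b + norm c * norm (b - d)"
proof -
  have "a \<bullet> b - c \<bullet> d = (a - c) \<bullet> b + c \<bullet> (b - d)" by (simp add: inner_simps)
  then show ?thesis
    using Cauchy_Schwarz_ineq2[of "a - c" b] Cauchy_Schwarz_ineq2[of c "b - d"] by linarith
qed

lemma scaleR_diff_le:
  fixes x y :: "'a::real_normed_vector"
  shows "norm (a *\<^sub>R x - b *\<^sub>R y) \<le> \<bar>a - b\<bar> * norm x + \<bar>b\<bar> * norm (x - y)"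
proof -
  have "a *\<^sub>R x - b *\<^sub>R y = (a - b) *\<^sub>R x + b *\<^sub>R (x - y)" by (simp add: algebra_simps)
  then show ?thesis by (metis norm_scaleR norm_triangle_ineq)
qed

text \<open>\<open>G k \<theta> t\<close> is the \<open>k\<close>-th derivative in the curve parameter; \<open>B\<close> bounds everything.\<close>

locale evolving_curve =
  fixes T B :: real and G :: "nat \<Rightarrow> real \<Rightarrow> real \<Rightarrow> real^2"
  assumes B: "1 \<le> B"
    and deriv: "\<And>k \<theta> t. t \<in> {0..T} \<Longrightarrow> ((\<lambda>\<theta>. G k \<theta> t) has_vector_derivative G (Suc k) \<theta> t) (at \<theta>)"
    and bound: "\<And>k \<theta> t. k \<le> 3 \<Longrightarrow> t \<in> {0..T} \<Longrightarrow> norm (G k \<theta> t) \<le> B"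
    and time: "\<And>k \<theta> t t'. k \<le> 2 \<Longrightarrow> t \<in> {0..T} \<Longrightarrow> t' \<in> {0..T} \<Longrightarrow> norm (G k \<theta> t' - G k \<theta> t) \<le> B * \<bar>t' - t\<bar>"
    and regular: "\<And>\<theta> t. t \<in> {0..T} \<Longrightarrow> 1 / B \<le> norm (G 1 \<theta> t)"
    and chord: "\<And>\<theta> \<theta>' t. t \<in> {0..T} \<Longrightarrow> \<bar>\<theta> - \<theta>'\<bar> \<le> 1 / 2 \<Longrightarrow> \<bar>\<theta> - \<theta>'\<bar> \<le> B * norm (G 0 \<theta> t - G 0 \<theta>' t)"
    and periodic: "\<And>k \<theta> t. t \<in> {0..T} \<Longrightarrow> G k (\<theta> + 1) t = G k \<theta> t"
begin

section \<open>Increments of the family in parameter and time\<close>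

lemma periodic_int: assumes "t \<in> {0..T}" shows "G k (\<theta> + of_int z) t = G k \<theta> t"
  by (rule periodic_of_int[where f = "\<lambda>x. G k x t"]) (rule periodic[OF assms])

lemma lip: assumes "k \<le> 2" "t \<in> {0..T}" shows "norm (G k x t - G k y t) \<le> B * \<bar>x - y\<bar>"
  using deriv[OF assms(2), of k] bound[OF _ assms(2), of "Suc k"] assms(1)
  by (intro vector_mean_value_bound[where f = "\<lambda>\<theta>. G k \<theta> t"]) auto

lemma linearization:
  assumes "k \<le> 1" "t \<in> {0..T}"
  shows "norm (G k x t - G k y t - (x - y) *\<^sub>R G (Suc k) y t) \<le> B * (x - y)\<^sup>2"
  using assms B lip[of "Suc k" t] by (intro vector_linearization_bound deriv) auto

lemma increment:
  assumes "k \<le> 2" "t \<in> {0..T}" "t' \<in> {0..T}"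
  shows "norm (G k (\<theta> + \<eta>) t' - G k \<theta> t) \<le> B * (\<bar>\<eta>\<bar> + \<bar>t' - t\<bar>)"
proof -
  have "norm (G k (\<theta> + \<eta>) t' - G k \<theta> t) \<le> norm (G k (\<theta> + \<eta>) t' - G k \<theta> t') + norm (G k \<theta> t' - G k \<theta> t)"
    by (metis norm_triangle_ineq diff_add_cancel add_diff_eq)
  then show ?thesis using lip[OF assms(1,3), of "\<theta> + \<eta>" \<theta>] time[OF assms, of \<theta>] by (simp add: algebra_simps)
qed

lemma increment_diff:
  assumes "k \<le> 1" "t \<in> {0..T}" "t' \<in> {0..T}"
  shows "norm ((G k (\<theta>' + \<eta>') t' - G k \<theta>' t) - (G k (\<theta> + \<eta>) t' - G k \<theta> t))
    \<le> B * (\<bar>\<theta>' - \<theta>\<bar> * (\<bar>\<eta>\<bar> + \<bar>t' - t\<bar>) + \<bar>\<eta>' - \<eta>\<bar>)"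
proof -
  have "((\<lambda>x. G k (x + \<eta>) t') has_vector_derivative G (Suc k) (x + \<eta>) t') (at x)" for x
    using affine_vector_chain[OF deriv[OF assms(3)], of k \<eta> 1 x] by (simp add: add.commute)
  then have "((\<lambda>x. G k (x + \<eta>) t' - G k x t) has_vector_derivative G (Suc k) (x + \<eta>) t' - G (Suc k) x t) (at x)" for x
    by (intro has_vector_derivative_diff deriv assms)
  then have "norm ((G k (\<theta>' + \<eta>) t' - G k \<theta>' t) - (G k (\<theta> + \<eta>) t' - G k \<theta> t)) \<le> B * (\<bar>\<eta>\<bar> + \<bar>t' - t\<bar>) * \<bar>\<theta>' - \<theta>\<bar>"
    using increment[of "Suc k" t t'] assms by (intro vector_mean_value_bound) auto
  moreover have "norm (G k (\<theta>' + \<eta>') t' - G k (\<theta>' + \<eta>) t') \<le> B * \<bar>\<eta>' - \<eta>\<bar>"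
    using lip[of k t' "\<theta>' + \<eta>'" "\<theta>' + \<eta>"] assms by simp
  moreover have "(G k (\<theta>' + \<eta>') t' - G k \<theta>' t) - (G k (\<theta> + \<eta>) t' - G k \<theta> t)
     = ((G k (\<theta>' + \<eta>) t' - G k \<theta>' t) - (G k (\<theta> + \<eta>) t' - G k \<theta> t)) + (G k (\<theta>' + \<eta>') t' - G k (\<theta>' + \<eta>) t')"
    by simp
  ultimately show ?thesis
    by (smt (verit) norm_triangle_ineq distrib_left mult.commute mult.left_commute)
qed

text \<open>The unnormalised normal is taken at time \<open>t\<close>, while both points lie on the
  curve at time \<open>t'\<close>. Equal times are allowed: this is the version needed when the
  normal belongs to the new curve.\<close>

definition normal_jump :: "real \<Rightarrow> real \<Rightarrow> real \<Rightarrow> real \<Rightarrow> real" where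
  "normal_jump t t' \<theta> \<eta> = perp (G 1 \<theta> t) \<bullet> (G 0 (\<theta> + \<eta>) t' - G 0 \<theta> t')"

lemma increment_linearization:
  assumes "k \<le> 1" "t \<in> {0..T}" "t' \<in> {0..T}"
  shows "norm (G k (\<theta> + \<eta>) t' - G k \<theta> t' - \<eta> *\<^sub>R G (Suc k) \<theta> t) \<le> B * (\<bar>\<eta>\<bar> * (\<bar>\<eta>\<bar> + \<bar>t' - t\<bar>))"
proof -
  have "norm (G k (\<theta> + \<eta>) t' - G k \<theta> t' - \<eta> *\<^sub>R G (Suc k) \<theta> t') \<le> B * \<eta>\<^sup>2"
    using linearization[OF assms(1,3), of "\<theta> + \<eta>" \<theta>] by simp
  moreover have "norm (\<eta> *\<^sub>R (G (Suc k) \<theta> t' - G (Suc k) \<theta> t)) \<le> \<bar>\<eta>\<bar> * (B * \<bar>t' - t\<bar>)"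
    using time[of "Suc k" t t'] assms by (simp add: mult_left_mono)
  moreover have "G k (\<theta> + \<eta>) t' - G k \<theta> t' - \<eta> *\<^sub>R G (Suc k) \<theta> t
     = (G k (\<theta> + \<eta>) t' - G k \<theta> t' - \<eta> *\<^sub>R G (Suc k) \<theta> t') + \<eta> *\<^sub>R (G (Suc k) \<theta> t' - G (Suc k) \<theta> t)"
    by (simp add: algebra_simps)
  ultimately have "norm (G k (\<theta> + \<eta>) t' - G k \<theta> t' - \<eta> *\<^sub>R G (Suc k) \<theta> t) \<le> B * \<eta>\<^sup>2 + \<bar>\<eta>\<bar> * (B * \<bar>t' - t\<bar>)"
    by (simp only: norm_triangle_mono)
  also have "\<eta>\<^sup>2 = \<bar>\<eta>\<bar> * \<bar>\<eta>\<bar>" by (simp add: power2_eq_square)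
  finally show ?thesis by (simp add: algebra_simps)
qed

text \<open>The first-order part of the jump is \<eta> times the tangent at \<open>t\<close>, which
  the normal annihilates. What remains is quadratic: curvature of the curve, and change of the
  tangent in time.\<close>

lemma normal_jump_le:
  assumes t: "t \<in> {0..T}" "t' \<in> {0..T}"
  shows "\<bar>normal_jump t t' \<theta> \<eta>\<bar> \<le> B\<^sup>2 * (\<bar>\<eta>\<bar> * (\<bar>\<eta>\<bar> + \<bar>t' - t\<bar>))"
proof -
  have "normal_jump t t' \<theta> \<eta> = perp (G 1 \<theta> t) \<bullet> (G 0 (\<theta> + \<eta>) t' - G 0 \<theta> t' - \<eta> *\<^sub>R G (Suc 0) \<theta> t)"
    by (simp add: normal_jump_def inner_diff_right)
  also have "\<bar>\<dots>\<bar> \<le> B * (B * (\<bar>\<eta>\<bar> * (\<bar>\<eta>\<bar> + \<bar>t' - t\<bar>)))"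
    using bound[of 1 t \<theta>] increment_linearization[of 0 t t' \<theta> \<eta>] t B
    by (intro order_trans[OF Cauchy_Schwarz_ineq2] mult_mono) auto
  finally show ?thesis by (simp add: power2_eq_square)
qed

text \<open>The base point is moved with the shift fixed, and the shift with the base point fixed.
  Both moves retain a quadratic total order, so that the difference quotient of the jump along the
  polygon is O(\<tau>^2) when \<eta> and its difference quotients are O(\<tau>).\<close>

lemma normal_jump_diff:
  assumes t: "t \<in> {0..T}" "t' \<in> {0..T}"
  shows "\<bar>normal_jump t t' \<theta>' \<eta>' - normal_jump t t' \<theta> \<eta>\<bar>
    \<le> B\<^sup>2 * (2 * \<bar>\<theta>' - \<theta>\<bar> * (\<bar>\<eta>\<bar> * (\<bar>\<eta>\<bar> + \<bar>t' - t\<bar>)) + 2 * \<bar>\<eta>' - \<eta>\<bar> * (\<bar>\<eta>'\<bar> + \<bar>\<eta>\<bar> + \<bar>t' - t\<bar>))"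
proof -
  let ?c = "\<bar>\<eta>\<bar> * (\<bar>\<eta>\<bar> + \<bar>t' - t\<bar>)"
  have "norm (normal_jump t t' \<theta>' \<eta> - normal_jump t t' \<theta> \<eta>) \<le> 2 * B\<^sup>2 * ?c * \<bar>\<theta>' - \<theta>\<bar>"
  proof (rule vector_mean_value_bound)
    fix x
    have P: "((\<lambda>x. perp (G 1 x t)) has_vector_derivative perp (G 2 x t)) (at x)"
    proof -
      have "bounded_linear perp"
        by (rule bounded_linear_intro[of _ 1]) (auto simp: perp_add perp_scaleR)
      from bounded_linear.has_vector_derivative[OF this deriv[OF t(1), of 1]]
      show ?thesis by (simp add: numeral_2_eq_2)
    qed
    have "((\<lambda>x. G 0 (x + \<eta>) t') has_vector_derivative G 1 (x + \<eta>) t') (at x)"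
      using affine_vector_chain[OF deriv[OF t(2)], of 0 \<eta> 1 x] by (simp add: add.commute)
    then have "((\<lambda>x. G 0 (x + \<eta>) t' - G 0 x t') has_vector_derivative G 1 (x + \<eta>) t' - G 1 x t') (at x)"
      using deriv[OF t(2), of 0] by (intro has_vector_derivative_diff) auto
    from bounded_bilinear.has_vector_derivative[OF bounded_bilinear_inner P this]
    show "((\<lambda>x. normal_jump t t' x \<eta>) has_vector_derivative
        (perp (G 1 x t) \<bullet> (G 1 (x + \<eta>) t' - G 1 x t') + perp (G 2 x t) \<bullet> (G 0 (x + \<eta>) t' - G 0 x t'))) (at x)"
      unfolding normal_jump_def .
    \<comment> \<open>The terms linear in \<eta> are \<open>perp (G 1 x t) \<bullet> G 2 x t\<close>
      and the same product with the two vectors exchanged; by antisymmetry they cancel, and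
      linearization errors alone remain.\<close>
    have "perp (G 1 x t) \<bullet> (G 1 (x + \<eta>) t' - G 1 x t') + perp (G 2 x t) \<bullet> (G 0 (x + \<eta>) t' - G 0 x t')
      = perp (G 1 x t) \<bullet> (G 1 (x + \<eta>) t' - G 1 x t' - \<eta> *\<^sub>R G (Suc 1) x t)
        + perp (G 2 x t) \<bullet> (G 0 (x + \<eta>) t' - G 0 x t' - \<eta> *\<^sub>R G (Suc 0) x t)"
      using inner_perp_swap[of "G 2 x t" "G 1 x t"]
      by (simp add: inner_diff_right numeral_2_eq_2 inner_commute)
    moreover have "\<bar>perp (G 1 x t) \<bullet> (G 1 (x + \<eta>) t' - G 1 x t' - \<eta> *\<^sub>R G (Suc 1) x t)\<bar> \<le> B * (B * ?c)"
      using bound[of 1 t x] increment_linearization[of 1 t t' x \<eta>] t B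
      by (intro order_trans[OF Cauchy_Schwarz_ineq2] mult_mono) auto
    moreover have "\<bar>perp (G 2 x t) \<bullet> (G 0 (x + \<eta>) t' - G 0 x t' - \<eta> *\<^sub>R G (Suc 0) x t)\<bar> \<le> B * (B * ?c)"
      using bound[of 2 t x] increment_linearization[of 0 t t' x \<eta>] t B
      by (intro order_trans[OF Cauchy_Schwarz_ineq2] mult_mono) auto
    ultimately have "norm (perp (G 1 x t) \<bullet> (G 1 (x + \<eta>) t' - G 1 x t') + perp (G 2 x t) \<bullet> (G 0 (x + \<eta>) t' - G 0 x t'))
        \<le> B * (B * ?c) + B * (B * ?c)"
      unfolding real_norm_def by linarith
    also have "B * (B * ?c) + B * (B * ?c) = 2 * B\<^sup>2 * ?c" by (simp add: power2_eq_square)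
    finally show "norm (perp (G 1 x t) \<bullet> (G 1 (x + \<eta>) t' - G 1 x t') + perp (G 2 x t) \<bullet> (G 0 (x + \<eta>) t' - G 0 x t'))
        \<le> 2 * B\<^sup>2 * ?c" .
  qed
  moreover have "\<bar>normal_jump t t' \<theta>' \<eta>' - normal_jump t t' \<theta>' \<eta>\<bar> \<le> 2 * B\<^sup>2 * (\<bar>\<eta>' - \<eta>\<bar> * (\<bar>\<eta>'\<bar> + \<bar>\<eta>\<bar> + \<bar>t' - t\<bar>))"
  proof -
    let ?d = "\<eta>' - \<eta>"
    let ?D = "G 0 (\<theta>' + \<eta>') t' - G 0 (\<theta>' + \<eta>) t' - ?d *\<^sub>R G 1 (\<theta>' + \<eta>) t'"
    have "normal_jump t t' \<theta>' \<eta>' - normal_jump t t' \<theta>' \<eta>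
       = perp (G 1 \<theta>' t) \<bullet> ?D + ?d * (perp (G 1 \<theta>' t) \<bullet> (G 1 (\<theta>' + \<eta>) t' - G 1 \<theta>' t))"
      by (simp add: normal_jump_def inner_diff_right)
    moreover have "\<bar>perp (G 1 \<theta>' t) \<bullet> ?D\<bar> \<le> B * (B * ?d\<^sup>2)"
      using bound[of 1 t \<theta>'] linearization[of 0 t' "\<theta>' + \<eta>'" "\<theta>' + \<eta>"] t B
      by (intro order_trans[OF Cauchy_Schwarz_ineq2] mult_mono) auto
    moreover have "\<bar>perp (G 1 \<theta>' t) \<bullet> (G 1 (\<theta>' + \<eta>) t' - G 1 \<theta>' t)\<bar> \<le> B * (B * (\<bar>\<eta>\<bar> + \<bar>t' - t\<bar>))"
      using bound[of 1 t \<theta>'] increment[of 1 t t' \<theta>' \<eta>] t B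
      by (intro order_trans[OF Cauchy_Schwarz_ineq2] mult_mono) auto
    then have "\<bar>?d * (perp (G 1 \<theta>' t) \<bullet> (G 1 (\<theta>' + \<eta>) t' - G 1 \<theta>' t))\<bar> \<le> \<bar>?d\<bar> * (B * (B * (\<bar>\<eta>\<bar> + \<bar>t' - t\<bar>)))"
      unfolding abs_mult by (rule mult_left_mono) simp
    moreover have "B * (B * ?d\<^sup>2) \<le> B\<^sup>2 * (\<bar>?d\<bar> * (\<bar>\<eta>'\<bar> + \<bar>\<eta>\<bar>))"
    proof -
      have "?d\<^sup>2 = \<bar>?d\<bar> * \<bar>?d\<bar>" by (simp add: power2_eq_square)
      also have "\<dots> \<le> \<bar>?d\<bar> * (\<bar>\<eta>'\<bar> + \<bar>\<eta>\<bar>)" by (intro mult_left_mono) auto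
      finally have "B\<^sup>2 * ?d\<^sup>2 \<le> B\<^sup>2 * (\<bar>?d\<bar> * (\<bar>\<eta>'\<bar> + \<bar>\<eta>\<bar>))" by (rule mult_left_mono) simp
      then show ?thesis by (simp add: power2_eq_square mult_ac)
    qed
    ultimately have "\<bar>normal_jump t t' \<theta>' \<eta>' - normal_jump t t' \<theta>' \<eta>\<bar>
       \<le> B\<^sup>2 * (\<bar>?d\<bar> * (\<bar>\<eta>'\<bar> + \<bar>\<eta>\<bar>)) + \<bar>?d\<bar> * (B * (B * (\<bar>\<eta>\<bar> + \<bar>t' - t\<bar>)))" by linarith
    also have "\<dots> = B\<^sup>2 * (\<bar>?d\<bar> * (\<bar>\<eta>'\<bar> + 2 * \<bar>\<eta>\<bar> + \<bar>t' - t\<bar>))" by (simp add: power2_eq_square algebra_simps)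
    also have "\<dots> \<le> B\<^sup>2 * (\<bar>?d\<bar> * (2 * (\<bar>\<eta>'\<bar> + \<bar>\<eta>\<bar> + \<bar>t' - t\<bar>)))"
      by (intro mult_left_mono) auto
    finally show ?thesis by (simp add: algebra_simps)
  qed
  ultimately have "\<bar>normal_jump t t' \<theta>' \<eta>' - normal_jump t t' \<theta> \<eta>\<bar>
      \<le> 2 * B\<^sup>2 * ?c * \<bar>\<theta>' - \<theta>\<bar> + 2 * B\<^sup>2 * (\<bar>\<eta>' - \<eta>\<bar> * (\<bar>\<eta>'\<bar> + \<bar>\<eta>\<bar> + \<bar>t' - t\<bar>))"
    unfolding real_norm_def by linarith
  moreover have "2 * b * c * x + 2 * b * (y * z) = b * (2 * x * c + 2 * y * z)" for b c x y z :: real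
    by (simp add: algebra_simps)
  ultimately show ?thesis by (simp only:)
qed

section \<open>Unit tangent and curvature vector\<close>

definition tang :: "real \<Rightarrow> real \<Rightarrow> real^2" where
  "tang \<theta> t = G 1 \<theta> t /\<^sub>R norm (G 1 \<theta> t)"

text \<open>The derivative of \<open>tang\<close> in the curve parameter: the normal part of the
  second derivative, divided by the speed.\<close>

definition dtang :: "real \<Rightarrow> real \<Rightarrow> real^2" where
  "dtang \<theta> t = (G 2 \<theta> t - (G 2 \<theta> t \<bullet> tang \<theta> t) *\<^sub>R tang \<theta> t) /\<^sub>R norm (G 1 \<theta> t)"

text \<open>The second arc-length derivative of the position, hence independent of the
  parametrization and of its direction.\<close>

definition curvature :: "real \<Rightarrow> real \<Rightarrow> real^2" where
  "curvature \<theta> t = dtang \<theta> t /\<^sub>R norm (G 1 \<theta> t)"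

lemma G1_nonzero: "t \<in> {0..T} \<Longrightarrow> G 1 \<theta> t \<noteq> 0"
  using regular[of t \<theta>] B by (auto simp: divide_le_0_iff)

lemma norm_tang: "t \<in> {0..T} \<Longrightarrow> norm (tang \<theta> t) = 1"
  using G1_nonzero by (simp add: tang_def)

lemma inverse_norm_le: "t \<in> {0..T} \<Longrightarrow> inverse (norm (G 1 \<theta> t)) \<le> B"
  using regular[of t \<theta>] B le_imp_inverse_le[of "1 / B" "norm (G 1 \<theta> t)"] by simp

lemma tang_deriv: assumes t: "t \<in> {0..T}" shows "((\<lambda>\<theta>. tang \<theta> t) has_vector_derivative dtang \<theta> t) (at \<theta>)"
proof -
  let ?g = "\<lambda>\<theta>. G 1 \<theta> t"
  have nz: "?g \<theta> \<noteq> 0" using G1_nonzero[OF t] .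
  have g: "(?g has_derivative (\<lambda>h. h *\<^sub>R G 2 \<theta> t)) (at \<theta>)"
    using deriv[OF t, of 1 \<theta>] by (simp add: has_vector_derivative_def numeral_2_eq_2)
  have n: "((\<lambda>\<theta>. norm (?g \<theta>)) has_derivative (\<lambda>h. h *\<^sub>R G 2 \<theta> t \<bullet> sgn (?g \<theta>))) (at \<theta>)"
    using has_derivative_compose[OF g has_derivative_norm[OF nz]] by simp
  have "((\<lambda>\<theta>. inverse (norm (?g \<theta>)) *\<^sub>R ?g \<theta>) has_derivative
     (\<lambda>h. inverse (norm (?g \<theta>)) *\<^sub>R (h *\<^sub>R G 2 \<theta> t) + (- (inverse (norm (?g \<theta>)) * (h *\<^sub>R G 2 \<theta> t \<bullet> sgn (?g \<theta>)) * inverse (norm (?g \<theta>)))) *\<^sub>R ?g \<theta>)) (at \<theta>)"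
    by (rule has_derivative_scaleR[OF Deriv.has_derivative_inverse[OF _ n] g]) (use nz in simp)
  then show ?thesis unfolding has_vector_derivative_def tang_def
    by (rule has_derivative_eq_rhs)
       (simp add: dtang_def tang_def sgn_div_norm scaleR_diff_right fun_eq_iff mult_ac)
qed

lemma dtang_le: assumes t: "t \<in> {0..T}" shows "norm (dtang \<theta> t) \<le> 2 * B\<^sup>2"
proof -
  have "\<bar>G 2 \<theta> t \<bullet> tang \<theta> t\<bar> \<le> B * 1"
    using bound[of 2 t \<theta>] t norm_tang[OF t, of \<theta>] Cauchy_Schwarz_ineq2[of "G 2 \<theta> t" "tang \<theta> t"] by simp
  then have "norm (G 2 \<theta> t - (G 2 \<theta> t \<bullet> tang \<theta> t) *\<^sub>R tang \<theta> t) \<le> 2 * B"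
    using bound[of 2 t \<theta>] t norm_tang[OF t, of \<theta>]
    by (intro order_trans[OF norm_triangle_ineq4]) simp
  then have "norm (dtang \<theta> t) \<le> B * (2 * B)"
    unfolding dtang_def norm_scaleR using inverse_norm_le[OF t, of \<theta>] B by (intro mult_mono) auto
  then show ?thesis by (simp add: power2_eq_square)
qed

lemma tang_lip: assumes t: "t \<in> {0..T}" shows "norm (tang x t - tang y t) \<le> 2 * B\<^sup>2 * \<bar>x - y\<bar>"
  using dtang_le[OF t] by (intro vector_mean_value_bound[where f = "\<lambda>\<theta>. tang \<theta> t" and f' = "\<lambda>\<theta>. dtang \<theta> t"] tang_deriv[OF t]) auto

lemma inverse_norm_lip: assumes t: "t \<in> {0..T}"
  shows "\<bar>inverse (norm (G 1 x t)) - inverse (norm (G 1 y t))\<bar> \<le> B^3 * \<bar>x - y\<bar>"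
proof -
  let ?a = "norm (G 1 x t)" and ?b = "norm (G 1 y t)"
  have "inverse ?a - inverse ?b = inverse ?a * (?b - ?a) * inverse ?b"
    using G1_nonzero[OF t] by (intro inverse_diff_inverse[THEN trans]) (auto simp: algebra_simps)
  then have "\<bar>inverse ?a - inverse ?b\<bar> = inverse ?a * \<bar>?b - ?a\<bar> * inverse ?b" by (simp add: abs_mult)
  also have "\<dots> \<le> B * (B * \<bar>x - y\<bar>) * B"
    using inverse_norm_le[OF t] B lip[of 1 t x y] t norm_triangle_ineq3[of "G 1 y t" "G 1 x t"]
    by (intro mult_mono) (auto simp: norm_minus_commute)
  finally show ?thesis by (simp add: power3_eq_cube mult_ac)
qed

lemma dtang_lip: assumes t: "t \<in> {0..T}" shows "norm (dtang x t - dtang y t) \<le> 8 * B^4 * \<bar>x - y\<bar>"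
proof -
  define V where "V z = G 2 z t - (G 2 z t \<bullet> tang z t) *\<^sub>R tang z t" for z
  have ip: "\<bar>G 2 z t \<bullet> tang z t\<bar> \<le> B" for z
    using bound[of 2 t z] t norm_tang[OF t, of z] Cauchy_Schwarz_ineq2[of "G 2 z t" "tang z t"] by simp
  have Vle: "norm (V z) \<le> 2 * B" for z
    unfolding V_def using bound[of 2 t z] t norm_tang[OF t, of z] ip[of z]
    by (intro order_trans[OF norm_triangle_ineq4]) simp
  have "\<bar>G 2 x t \<bullet> tang x t - G 2 y t \<bullet> tang y t\<bar> \<le> (B * \<bar>x - y\<bar>) * 1 + B * (2 * B\<^sup>2 * \<bar>x - y\<bar>)"
    using lip[of 2 t x y] t norm_tang[OF t] bound[of 2 t y] tang_lip[OF t, of x y] B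
    by (intro order_trans[OF inner_diff_le] add_mono mult_mono) auto
  then have 1: "norm ((G 2 x t \<bullet> tang x t) *\<^sub>R tang x t - (G 2 y t \<bullet> tang y t) *\<^sub>R tang y t)
     \<le> ((B * \<bar>x - y\<bar>) * 1 + B * (2 * B\<^sup>2 * \<bar>x - y\<bar>)) * 1 + B * (2 * B\<^sup>2 * \<bar>x - y\<bar>)"
    using ip[of y] norm_tang[OF t] tang_lip[OF t, of x y] B
    by (intro order_trans[OF scaleR_diff_le] add_mono mult_mono) auto
  have "V x - V y = (G 2 x t - G 2 y t) - ((G 2 x t \<bullet> tang x t) *\<^sub>R tang x t - (G 2 y t \<bullet> tang y t) *\<^sub>R tang y t)"
    by (simp add: V_def)
  then have "norm (V x - V y) \<le> norm (G 2 x t - G 2 y t) + norm ((G 2 x t \<bullet> tang x t) *\<^sub>R tang x t - (G 2 y t \<bullet> tang y t) *\<^sub>R tang y t)"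
    by (metis norm_triangle_ineq4)
  also have "\<dots> \<le> B * \<bar>x - y\<bar> + (((B * \<bar>x - y\<bar>) * 1 + B * (2 * B\<^sup>2 * \<bar>x - y\<bar>)) * 1 + B * (2 * B\<^sup>2 * \<bar>x - y\<bar>))"
    using 1 lip[of 2 t x y] t by (intro add_mono) auto
  also have "\<dots> = (2 * B + 4 * B^3) * \<bar>x - y\<bar>" by (simp add: power2_eq_square power3_eq_cube algebra_simps)
  also have "\<dots> \<le> (2 * B^3 + 4 * B^3) * \<bar>x - y\<bar>"
    using B power_increasing[of 1 3 B] by (intro mult_right_mono add_right_mono) auto
  finally have V: "norm (V x - V y) \<le> 6 * B^3 * \<bar>x - y\<bar>" by simp
  have "norm (dtang x t - dtang y t) \<le> (B^3 * \<bar>x - y\<bar>) * (2 * B) + B * (6 * B^3 * \<bar>x - y\<bar>)"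
    unfolding dtang_def V_def[symmetric]
    using inverse_norm_lip[OF t, of x y] Vle V inverse_norm_le[OF t, of y] B
    by (intro order_trans[OF scaleR_diff_le] add_mono mult_mono) auto
  then show ?thesis by (simp add: power_eq_if algebra_simps)
qed

lemma tang_linearization: assumes t: "t \<in> {0..T}"
  shows "norm (tang x t - tang y t - (x - y) *\<^sub>R dtang y t) \<le> 8 * B^4 * (x - y)\<^sup>2"
  using B dtang_lip[OF t] by (intro vector_linearization_bound tang_deriv[OF t]) auto

lemma curvature_le: assumes t: "t \<in> {0..T}" shows "norm (curvature \<theta> t) \<le> 2 * B^3"
proof -
  have "norm (curvature \<theta> t) \<le> B * (2 * B\<^sup>2)"
    unfolding curvature_def norm_scaleR using inverse_norm_le[OF t, of \<theta>] dtang_le[OF t, of \<theta>] B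
    by (intro mult_mono) auto
  then show ?thesis by (simp add: power2_eq_square power3_eq_cube)
qed

lemma curvature_lip: assumes t: "t \<in> {0..T}" shows "norm (curvature x t - curvature y t) \<le> 10 * B^5 * \<bar>x - y\<bar>"
proof -
  have "norm (curvature x t - curvature y t) \<le> (B^3 * \<bar>x - y\<bar>) * (2 * B\<^sup>2) + B * (8 * B^4 * \<bar>x - y\<bar>)"
    unfolding curvature_def
    using inverse_norm_lip[OF t, of x y] dtang_le[OF t, of x] dtang_lip[OF t, of x y] inverse_norm_le[OF t, of y] B
    by (intro order_trans[OF scaleR_diff_le] add_mono mult_mono) auto
  then show ?thesis by (simp add: power_eq_if algebra_simps)
qed

lemma curvature_periodic: "t \<in> {0..T} \<Longrightarrow> curvature (\<theta> + of_int z) t = curvature \<theta> t"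
  by (simp add: curvature_def dtang_def tang_def periodic_int)

section \<open>Consistency of chords and of the discrete curvature\<close>

lemma chord_midpoint:
  assumes t: "t \<in> {0..T}"
  shows "norm (G 0 (\<theta> + a) t - G 0 \<theta> t - a *\<^sub>R G 1 (\<theta> + a / 2) t) \<le> B * \<bar>a\<bar>^3 / 4"
proof -
  \<comment> \<open>The chord is written as a symmetric difference about its midpoint parameter, so
    that the second-order terms cancel and the error is cubic.\<close>
  define f where "f s = G 0 (\<theta> + a / 2 + s) t - G 0 (\<theta> + a / 2 - s) t - (2 * s) *\<^sub>R G 1 (\<theta> + a / 2) t" for s
  have "norm (f (a / 2) - f 0) \<le> (2 * B * (a / 2)\<^sup>2) * \<bar>a / 2 - 0\<bar>"
  proof (rule vector_mean_value_bound)
    fix s assume s: "s \<in> closed_segment 0 (a / 2)"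
    have "((\<lambda>s. G 0 (\<theta> + a / 2 + s) t) has_vector_derivative G 1 (\<theta> + a / 2 + s) t) (at s)"
      using affine_vector_chain[OF deriv[OF t], of 0 "\<theta> + a / 2" 1 s] by simp
    moreover have "((\<lambda>s. G 0 (\<theta> + a / 2 - s) t) has_vector_derivative - G 1 (\<theta> + a / 2 - s) t) (at s)"
      using affine_vector_chain[OF deriv[OF t], of 0 "\<theta> + a / 2" "-1" s] by simp
    moreover have "((\<lambda>s. (2 * s) *\<^sub>R G 1 (\<theta> + a / 2) t) has_vector_derivative 2 *\<^sub>R G 1 (\<theta> + a / 2) t) (at s)"
      by (auto intro!: derivative_eq_intros)
    ultimately show "(f has_vector_derivative (G 1 (\<theta> + a / 2 + s) t - (- G 1 (\<theta> + a / 2 - s) t) - 2 *\<^sub>R G 1 (\<theta> + a / 2) t)) (at s)"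
      unfolding f_def by (intro has_vector_derivative_diff)
    let ?m = "\<theta> + a / 2"
    have "G 1 (?m + s) t - (- G 1 (?m - s) t) - 2 *\<^sub>R G 1 ?m t
       = (G 1 (?m + s) t - G 1 ?m t - (?m + s - ?m) *\<^sub>R G (Suc 1) ?m t) + (G 1 (?m - s) t - G 1 ?m t - (?m - s - ?m) *\<^sub>R G (Suc 1) ?m t)"
      by (simp add: algebra_simps scaleR_2)
    also have "norm \<dots> \<le> B * s\<^sup>2 + B * s\<^sup>2"
      using linearization[of 1 t "?m + s" ?m] linearization[of 1 t "?m - s" ?m] t
      by (intro norm_triangle_le add_mono) auto
    also have "\<dots> \<le> 2 * B * (a / 2)\<^sup>2"
    proof -
      have "\<bar>s\<bar> \<le> \<bar>a / 2\<bar>" using s by (auto simp: closed_segment_eq_real_ivl split: if_splits)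
      then have "s\<^sup>2 \<le> (a / 2)\<^sup>2" by (simp only: abs_le_square_iff)
      then show ?thesis using B by simp
    qed
    finally show "norm (G 1 (\<theta> + a / 2 + s) t - (- G 1 (\<theta> + a / 2 - s) t) - 2 *\<^sub>R G 1 (\<theta> + a / 2) t) \<le> 2 * B * (a / 2)\<^sup>2" .
  qed
  moreover have "f (a / 2) - f 0 = G 0 (\<theta> + a) t - G 0 \<theta> t - a *\<^sub>R G 1 (\<theta> + a / 2) t"
    unfolding f_def add.assoc field_sum_of_halves by simp
  moreover have "(2 * B * (a / 2)\<^sup>2) * \<bar>a / 2 - 0\<bar> = B * \<bar>a\<bar>^3 / 4"
    using power2_abs[of "a / 2"] by (simp add: power2_eq_square power3_eq_cube)
  ultimately show ?thesis by (simp only:)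
qed

lemma chord_tangent:
  assumes t: "t \<in> {0..T}" and a: "\<sigma> = 1 \<or> \<sigma> = (-1::real)" "0 < \<sigma> * a"
  shows "norm ((G 0 (\<theta> + a) t - G 0 \<theta> t) /\<^sub>R norm (G 0 (\<theta> + a) t - G 0 \<theta> t) - \<sigma> *\<^sub>R tang (\<theta> + a / 2) t) \<le> B\<^sup>2 * a\<^sup>2 / 2"
proof -
  let ?P = "G 0 (\<theta> + a) t - G 0 \<theta> t" and ?Q = "a *\<^sub>R G 1 (\<theta> + a / 2) t"
  have a0: "a \<noteq> 0" using a by auto
  have Q0: "?Q \<noteq> 0" using G1_nonzero[OF t] a0 by simp
  have "?Q /\<^sub>R norm ?Q = (a / \<bar>a\<bar>) *\<^sub>R tang (\<theta> + a / 2) t"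
    unfolding tang_def by (simp only: norm_scaleR inverse_mult_distrib scaleR_scaleR divide_inverse real_norm_def mult_ac)
  also have "a / \<bar>a\<bar> = \<sigma>" using a by (auto simp: abs_if)
  finally have "norm (?P /\<^sub>R norm ?P - \<sigma> *\<^sub>R tang (\<theta> + a / 2) t) \<le> 2 * norm (?P - ?Q) / norm ?Q"
    using normalize_diff_le[OF Q0, of ?P] by simp
  also have "\<dots> = 2 * norm (?P - ?Q) / \<bar>a\<bar> * inverse (norm (G 1 (\<theta> + a / 2) t))"
    by (simp only: norm_scaleR divide_inverse inverse_mult_distrib mult.assoc)
  also have "\<dots> \<le> 2 * (B * \<bar>a\<bar>^3 / 4) / \<bar>a\<bar> * B"
    using chord_midpoint[OF t, of \<theta> a] inverse_norm_le[OF t] B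
    by (intro mult_mono divide_right_mono) auto
  also have "\<dots> = B * B * (\<bar>a\<bar>^3 / \<bar>a\<bar>) / 2" by (simp add: mult_ac)
  also have "\<bar>a\<bar>^3 / \<bar>a\<bar> = a\<^sup>2" using a0 by (simp add: power2_eq_square power3_eq_cube)
  also have "B * B * a\<^sup>2 / 2 = B\<^sup>2 * a\<^sup>2 / 2" by (simp add: power2_eq_square)
  finally show ?thesis .
qed

text \<open>Edge directions agree to second order with exact tangents at midpoint parameters, which
  are \<open>(\<bar>a\<bar> + \<bar>b\<bar>) / 2\<close> apart, so their difference divided by
  \<open>m\<close> is the curvature up to O(h). Relative perturbations \<open>n\<^sub>1\<close>,
  \<open>n\<^sub>2\<close> of the edges turn them by at most twice that amount, and division by
  \<open>m\<close> costs 1/h. The sign \<sigma> tells whether the polygon runs with or against the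
  parametrization.\<close>

lemma node_curvature_consistent:
  assumes t: "t \<in> {0..T}" and \<sigma>: "\<sigma> = 1 \<or> \<sigma> = (-1::real)" and ab: "0 < \<sigma> * a" "0 < \<sigma> * b"
    and E: "E\<^sub>1 \<noteq> 0" "E\<^sub>2 \<noteq> 0"
    and n: "norm (E\<^sub>1 - (G 0 (\<theta> + a) t - G 0 \<theta> t)) \<le> n\<^sub>1 * norm (G 0 (\<theta> + a) t - G 0 \<theta> t)"
      "norm (E\<^sub>2 - (G 0 \<theta> t - G 0 (\<theta> - b) t)) \<le> n\<^sub>2 * norm (G 0 \<theta> t - G 0 (\<theta> - b) t)"
    and m: "m = (norm E\<^sub>1 + norm E\<^sub>2) / 2"
  shows "norm ((E\<^sub>1 /\<^sub>R norm E\<^sub>1 - E\<^sub>2 /\<^sub>R norm E\<^sub>2) /\<^sub>R m - curvature \<theta> t)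
    \<le> (4 * B^4 * (a\<^sup>2 + b\<^sup>2) + 2 * n\<^sub>1 + 2 * n\<^sub>2
        + B^3 * (n\<^sub>1 * norm (G 0 (\<theta> + a) t - G 0 \<theta> t) + n\<^sub>2 * norm (G 0 \<theta> t - G 0 (\<theta> - b) t))) / m"
    and "norm (E\<^sub>1 /\<^sub>R norm E\<^sub>1 - \<sigma> *\<^sub>R tang \<theta> t) \<le> B\<^sup>2 * a\<^sup>2 / 2 + B\<^sup>2 * \<bar>a\<bar> + 2 * n\<^sub>1"
proof -
  let ?P1 = "G 0 (\<theta> + a) t - G 0 \<theta> t" and ?P2 = "G 0 \<theta> t - G 0 (\<theta> - b) t"
  let ?t1 = "tang (\<theta> + a / 2) t" and ?t2 = "tang (\<theta> - b / 2) t"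
  have "0 < norm E\<^sub>1" "0 < norm E\<^sub>2" using E by auto
  then have m0: "0 < m" unfolding m by (simp add: add_pos_pos)
  have abs_ab: "\<bar>a\<bar> = \<sigma> * a" "\<bar>b\<bar> = \<sigma> * b" using ab \<sigma> by auto
  have P1: "norm (?P1 - a *\<^sub>R G 1 \<theta> t) \<le> B * a\<^sup>2" using linearization[of 0 t "\<theta> + a" \<theta>] t by simp
  have "norm (G 0 (\<theta> - b) t - G 0 \<theta> t - (- b) *\<^sub>R G 1 \<theta> t) \<le> B * b\<^sup>2"
    using linearization[of 0 t "\<theta> - b" \<theta>] t by simp
  moreover have "?P2 - b *\<^sub>R G 1 \<theta> t = - (G 0 (\<theta> - b) t - G 0 \<theta> t - (- b) *\<^sub>R G 1 \<theta> t)"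
    by simp
  ultimately have P2: "norm (?P2 - b *\<^sub>R G 1 \<theta> t) \<le> B * b\<^sup>2"
    by (simp only: norm_minus_cancel)
  have nz: "?P1 \<noteq> 0" "?P2 \<noteq> 0" using n E by auto
  have E1: "norm (E\<^sub>1 /\<^sub>R norm E\<^sub>1 - ?P1 /\<^sub>R norm ?P1) \<le> 2 * n\<^sub>1"
  proof -
    have "2 * norm (E\<^sub>1 - ?P1) / norm ?P1 \<le> 2 * n\<^sub>1"
      using n(1) nz(1) by (simp add: pos_divide_le_eq)
    then show ?thesis using normalize_diff_le[OF nz(1), of E\<^sub>1] by linarith
  qed
  have E2: "norm (E\<^sub>2 /\<^sub>R norm E\<^sub>2 - ?P2 /\<^sub>R norm ?P2) \<le> 2 * n\<^sub>2"
  proof -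
    have "2 * norm (E\<^sub>2 - ?P2) / norm ?P2 \<le> 2 * n\<^sub>2"
      using n(2) nz(2) by (simp add: pos_divide_le_eq)
    then show ?thesis using normalize_diff_le[OF nz(2), of E\<^sub>2] by linarith
  qed
  have c1: "norm (?P1 /\<^sub>R norm ?P1 - \<sigma> *\<^sub>R ?t1) \<le> B\<^sup>2 * a\<^sup>2 / 2"
    by (rule chord_tangent[OF t \<sigma> ab(1)])
  have "norm ((G 0 (\<theta> - b + b) t - G 0 (\<theta> - b) t) /\<^sub>R norm (G 0 (\<theta> - b + b) t - G 0 (\<theta> - b) t)
      - \<sigma> *\<^sub>R tang (\<theta> - b + b / 2) t) \<le> B\<^sup>2 * b\<^sup>2 / 2"
    by (rule chord_tangent[OF t \<sigma> ab(2)])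
  moreover have "\<theta> - b + b = \<theta>" "\<theta> - b + b / 2 = \<theta> - b / 2" by simp_all
  ultimately have c2: "norm (?P2 /\<^sub>R norm ?P2 - \<sigma> *\<^sub>R ?t2) \<le> B\<^sup>2 * b\<^sup>2 / 2"
    by (simp only:)
  let ?R1 = "?t1 - tang \<theta> t - (a / 2) *\<^sub>R dtang \<theta> t" and ?R2 = "?t2 - tang \<theta> t - (- b / 2) *\<^sub>R dtang \<theta> t"
  have l1: "norm ?R1 \<le> 8 * B^4 * (a / 2)\<^sup>2"
    using tang_linearization[OF t, of "\<theta> + a / 2" \<theta>] by simp
  have l2: "norm ?R2 \<le> 8 * B^4 * (b / 2)\<^sup>2"
    using tang_linearization[OF t, of "\<theta> - b / 2" \<theta>] by simp
  let ?A1 = "E\<^sub>1 /\<^sub>R norm E\<^sub>1 - \<sigma> *\<^sub>R ?t1" and ?A2 = "E\<^sub>2 /\<^sub>R norm E\<^sub>2 - \<sigma> *\<^sub>R ?t2"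
  have A1: "norm ?A1 \<le> B\<^sup>2 * a\<^sup>2 / 2 + 2 * n\<^sub>1"
    using norm_triangle_mono[OF E1 c1] by simp
  have A2: "norm ?A2 \<le> B\<^sup>2 * b\<^sup>2 / 2 + 2 * n\<^sub>2"
    using norm_triangle_mono[OF E2 c2] by simp
  have len: "\<bar>m - (\<bar>a\<bar> + \<bar>b\<bar>) / 2 * norm (G 1 \<theta> t)\<bar> \<le> (B * (a\<^sup>2 + b\<^sup>2) + n\<^sub>1 * norm ?P1 + n\<^sub>2 * norm ?P2) / 2"
  proof -
    have "\<bar>norm E\<^sub>1 - norm (a *\<^sub>R G 1 \<theta> t)\<bar> \<le> norm (E\<^sub>1 - a *\<^sub>R G 1 \<theta> t)" by (rule norm_triangle_ineq3)
    also have "\<dots> \<le> n\<^sub>1 * norm ?P1 + B * a\<^sup>2" using norm_triangle_mono[OF n(1) P1] by simp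
    finally have 1: "\<bar>norm E\<^sub>1 - \<bar>a\<bar> * norm (G 1 \<theta> t)\<bar> \<le> n\<^sub>1 * norm ?P1 + B * a\<^sup>2" by simp
    have "\<bar>norm E\<^sub>2 - norm (b *\<^sub>R G 1 \<theta> t)\<bar> \<le> norm (E\<^sub>2 - b *\<^sub>R G 1 \<theta> t)" by (rule norm_triangle_ineq3)
    also have "\<dots> \<le> n\<^sub>2 * norm ?P2 + B * b\<^sup>2" using norm_triangle_mono[OF n(2) P2] by simp
    finally have 2: "\<bar>norm E\<^sub>2 - \<bar>b\<bar> * norm (G 1 \<theta> t)\<bar> \<le> n\<^sub>2 * norm ?P2 + B * b\<^sup>2" by simp
    have "m - (\<bar>a\<bar> + \<bar>b\<bar>) / 2 * norm (G 1 \<theta> t)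
       = ((norm E\<^sub>1 - \<bar>a\<bar> * norm (G 1 \<theta> t)) + (norm E\<^sub>2 - \<bar>b\<bar> * norm (G 1 \<theta> t))) / 2"
      by (simp add: m algebra_simps add_divide_distrib)
    moreover have "\<bar>(x + y) / 2\<bar> \<le> (u + v) / 2" if "\<bar>x\<bar> \<le> u" "\<bar>y\<bar> \<le> v" for x y u v :: real
      using that by (simp add: abs_le_iff)
    from this[OF 1 2] have "\<bar>((norm E\<^sub>1 - \<bar>a\<bar> * norm (G 1 \<theta> t)) + (norm E\<^sub>2 - \<bar>b\<bar> * norm (G 1 \<theta> t))) / 2\<bar>
      \<le> (B * (a\<^sup>2 + b\<^sup>2) + n\<^sub>1 * norm ?P1 + n\<^sub>2 * norm ?P2) / 2" by (simp add: distrib_left algebra_simps)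
    ultimately show ?thesis by (simp only:)
  qed
  have dt: "dtang \<theta> t = norm (G 1 \<theta> t) *\<^sub>R curvature \<theta> t"
    using G1_nonzero[OF t] by (simp add: curvature_def)
  let ?u = "E\<^sub>1 /\<^sub>R norm E\<^sub>1 - E\<^sub>2 /\<^sub>R norm E\<^sub>2"
  \<comment> \<open>Direction errors and linearization remainders are collected on the left; the
    values of \<open>tang\<close> at the node cancel and only its first-order variation is left
    over.\<close>
  have "(?A1 - ?A2) + \<sigma> *\<^sub>R (?R1 - ?R2) = ?u - (\<sigma> * (a / 2) + \<sigma> * (b / 2)) *\<^sub>R dtang \<theta> t"
    by (simp add: algebra_simps)
  also have "\<sigma> * (a / 2) + \<sigma> * (b / 2) = (\<bar>a\<bar> + \<bar>b\<bar>) / 2" unfolding abs_ab by simp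
  finally have eq: "?u - m *\<^sub>R curvature \<theta> t = ((?A1 - ?A2) + \<sigma> *\<^sub>R (?R1 - ?R2))
     + ((\<bar>a\<bar> + \<bar>b\<bar>) / 2 * norm (G 1 \<theta> t) - m) *\<^sub>R curvature \<theta> t"
    unfolding dt by (simp add: algebra_simps)
  have "norm (?u - m *\<^sub>R curvature \<theta> t) \<le> ((B\<^sup>2 * a\<^sup>2 / 2 + 2 * n\<^sub>1) + (B\<^sup>2 * b\<^sup>2 / 2 + 2 * n\<^sub>2)
      + 1 * (8 * B^4 * (a / 2)\<^sup>2 + 8 * B^4 * (b / 2)\<^sup>2))
      + (B * (a\<^sup>2 + b\<^sup>2) + n\<^sub>1 * norm ?P1 + n\<^sub>2 * norm ?P2) / 2 * (2 * B^3)"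
    unfolding eq
  proof (intro norm_triangle_mono)
    show "norm (?A1 - ?A2) \<le> (B\<^sup>2 * a\<^sup>2 / 2 + 2 * n\<^sub>1) + (B\<^sup>2 * b\<^sup>2 / 2 + 2 * n\<^sub>2)"
      by (rule order_trans[OF norm_triangle_ineq4 add_mono[OF A1 A2]])
    show "norm (\<sigma> *\<^sub>R (?R1 - ?R2)) \<le> 1 * (8 * B^4 * (a / 2)\<^sup>2 + 8 * B^4 * (b / 2)\<^sup>2)"
      unfolding norm_scaleR using \<sigma>
      by (intro mult_mono order_trans[OF norm_triangle_ineq4 add_mono[OF l1 l2]]) auto
    show "norm (((\<bar>a\<bar> + \<bar>b\<bar>) / 2 * norm (G 1 \<theta> t) - m) *\<^sub>R curvature \<theta> t)
       \<le> (B * (a\<^sup>2 + b\<^sup>2) + n\<^sub>1 * norm ?P1 + n\<^sub>2 * norm ?P2) / 2 * (2 * B^3)"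
      unfolding norm_scaleR using len curvature_le[OF t, of \<theta>]
      by (intro mult_mono order_trans[OF abs_ge_zero len]) (auto simp: abs_minus_commute)
  qed
  also have "\<dots> = (B\<^sup>2 / 2 + 3 * B^4) * (a\<^sup>2 + b\<^sup>2) + 2 * n\<^sub>1 + 2 * n\<^sub>2 + B^3 * (n\<^sub>1 * norm ?P1 + n\<^sub>2 * norm ?P2)"
    by (simp add: power_eq_if field_simps)
  also have "\<dots> \<le> (4 * B^4) * (a\<^sup>2 + b\<^sup>2) + 2 * n\<^sub>1 + 2 * n\<^sub>2 + B^3 * (n\<^sub>1 * norm ?P1 + n\<^sub>2 * norm ?P2)"
  proof -
    have "B\<^sup>2 \<le> B^4" "0 \<le> B^4" using B power_increasing[of 2 4 B] by auto
    then have "B\<^sup>2 / 2 + 3 * B^4 \<le> 4 * B^4" by linarith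
    then show ?thesis by (intro add_right_mono mult_right_mono) auto
  qed
  finally have fin: "norm (?u - m *\<^sub>R curvature \<theta> t) \<le> 4 * B^4 * (a\<^sup>2 + b\<^sup>2) + 2 * n\<^sub>1 + 2 * n\<^sub>2 + B^3 * (n\<^sub>1 * norm ?P1 + n\<^sub>2 * norm ?P2)"
    by simp
  have "?u /\<^sub>R m - curvature \<theta> t = (?u - m *\<^sub>R curvature \<theta> t) /\<^sub>R m" using m0 by (simp add: scaleR_diff_right)
  then have "norm (?u /\<^sub>R m - curvature \<theta> t) = norm (?u - m *\<^sub>R curvature \<theta> t) / m"
    using m0 by (simp add: divide_inverse mult.commute)
  also have "\<dots> \<le> (4 * B^4 * (a\<^sup>2 + b\<^sup>2) + 2 * n\<^sub>1 + 2 * n\<^sub>2 + B^3 * (n\<^sub>1 * norm ?P1 + n\<^sub>2 * norm ?P2)) / m"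
    using fin m0 by (intro divide_right_mono) auto
  finally show "norm ((E\<^sub>1 /\<^sub>R norm E\<^sub>1 - E\<^sub>2 /\<^sub>R norm E\<^sub>2) /\<^sub>R m - curvature \<theta> t)
    \<le> (4 * B^4 * (a\<^sup>2 + b\<^sup>2) + 2 * n\<^sub>1 + 2 * n\<^sub>2 + B^3 * (n\<^sub>1 * norm ?P1 + n\<^sub>2 * norm ?P2)) / m" .
  have "norm (?A1 + \<sigma> *\<^sub>R (?t1 - tang \<theta> t)) \<le> (B\<^sup>2 * a\<^sup>2 / 2 + 2 * n\<^sub>1) + B\<^sup>2 * \<bar>a\<bar>"
    using \<sigma> tang_lip[OF t, of "\<theta> + a / 2" \<theta>] by (intro norm_triangle_mono A1) auto
  then show "norm (E\<^sub>1 /\<^sub>R norm E\<^sub>1 - \<sigma> *\<^sub>R tang \<theta> t) \<le> B\<^sup>2 * a\<^sup>2 / 2 + B\<^sup>2 * \<bar>a\<bar> + 2 * n\<^sub>1"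
    by (simp add: scaleR_diff_right algebra_simps)
qed

section \<open>Closest points on the curve\<close>

abbreviation curve :: "real \<Rightarrow> (real^2) set" where
  "curve t \<equiv> range (\<lambda>\<theta>. G 0 \<theta> t)"

lemma curve_compact: assumes t: "t \<in> {0..T}" shows "compact (curve t)"
proof -
  have "curve t = (\<lambda>\<theta>. G 0 \<theta> t) ` {0..1}"
  proof (intro equalityI subsetI)
    fix y assume "y \<in> curve t"
    then obtain \<theta> where "y = G 0 \<theta> t" by auto
    also have "\<dots> = G 0 (frac \<theta>) t"
      using periodic_int[OF t, of 0 "frac \<theta>" "\<lfloor>\<theta>\<rfloor>"] by (simp add: frac_def)
    finally show "y \<in> (\<lambda>\<theta>. G 0 \<theta> t) ` {0..1}" using frac_lt_1[of \<theta>] by (auto simp: less_imp_le)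
  qed auto
  moreover have "continuous_on {0..1} (\<lambda>\<theta>. G 0 \<theta> t)"
    using deriv[OF t, of 0]
    by (meson continuous_at_imp_continuous_on has_vector_derivative_continuous)
  ultimately show ?thesis by (simp add: compact_continuous_image)
qed

lemma closest_point_in_curve:
  assumes "t \<in> {0..T}"
  shows "closest_point (curve t) y \<in> curve t" "\<And>p. p \<in> curve t \<Longrightarrow> dist y (closest_point (curve t) y) \<le> dist y p"
  using closest_point_exists[of "curve t" y] compact_imp_closed[OF curve_compact[OF assms]] by auto

lemma closest_point_orthogonal:
  assumes t: "t \<in> {0..T}" and p: "closest_point (curve t) y = G 0 \<theta> t"
  shows "(y - G 0 \<theta> t) \<bullet> G 1 \<theta> t = 0"
proof -
  let ?f = "\<lambda>s. (y - G 0 s t) \<bullet> (y - G 0 s t)"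
  have d: "((\<lambda>s. y - G 0 s t) has_vector_derivative - G 1 \<theta> t) (at \<theta>)"
    using has_vector_derivative_diff[OF has_vector_derivative_const deriv[OF t, of 0 \<theta>], of y] by simp
  have "(?f has_vector_derivative ((y - G 0 \<theta> t) \<bullet> (- G 1 \<theta> t) + (- G 1 \<theta> t) \<bullet> (y - G 0 \<theta> t))) (at \<theta>)"
    by (rule bounded_bilinear.has_vector_derivative[OF bounded_bilinear_inner d d])
  then have "DERIV ?f \<theta> :> - 2 * ((y - G 0 \<theta> t) \<bullet> G 1 \<theta> t)"
    by (simp add: has_real_derivative_iff_has_vector_derivative inner_commute)
  then have "- 2 * ((y - G 0 \<theta> t) \<bullet> G 1 \<theta> t) = 0"
  proof (rule DERIV_local_min[OF _ zero_less_one], intro allI impI)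
    fix s
    have "norm (y - G 0 \<theta> t) \<le> norm (y - G 0 s t)"
      using closest_point_in_curve(2)[OF t, of "G 0 s t" y] p by (simp add: dist_norm)
    then show "?f \<theta> \<le> ?f s" by (simp add: norm_le)
  qed
  then show ?thesis by simp
qed

text \<open>Adding a suitable integer brings any parameter of \<open>p\<close> within 1/2 of the
  reference parameter, where arc and chord are comparable.\<close>

lemma curve_lift:
  assumes t: "t \<in> {0..T}" and p: "p \<in> curve t"
  obtains \<theta> where "p = G 0 \<theta> t" "\<bar>\<theta> - \<theta>0\<bar> \<le> B * norm (p - G 0 \<theta>0 t)" "\<bar>\<theta> - \<theta>0\<bar> \<le> 1 / 2"
proof -
  obtain s where s: "p = G 0 s t" using p by auto
  let ?z = "round (\<theta>0 - s)"
  have "\<bar>s + of_int ?z - \<theta>0\<bar> \<le> 1 / 2" using of_int_round_abs_le[of "\<theta>0 - s"] by (simp add: algebra_simps)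
  moreover from this have "\<bar>s + of_int ?z - \<theta>0\<bar> \<le> B * norm (G 0 (s + of_int ?z) t - G 0 \<theta>0 t)"
    by (rule chord[OF t])
  ultimately show ?thesis using that[of "s + of_int ?z"] s periodic_int[OF t, of 0 s ?z] by simp
qed

lemma param_unique:
  assumes t: "t \<in> {0..T}" and eq: "G 0 x t = G 0 y t"
  obtains z :: int where "x = y + of_int z"
proof -
  have "\<bar>x - y - of_int (round (x - y))\<bar> \<le> 1 / 2"
    using of_int_round_abs_le[of "x - y"] by (simp add: abs_minus_commute)
  then have "\<bar>x - (y + of_int (round (x - y)))\<bar> \<le> B * norm (G 0 x t - G 0 (y + of_int (round (x - y))) t)"
    by (intro chord[OF t]) (simp add: algebra_simps)
  then have "x = y + of_int (round (x - y))" using eq periodic_int[OF t, of 0 y] by simp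
  then show ?thesis by (rule that)
qed

lemma inner_tangent_le: assumes t: "t \<in> {0..T}" shows "1 / B\<^sup>2 \<le> G 1 \<theta> t \<bullet> G 1 \<theta> t"
proof -
  have "(1 / B)\<^sup>2 \<le> (norm (G 1 \<theta> t))\<^sup>2" using regular[OF t] B by (intro power_mono) auto
  then show ?thesis by (simp add: power2_norm_eq_inner power_divide)
qed

lemma chord_dot_tangent:
  assumes t: "t \<in> {0..T}"
  shows "\<bar>(G 0 x t - G 0 r t) \<bullet> G 1 r t - (x - r) * (G 1 r t \<bullet> G 1 r t)\<bar> \<le> B\<^sup>2 * (x - r)\<^sup>2"
proof -
  have "(G 0 x t - G 0 r t) \<bullet> G 1 r t - (x - r) * (G 1 r t \<bullet> G 1 r t)
     = (G 0 x t - G 0 r t - (x - r) *\<^sub>R G (Suc 0) r t) \<bullet> G 1 r t" by (simp add: inner_simps)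
  also have "\<bar>\<dots>\<bar> \<le> (B * (x - r)\<^sup>2) * B"
    using linearization[of 0 t x r] bound[of 1 t r] t B
    by (intro order_trans[OF Cauchy_Schwarz_ineq2] mult_mono) auto
  finally show ?thesis by (simp add: power2_eq_square mult_ac)
qed

text \<open>The true minimiser is also a critical point of the distance, and its parameter is within
  a multiple of the distance of \<open>r\<close>. Subtracting the two orthogonality conditions gives
  an inequality in which the squared speed dominates all other coefficients, so the parameters
  agree.\<close>

lemma closest_point_eq:
  assumes t: "t \<in> {0..T}" and orth: "(y - G 0 r t) \<bullet> G 1 r t = 0" and near: "3 * B^5 * norm (y - G 0 r t) < 1"
  shows "closest_point (curve t) y = G 0 r t"
proof -
  let ?\<rho> = "norm (y - G 0 r t)"
  obtain r' where r': "closest_point (curve t) y = G 0 r' t" "\<bar>r' - r\<bar> \<le> B * norm (closest_point (curve t) y - G 0 r t)"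
    using curve_lift[OF t closest_point_in_curve(1)[OF t], of y r] by metis
  have "norm (y - G 0 r' t) \<le> ?\<rho>"
    using closest_point_in_curve(2)[OF t, of "G 0 r t" y] r'(1) by (simp add: dist_norm)
  then have "norm (G 0 r' t - G 0 r t) \<le> 2 * ?\<rho>"
    using norm_triangle_ineq4[of "y - G 0 r t" "y - G 0 r' t"] by simp
  then have "B * norm (G 0 r' t - G 0 r t) \<le> B * (2 * ?\<rho>)" using B by (intro mult_left_mono) auto
  then have d: "\<bar>r - r'\<bar> \<le> B * (2 * ?\<rho>)" using r' by (simp add: abs_minus_commute)
  have "0 = (y - G 0 r' t) \<bullet> G 1 r' t" using closest_point_orthogonal[OF t r'(1)] by simp
  also have "\<dots> = (y - G 0 r t) \<bullet> (G 1 r' t - G 1 r t) + (G 0 r t - G 0 r' t) \<bullet> G 1 r' t"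
    using orth by (simp add: inner_simps)
  finally have "\<bar>(G 0 r t - G 0 r' t) \<bullet> G 1 r' t\<bar> = \<bar>(y - G 0 r t) \<bullet> (G 1 r' t - G 1 r t)\<bar>" by linarith
  also have "\<dots> \<le> ?\<rho> * (B * \<bar>r - r'\<bar>)"
    using lip[of 1 t r' r] t by (intro order_trans[OF Cauchy_Schwarz_ineq2] mult_left_mono) (auto simp: abs_minus_commute)
  finally have 1: "\<bar>(G 0 r t - G 0 r' t) \<bullet> G 1 r' t\<bar> \<le> ?\<rho> * (B * \<bar>r - r'\<bar>)" .
  have "\<bar>r - r'\<bar> * (1 / B\<^sup>2) \<le> \<bar>r - r'\<bar> * (G 1 r' t \<bullet> G 1 r' t)"
    using inner_tangent_le[OF t] by (intro mult_left_mono) auto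
  also have "\<dots> = \<bar>(r - r') * (G 1 r' t \<bullet> G 1 r' t)\<bar>" by (simp add: abs_mult)
  also have "\<dots> \<le> ?\<rho> * (B * \<bar>r - r'\<bar>) + B\<^sup>2 * (r - r')\<^sup>2"
    using chord_dot_tangent[OF t, of r r'] 1 by linarith
  also have "(r - r')\<^sup>2 = \<bar>r - r'\<bar> * \<bar>r - r'\<bar>" by (simp add: power2_eq_square)
  also have "\<dots> \<le> \<bar>r - r'\<bar> * (B * (2 * ?\<rho>))" using d by (intro mult_left_mono) auto
  finally have "\<bar>r - r'\<bar> * (1 / B\<^sup>2) \<le> ?\<rho> * (B * \<bar>r - r'\<bar>) + B\<^sup>2 * (\<bar>r - r'\<bar> * (B * (2 * ?\<rho>)))"
    by (simp add: mult_left_mono)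
  then have "\<bar>r - r'\<bar> * (1 / B\<^sup>2) \<le> \<bar>r - r'\<bar> * (?\<rho> * B + 2 * B^3 * ?\<rho>)"
    by (simp add: power2_eq_square power3_eq_cube algebra_simps)
  moreover have "?\<rho> * B + 2 * B^3 * ?\<rho> < 1 / B\<^sup>2"
  proof -
    have "?\<rho> * B + 2 * B^3 * ?\<rho> \<le> 3 * B^3 * ?\<rho>"
      using B power_increasing[of 1 3 B] mult_right_mono[of B "B^3" ?\<rho>] by (simp add: mult.commute)
    also have "\<dots> = (3 * B^5 * ?\<rho>) / B\<^sup>2" using B by (simp add: power_eq_if)
    also have "\<dots> < 1 / B\<^sup>2" using near B by (intro divide_strict_right_mono) auto
    finally show ?thesis .
  qed
  ultimately have "\<not> 0 < \<bar>r - r'\<bar>" using mult_less_cancel_left_pos[of "\<bar>r - r'\<bar>"] by (meson not_less)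
  then show ?thesis using r' by simp
qed

text \<open>Seen along the tangent at \<open>r\<close>, the two chord ends lie on opposite sides of
  the normal line through the arc point. The chord crosses that line at a point close enough for
  \<open>closest_point_eq\<close> to apply.\<close>

lemma arc_covered:
  assumes t: "t \<in> {0..T}" and r: "a < r" "r < b" and small: "3 * B^6 * (b - a) < 1"
  shows "\<exists>s. 0 < s \<and> s < 1 \<and> closest_point (curve t) ((1 - s) *\<^sub>R G 0 a t + s *\<^sub>R G 0 b t) = G 0 r t"
proof -
  let ?g = "G 1 r t \<bullet> G 1 r t"
  let ?\<alpha> = "(G 0 a t - G 0 r t) \<bullet> G 1 r t" and ?\<beta> = "(G 0 b t - G 0 r t) \<bullet> G 1 r t"
  have B4: "B\<^sup>2 * (b - a) < 1 / B\<^sup>2"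
  proof -
    have "B^4 * (b - a) \<le> 3 * B^6 * (b - a)"
      using B r power_increasing[of 4 6 B] zero_le_power[of B 6] by (intro mult_right_mono) linarith+
    then have "B^4 * (b - a) < 1" using small by linarith
    then show ?thesis using B by (simp add: pos_less_divide_eq power_eq_if mult_ac)
  qed
  have *: "B\<^sup>2 * (x - r)\<^sup>2 < \<bar>x - r\<bar> * ?g" if "x \<noteq> r" "\<bar>x - r\<bar> \<le> b - a" for x
  proof -
    have "B\<^sup>2 * (x - r)\<^sup>2 = \<bar>x - r\<bar> * (B\<^sup>2 * \<bar>x - r\<bar>)" by (simp add: power2_eq_square)
    also have "\<dots> \<le> \<bar>x - r\<bar> * (B\<^sup>2 * (b - a))" using that by (intro mult_left_mono) auto
    also have "\<dots> < \<bar>x - r\<bar> * (1 / B\<^sup>2)" using B4 that by (intro mult_strict_left_mono) auto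
    also have "\<dots> \<le> \<bar>x - r\<bar> * ?g" using inner_tangent_le[OF t] by (intro mult_left_mono) auto
    finally show ?thesis .
  qed
  have al: "?\<alpha> < 0" using chord_dot_tangent[OF t, of a r] *[of a] r by (simp add: abs_le_iff left_diff_distrib)
  have be: "0 < ?\<beta>" using chord_dot_tangent[OF t, of b r] *[of b] r by (simp add: abs_le_iff left_diff_distrib)
  \<comment> \<open>The zero of the affine function that takes the values \<alpha> and \<beta> at
    the chord ends.\<close>
  define s where "s = ?\<alpha> / (?\<alpha> - ?\<beta>)"
  have s: "0 < s" "s < 1" using al be by (auto simp: s_def field_simps)
  let ?y = "(1 - s) *\<^sub>R G 0 a t + s *\<^sub>R G 0 b t"
  have y: "?y - G 0 r t = (1 - s) *\<^sub>R (G 0 a t - G 0 r t) + s *\<^sub>R (G 0 b t - G 0 r t)"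
    by (simp add: algebra_simps)
  have "(?y - G 0 r t) \<bullet> G 1 r t = (1 - s) * ?\<alpha> + s * ?\<beta>" unfolding y by (simp only: inner_add_left inner_scaleR_left)
  also have "\<dots> = ?\<alpha> - s * (?\<alpha> - ?\<beta>)" by (simp add: algebra_simps)
  also have "\<dots> = 0" using al be by (simp add: s_def)
  finally have orth: "(?y - G 0 r t) \<bullet> G 1 r t = 0" .
  have "norm (?y - G 0 r t) \<le> (1 - s) * (B * (b - a)) + s * (B * (b - a))"
    unfolding y
  proof (rule norm_triangle_mono)
    have "norm (G 0 a t - G 0 r t) \<le> B * (b - a)"
      using lip[of 0 t a r] t r B by (auto intro: order_trans mult_left_mono)
    then show "norm ((1 - s) *\<^sub>R (G 0 a t - G 0 r t)) \<le> (1 - s) * (B * (b - a))" using s by simp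
    have "norm (G 0 b t - G 0 r t) \<le> B * (b - a)"
      using lip[of 0 t b r] t r B by (auto intro: order_trans mult_left_mono)
    then show "norm (s *\<^sub>R (G 0 b t - G 0 r t)) \<le> s * (B * (b - a))" using s by simp
  qed
  then have "norm (?y - G 0 r t) \<le> B * (b - a)" by (simp add: algebra_simps)
  then have "3 * B^5 * norm (?y - G 0 r t) \<le> 3 * B^5 * (B * (b - a))" using B by (intro mult_left_mono) auto
  then have "3 * B^5 * norm (?y - G 0 r t) < 1" using small by (simp add: power_eq_if mult_ac)
  from closest_point_eq[OF t orth this] show ?thesis using s by blast
qed

end

section \<open>Projected nodes and their parameters\<close>

text \<open>Arcs are described by a start parameter and a signed increment \<open>a j\<close>. No
  ordering of the nodes along the curve is presupposed, and the parameter of the next node equals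
  \<open>\<theta> j + a j\<close> only modulo one.\<close>

locale inscribed_polygon = evolving_curve +
  fixes t :: real and J :: nat and p :: nodal and \<theta> a :: "nat \<Rightarrow> real"
  assumes t: "t \<in> {0..T}" and p: "\<And>j. j < J \<Longrightarrow> p j = G 0 (\<theta> j) t"
    and p_nxt: "\<And>j. j < J \<Longrightarrow> p (nxt J j) = G 0 (\<theta> j + a j) t"
    and simple: "simple_polygon J p" and inj: "inj_on (closest_point (curve t)) (polygon J p)"
    and a_small: "\<And>j. j < J \<Longrightarrow> 3 * B^6 * \<bar>a j\<bar> < 1"
begin

definition arc_of :: "nat \<Rightarrow> real set" where
  "arc_of j = {min (\<theta> j) (\<theta> j + a j)<..<max (\<theta> j) (\<theta> j + a j)}"

lemma arc_of_covered:
  assumes j: "j < J" and r: "r \<in> arc_of j"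
  shows "\<exists>s. 0 < s \<and> s < 1 \<and> closest_point (curve t) (fe J p j s) = G 0 r t"
proof (cases "0 \<le> a j")
  case True
  then have "\<exists>s. 0 < s \<and> s < 1 \<and> closest_point (curve t) ((1 - s) *\<^sub>R G 0 (\<theta> j) t + s *\<^sub>R G 0 (\<theta> j + a j) t) = G 0 r t"
    using r a_small[OF j] by (intro arc_covered[OF t]) (auto simp: arc_of_def)
  then show ?thesis by (simp add: fe_def p[OF j] p_nxt[OF j])
next
  case False
  then have "\<exists>s. 0 < s \<and> s < 1 \<and> closest_point (curve t) ((1 - s) *\<^sub>R G 0 (\<theta> j + a j) t + s *\<^sub>R G 0 (\<theta> j) t) = G 0 r t"
    using r a_small[OF j] by (intro arc_covered[OF t]) (auto simp: arc_of_def)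
  then obtain s where "0 < s" "s < 1" "closest_point (curve t) ((1 - s) *\<^sub>R G 0 (\<theta> j + a j) t + s *\<^sub>R G 0 (\<theta> j) t) = G 0 r t"
    by blast
  then show ?thesis by (intro exI[of _ "1 - s"]) (simp add: fe_def p[OF j] p_nxt[OF j] add.commute)
qed

text \<open>A common point of two arcs would be the retraction of an interior point of each of the
  two edges; injectivity identifies these points, and simplicity of the polygon identifies the
  edges.\<close>

lemma arcs_disjoint:
  assumes ij: "i < J" "j < J" "i \<noteq> j" and r: "r \<in> arc_of i" "r + of_int z \<in> arc_of j"
  shows False
proof -
  obtain s where s: "0 < s" "s < 1" "closest_point (curve t) (fe J p i s) = G 0 r t"
    using arc_of_covered[OF ij(1) r(1)] by blast
  obtain s' where s': "0 < s'" "s' < 1" "closest_point (curve t) (fe J p j s') = G 0 (r + of_int z) t"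
    using arc_of_covered[OF ij(2) r(2)] by blast
  have "closest_point (curve t) (fe J p i s) = closest_point (curve t) (fe J p j s')"
    using s s' periodic_int[OF t] by simp
  moreover have "fe J p i s \<in> polygon J p" "fe J p j s' \<in> polygon J p"
    unfolding in_polygon_iff using s s' ij by force+
  ultimately have "fe J p i s = fe J p j s'" using inj by (meson inj_onD)
  then show False using simple_polygon_inj[OF simple ij(1,2), of s s'] s s' ij(3) by simp
qed

text \<open>If the direction were reversed at a node, both adjacent arcs would lie on the same side
  of it and overlap.\<close>

lemma same_orientation:
  assumes j: "j < J" and nz: "a j \<noteq> 0" "a (prv J j) \<noteq> 0"
  shows "0 < a j * a (prv J j)"
proof (rule ccontr)
  assume neg: "\<not> ?thesis"
  let ?i = "prv J j"
  have i: "?i < J" "?i \<noteq> j" using j simple by (auto simp: simple_polygon_def prv_cases)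
  have "G 0 (\<theta> ?i + a ?i) t = G 0 (\<theta> j) t" using p_nxt[OF i(1)] p[OF j] j by simp
  then obtain z where z: "\<theta> ?i + a ?i = \<theta> j + of_int z" using param_unique[OF t] by metis
  consider "0 < a j" "a ?i < 0" | "a j < 0" "0 < a ?i"
    using neg nz by (metis linorder_neqE_linordered_idom mult_neg_neg mult_pos_pos)
  then show False
  proof cases
    case 1
    \<comment> \<open>Half the shorter of the two arcs beyond the common node lies inside both;
      \<open>z\<close> accounts for the parameter of the preceding arc.\<close>
    let ?r = "\<theta> j + min (a j) (- a ?i) / 2"
    have "?r \<in> arc_of j" "?r + of_int z \<in> arc_of ?i" using 1 z by (auto simp: arc_of_def min_def max_def)
    then show False using arcs_disjoint[OF j i(1) i(2)[symmetric]] by blast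
  next
    case 2
    let ?r = "\<theta> j + max (a j) (- a ?i) / 2"
    have "?r \<in> arc_of j" "?r + of_int z \<in> arc_of ?i" using 2 z by (auto simp: arc_of_def min_def max_def)
    then show False using arcs_disjoint[OF j i(1) i(2)[symmetric]] by blast
  qed
qed

text \<open>The arcs are disjoint modulo one, so their midpoints are separated and lie in different cells
  of a grid.\<close>

lemma number_of_nodes:
  assumes w: "0 < w" "\<And>j. j < J \<Longrightarrow> w \<le> \<bar>a j\<bar>"
  shows "real J * w \<le> 1 + w"
proof -
  define \<mu> where "\<mu> j = \<theta> j + a j / 2" for j
  define cell where "cell j = nat \<lfloor>frac (\<mu> j) / w\<rfloor>" for j
  have in_arc: "x \<in> arc_of j" if "j < J" "\<bar>x - \<mu> j\<bar> < w / 2" for x j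
    using w(2)[OF that(1)] that(2) by (auto simp: arc_of_def \<mu>_def min_def max_def abs_if field_simps split: if_splits)
  have "inj_on cell {..<J}"
  proof (rule inj_onI, rule ccontr)
    fix i j assume ij: "i \<in> {..<J}" "j \<in> {..<J}" "cell i = cell j" "i \<noteq> j"
    have nn: "0 \<le> frac (\<mu> k) / w" for k using w frac_ge_0[of "\<mu> k"] by simp
    have "\<lfloor>frac (\<mu> i) / w\<rfloor> = \<lfloor>frac (\<mu> j) / w\<rfloor>"
      using ij(3) nn[of i] nn[of j] unfolding cell_def by (metis eq_nat_nat_iff zero_le_floor)
    then have "\<bar>frac (\<mu> i) / w - frac (\<mu> j) / w\<bar> < 1" by linarith
    then have "\<bar>frac (\<mu> i) - frac (\<mu> j)\<bar> < w"
      using w by (simp add: diff_divide_distrib[symmetric] abs_divide)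
    \<comment> \<open>Halfway between two arc midpoints in the same cell, hence less than half of
      the minimal arc width from each.\<close>
    moreover define r where "r = (frac (\<mu> i) + frac (\<mu> j)) / 2"
    ultimately have "\<bar>(r + of_int \<lfloor>\<mu> i\<rfloor>) - \<mu> i\<bar> < w / 2" "\<bar>(r + of_int \<lfloor>\<mu> j\<rfloor>) - \<mu> j\<bar> < w / 2"
      by (auto simp: frac_def abs_if field_simps split: if_splits)
    then have "r + of_int \<lfloor>\<mu> i\<rfloor> \<in> arc_of i" "r + of_int \<lfloor>\<mu> j\<rfloor> \<in> arc_of j"
      using in_arc ij by auto
    moreover have "r + of_int \<lfloor>\<mu> j\<rfloor> = (r + of_int \<lfloor>\<mu> i\<rfloor>) + of_int (\<lfloor>\<mu> j\<rfloor> - \<lfloor>\<mu> i\<rfloor>)" by simp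
    ultimately show False using arcs_disjoint[of i j] ij by (metis lessThan_iff)
  qed
  moreover have "cell ` {..<J} \<subseteq> {..nat \<lfloor>1 / w\<rfloor>}"
  proof
    fix k assume "k \<in> cell ` {..<J}"
    then obtain j where "k = cell j" by auto
    moreover have "frac (\<mu> j) / w \<le> 1 / w" using w frac_lt_1[of "\<mu> j"] by (intro divide_right_mono) auto
    ultimately show "k \<in> {..nat \<lfloor>1 / w\<rfloor>}" unfolding cell_def by (simp add: floor_mono nat_mono)
  qed
  ultimately have "card {..<J} \<le> card {..nat \<lfloor>1 / w\<rfloor>}" by (metis card_inj_on_le finite_atMost)
  then have "real J \<le> real (nat \<lfloor>1 / w\<rfloor>) + 1" by simp
  also have "\<dots> \<le> 1 / w + 1" using w by simp
  finally have "real J * w \<le> (1 / w + 1) * w" using w by (intro mult_right_mono) auto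
  then show ?thesis using w by (simp add: algebra_simps)
qed

end

section \<open>The implicit equation for the parameter shift of a projected node\<close>

context evolving_curve
begin

text \<open>\<open>e\<close> is the offset of the old vertex from its projection and the bracket in
  \<open>new\<close> the offset of the new one; each is orthogonal to the tangent at its foot.
  Expanding the second condition leaves \<eta> times the squared speed against terms in
  \<open>d\<close> and in the time step; terms that again contain \<eta> are absorbed by
  \<open>small\<close>.\<close>

lemma tangential_shift_le:
  assumes t: "t \<in> {0..T}" "t' \<in> {0..T}"
    and e: "e \<bullet> G 1 \<theta> t = 0" and new: "(e + d - (G 0 (\<theta> + \<eta>) t' - G 0 \<theta> t)) \<bullet> G 1 (\<theta> + \<eta>) t' = 0"
    and small: "4 * B^3 * norm e \<le> 1" "4 * B^4 * \<bar>\<eta>\<bar> \<le> 1"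
  shows "\<bar>\<eta>\<bar> \<le> 4 * B^4 * (norm d + \<bar>t' - t\<bar>)"
proof -
  let ?g = "G 1 (\<theta> + \<eta>) t'" and ?\<tau> = "\<bar>t' - t\<bar>"
  have "\<bar>(G 0 \<theta> t' - G 0 (\<theta> + \<eta>) t') \<bullet> ?g - (\<theta> - (\<theta> + \<eta>)) * (?g \<bullet> ?g)\<bar> \<le> B\<^sup>2 * (\<theta> - (\<theta> + \<eta>))\<^sup>2"
    by (rule chord_dot_tangent[OF t(2)])
  then have 1: "\<bar>\<eta> * (?g \<bullet> ?g) - (G 0 (\<theta> + \<eta>) t' - G 0 \<theta> t') \<bullet> ?g\<bar> \<le> B\<^sup>2 * \<eta>\<^sup>2"
    by (simp add: inner_diff_left abs_minus_commute)
  have "(G 0 (\<theta> + \<eta>) t' - G 0 \<theta> t') \<bullet> ?g = d \<bullet> ?g + e \<bullet> (?g - G 1 \<theta> t) - (G 0 \<theta> t' - G 0 \<theta> t) \<bullet> ?g"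
    using e new by (simp add: inner_simps)
  moreover have "\<bar>d \<bullet> ?g\<bar> \<le> norm d * B"
    using bound[of 1 t'] t by (intro order_trans[OF Cauchy_Schwarz_ineq2] mult_left_mono) auto
  moreover have "\<bar>e \<bullet> (?g - G 1 \<theta> t)\<bar> \<le> norm e * (B * (\<bar>\<eta>\<bar> + ?\<tau>))"
    using increment[of 1 t t' \<theta> \<eta>] t by (intro order_trans[OF Cauchy_Schwarz_ineq2] mult_left_mono) auto
  moreover have "\<bar>(G 0 \<theta> t' - G 0 \<theta> t) \<bullet> ?g\<bar> \<le> (B * ?\<tau>) * B"
    using bound[of 1 t'] time[of 0 t t'] t B by (intro order_trans[OF Cauchy_Schwarz_ineq2] mult_mono) auto
  ultimately have "\<bar>\<eta> * (?g \<bullet> ?g)\<bar> \<le> B\<^sup>2 * \<eta>\<^sup>2 + norm d * B + norm e * (B * (\<bar>\<eta>\<bar> + ?\<tau>)) + (B * ?\<tau>) * B"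
    using 1 by linarith
  then have main: "\<bar>\<eta>\<bar> * (?g \<bullet> ?g) \<le> B\<^sup>2 * \<eta>\<^sup>2 + norm d * B + norm e * (B * (\<bar>\<eta>\<bar> + ?\<tau>)) + (B * ?\<tau>) * B"
    by (simp add: abs_mult)
  define X where "X = \<bar>\<eta>\<bar> / B\<^sup>2"
  define Y where "Y = ?\<tau> / B\<^sup>2"
  have "X \<le> \<bar>\<eta>\<bar> * (?g \<bullet> ?g)" unfolding X_def
    using mult_left_mono[OF inner_tangent_le[OF t(2), of "\<theta> + \<eta>"], of "\<bar>\<eta>\<bar>"] by simp
  also note main
  also have "B\<^sup>2 * \<eta>\<^sup>2 \<le> X / 4"
  proof -
    have "B\<^sup>2 * \<eta>\<^sup>2 = (4 * B^4 * \<bar>\<eta>\<bar>) * (X / 4)"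
      using B power2_abs[of \<eta>] by (simp add: X_def power_eq_if)
    also have "\<dots> \<le> 1 * (X / 4)" using small by (intro mult_right_mono) (auto simp: X_def)
    finally show ?thesis by simp
  qed
  also have "norm e * (B * (\<bar>\<eta>\<bar> + ?\<tau>)) \<le> (X + Y) / 4"
  proof -
    have "norm e * (B * (\<bar>\<eta>\<bar> + ?\<tau>)) = (4 * B^3 * norm e) * ((X + Y) / 4)"
      using B by (simp add: X_def Y_def add_divide_distrib[symmetric] power_eq_if)
    also have "\<dots> \<le> 1 * ((X + Y) / 4)" using small by (intro mult_right_mono) (auto simp: X_def Y_def)
    finally show ?thesis by simp
  qed
  finally have "X / 2 \<le> norm d * B + Y / 4 + (B * ?\<tau>) * B" by (simp add: field_simps)
  then have "(\<bar>\<eta>\<bar> / B\<^sup>2) / 2 \<le> norm d * B + ?\<tau> / B\<^sup>2 / 4 + (B * ?\<tau>) * B"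
    by (simp only: X_def Y_def)
  then have "2 * B\<^sup>2 * ((\<bar>\<eta>\<bar> / B\<^sup>2) / 2) \<le> 2 * B\<^sup>2 * (norm d * B + ?\<tau> / B\<^sup>2 / 4 + (B * ?\<tau>) * B)"
    by (rule mult_left_mono) simp
  then have "\<bar>\<eta>\<bar> \<le> 2 * B^3 * norm d + ?\<tau> / 2 + 2 * B^4 * ?\<tau>"
    using B by (simp add: power_eq_if algebra_simps)
  also have "\<dots> \<le> 4 * B^4 * norm d + (2 * B^4 * ?\<tau> + 2 * B^4 * ?\<tau>)"
  proof -
    have "2 * B^3 * norm d \<le> 4 * B^4 * norm d"
    proof (rule mult_right_mono)
      have "B^3 \<le> B^4" "0 \<le> B^4" using B by (auto intro: power_increasing)
      then show "2 * B^3 \<le> 4 * B^4" by linarith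
    qed simp
    moreover have "1 / 2 * ?\<tau> \<le> 2 * B^4 * ?\<tau>" using one_le_power[OF B, of 4] by (intro mult_right_mono) linarith+
    ultimately show ?thesis by linarith
  qed
  finally show ?thesis by (simp add: algebra_simps)
qed

text \<open>Difference of two such equations at neighbouring nodes. The leading term is kept as the
  difference of the scalars \<open>d \<bullet> G 1 \<theta> t\<close>: a bound by
  \<open>norm (d' - d)\<close> would be too weak, and that norm occurs only with the small factor
  formed by the shift and the time step.\<close>

lemma tangential_shift_diff:
  assumes t: "t \<in> {0..T}" "t' \<in> {0..T}"
    and e: "e \<bullet> G 1 \<theta> t = 0" and new: "(e + d - (G 0 (\<theta> + \<eta>) t' - G 0 \<theta> t)) \<bullet> G 1 (\<theta> + \<eta>) t' = 0"
    and e': "e' \<bullet> G 1 \<theta>' t = 0" and new': "(e' + d' - (G 0 (\<theta>' + \<eta>') t' - G 0 \<theta>' t)) \<bullet> G 1 (\<theta>' + \<eta>') t' = 0"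
    and small: "16 * B^4 * \<bar>\<eta>\<bar> \<le> 1" "16 * B^4 * \<bar>\<eta>'\<bar> \<le> 1" "16 * B^4 * \<bar>t' - t\<bar> \<le> 1"
      "16 * B^3 * norm e' \<le> 1" "16 * B^3 * norm d' \<le> 1"
  shows "\<bar>\<eta>' - \<eta>\<bar> \<le> 2 * B\<^sup>2 * (\<bar>d' \<bullet> G 1 \<theta>' t - d \<bullet> G 1 \<theta> t\<bar>
     + B\<^sup>2 * (\<bar>\<eta>\<bar> + \<bar>t' - t\<bar>) * (3 * \<bar>\<theta>' - \<theta>\<bar> + norm (d' - d) + norm (e' - e)))"
proof -
  let ?\<tau> = "\<bar>t' - t\<bar>" and ?g' = "G 1 (\<theta>' + \<eta>') t'" and ?g = "G 1 (\<theta> + \<eta>) t'"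
  let ?x = "\<bar>\<eta>' - \<eta>\<bar>" and ?c = "\<bar>\<eta>\<bar> + \<bar>t' - t\<bar>" and ?y = "\<bar>\<theta>' - \<theta>\<bar>"
  let ?D = "?g - G 1 \<theta> t" and ?D' = "?g' - G 1 \<theta>' t"
  define P where "P = (G 0 (\<theta>' + \<eta>') t' - G 0 (\<theta>' + \<eta>) t') \<bullet> ?g'"
  define Q where "Q = (G 0 (\<theta>' + \<eta>) t' - G 0 \<theta>' t) \<bullet> (?g' - ?g)"
  define R where "R = ((G 0 (\<theta>' + \<eta>) t' - G 0 \<theta>' t) - (G 0 (\<theta> + \<eta>) t' - G 0 \<theta> t)) \<bullet> ?g"
  define U where "U = d' \<bullet> G 1 \<theta>' t - d \<bullet> G 1 \<theta> t"
  define V where "V = (d' + e') \<bullet> (?D' - ?D)"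
  define W where "W = ((d' - d) + (e' - e)) \<bullet> ?D"
  \<comment> \<open>The subtracted orthogonality conditions, sorted: \<open>P\<close> carries the
    unknown shift difference, \<open>Q\<close> and \<open>R\<close> the motion of the feet,
    \<open>U\<close> the leading term, \<open>V\<close> and \<open>W\<close> the change of the
    tangents.\<close>
  have eq: "P + Q + R = U + V + W"
    using e e' new new' unfolding P_def Q_def R_def U_def V_def W_def
    by (simp add: inner_simps)
  have "\<bar>(G 0 (\<theta>' + \<eta>) t' - G 0 (\<theta>' + \<eta>') t') \<bullet> ?g' - ((\<theta>' + \<eta>) - (\<theta>' + \<eta>')) * (?g' \<bullet> ?g')\<bar> \<le> B\<^sup>2 * ((\<theta>' + \<eta>) - (\<theta>' + \<eta>'))\<^sup>2"
    by (rule chord_dot_tangent[OF t(2)])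
  moreover have "(G 0 (\<theta>' + \<eta>) t' - G 0 (\<theta>' + \<eta>') t') \<bullet> ?g' - ((\<theta>' + \<eta>) - (\<theta>' + \<eta>')) * (?g' \<bullet> ?g') = (\<eta>' - \<eta>) * (?g' \<bullet> ?g') - P"
    by (simp add: P_def inner_diff_left algebra_simps)
  moreover have "((\<theta>' + \<eta>) - (\<theta>' + \<eta>'))\<^sup>2 = ?x * ?x" by (simp add: power2_eq_square algebra_simps)
  ultimately have P: "\<bar>(\<eta>' - \<eta>) * (?g' \<bullet> ?g') - P\<bar> \<le> B\<^sup>2 * (?x * ?x)" by simp
  have "?x / B\<^sup>2 \<le> ?x * (?g' \<bullet> ?g')"
    using mult_left_mono[OF inner_tangent_le[OF t(2), of "\<theta>' + \<eta>'"], of ?x] by simp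
  then have P': "?x / B\<^sup>2 \<le> \<bar>P\<bar> + B\<^sup>2 * (?x * ?x)"
    using P abs_mult[of "\<eta>' - \<eta>" "?g' \<bullet> ?g'"] by simp
  have Q: "\<bar>Q\<bar> \<le> (B * ?c) * (B * (?y + ?x))"
  proof -
    have "B * \<bar>\<theta>' + \<eta>' - (\<theta> + \<eta>)\<bar> \<le> B * (?y + ?x)" using B by (intro mult_left_mono) auto
    then have "norm (?g' - ?g) \<le> B * (?y + ?x)"
      using lip[of 1 t' "\<theta>' + \<eta>'" "\<theta> + \<eta>"] t by (auto intro: order_trans)
    then show ?thesis unfolding Q_def using increment[of 0 t t' \<theta>' \<eta>] t B
      by (intro order_trans[OF Cauchy_Schwarz_ineq2] mult_mono) auto
  qed
  have R: "\<bar>R\<bar> \<le> (B * (?y * ?c + \<bar>\<eta> - \<eta>\<bar>)) * B"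
    unfolding R_def using increment_diff[of 0 t t' \<theta>' \<eta> \<theta> \<eta>] bound[of 1 t' "\<theta> + \<eta>"] t B
    by (intro order_trans[OF Cauchy_Schwarz_ineq2] mult_mono) auto
  have V: "\<bar>V\<bar> \<le> (norm d' + norm e') * (B * (?y * ?c + ?x))"
    unfolding V_def using increment_diff[of 1 t t' \<theta>' \<eta>' \<theta> \<eta>] t B
    by (intro order_trans[OF Cauchy_Schwarz_ineq2] mult_mono norm_triangle_ineq) auto
  have W: "\<bar>W\<bar> \<le> (norm (d' - d) + norm (e' - e)) * (B * ?c)"
    unfolding W_def using increment[of 1 t t' \<theta> \<eta>] t B
    by (intro order_trans[OF Cauchy_Schwarz_ineq2] mult_mono norm_triangle_ineq) auto
  \<comment> \<open>A lower bound for the squared speed. Measured against it, all terms on the right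
    that contain the shift difference cost at most half of the left side.\<close>
  define X where "X = 1 / B\<^sup>2"
  have sm: "B\<^sup>2 * \<bar>\<eta>\<bar> \<le> X / 16" "B\<^sup>2 * \<bar>\<eta>'\<bar> \<le> X / 16" "B\<^sup>2 * ?\<tau> \<le> X / 16"
    "B * norm e' \<le> X / 16" "B * norm d' \<le> X / 16" and X: "0 \<le> X"
    using small B by (auto simp: X_def field_simps power_eq_if)
  have c1: "(B * norm d' + B * norm e') \<le> B\<^sup>2"
  proof -
    have "X \<le> 1" "1 \<le> B\<^sup>2" using B by (auto simp: X_def)
    then show ?thesis using sm(4,5) by linarith
  qed
  have "\<bar>P\<bar> \<le> \<bar>U\<bar> + \<bar>V\<bar> + \<bar>W\<bar> + \<bar>Q\<bar> + \<bar>R\<bar>" using eq by linarith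
  then have "?x / B\<^sup>2 \<le> \<bar>U\<bar> + \<bar>V\<bar> + \<bar>W\<bar> + \<bar>Q\<bar> + \<bar>R\<bar> + B\<^sup>2 * (?x * ?x)"
    by (rule order_trans[OF P' add_right_mono])
  also have "\<dots> \<le> \<bar>U\<bar> + (norm d' + norm e') * (B * (?y * ?c + ?x)) + (norm (d' - d) + norm (e' - e)) * (B * ?c)
      + (B * ?c) * (B * (?y + ?x)) + (B * (?y * ?c + \<bar>\<eta> - \<eta>\<bar>)) * B + B\<^sup>2 * (?x * ?x)"
    by (intro add_mono order_refl Q R V W)
  also have "\<dots> = \<bar>U\<bar> + ?x * ((B * norm d' + B * norm e') + B\<^sup>2 * ?c + B\<^sup>2 * ?x)
      + ?c * (((B * norm d' + B * norm e') + 2 * B\<^sup>2) * ?y + B * (norm (d' - d) + norm (e' - e)))"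
    by (simp add: power2_eq_square algebra_simps)
  also have "\<dots> \<le> \<bar>U\<bar> + ?x * (X / 2) + ?c * ((B\<^sup>2 + 2 * B\<^sup>2) * ?y + B\<^sup>2 * (norm (d' - d) + norm (e' - e)))"
  proof (intro add_mono mult_left_mono order_refl)
    have "B\<^sup>2 * ?x \<le> B\<^sup>2 * \<bar>\<eta>'\<bar> + B\<^sup>2 * \<bar>\<eta>\<bar>"
      unfolding distrib_left[symmetric] by (intro mult_left_mono) auto
    moreover have "B\<^sup>2 * ?c = B\<^sup>2 * \<bar>\<eta>\<bar> + B\<^sup>2 * ?\<tau>" by (simp add: distrib_left)
    ultimately show "(B * norm d' + B * norm e') + B\<^sup>2 * ?c + B\<^sup>2 * ?x \<le> X / 2"
      using sm X by argo
    show "((B * norm d' + B * norm e') + 2 * B\<^sup>2) * ?y \<le> (B\<^sup>2 + 2 * B\<^sup>2) * ?y"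
      using c1 by (intro mult_right_mono) auto
    show "B * (norm (d' - d) + norm (e' - e)) \<le> B\<^sup>2 * (norm (d' - d) + norm (e' - e))"
      using B by (intro mult_right_mono) (auto simp: power2_eq_square)
  qed auto
  finally have "(?x / B\<^sup>2) / 2 \<le> \<bar>U\<bar> + ?c * ((B\<^sup>2 + 2 * B\<^sup>2) * ?y + B\<^sup>2 * (norm (d' - d) + norm (e' - e)))"
    by (simp add: X_def)
  then have "2 * B\<^sup>2 * ((?x / B\<^sup>2) / 2) \<le> 2 * B\<^sup>2 * (\<bar>U\<bar> + ?c * ((B\<^sup>2 + 2 * B\<^sup>2) * ?y + B\<^sup>2 * (norm (d' - d) + norm (e' - e))))"
    by (rule mult_left_mono) simp
  moreover have "2 * B\<^sup>2 * ((?x / B\<^sup>2) / 2) = ?x" using B by simp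
  moreover have "?c * ((B\<^sup>2 + 2 * B\<^sup>2) * ?y + B\<^sup>2 * (norm (d' - d) + norm (e' - e)))
     = B\<^sup>2 * ?c * (3 * ?y + norm (d' - d) + norm (e' - e))" by (simp add: algebra_simps)
  ultimately show ?thesis unfolding U_def by (simp only:)
qed

end

section \<open>The displacement tested against the exact tangent\<close>

context polygon_step
begin

lemma d_le: assumes j: "j < J" shows "norm (d j) \<le> 2000 * M^8 * \<tau>"
proof -
  have "norm (u j *\<^sub>R N j) \<le> (6 * M\<^sup>2 * \<tau>) * 1"
    unfolding norm_scaleR real_norm_def norm_perp
    by (rule mult_mono[OF u_le[OF j] norm_T_le[OF j]]) (use tau in auto)
  moreover have "norm (s j *\<^sub>R T j) \<le> (1776 * M^8 * \<tau>) * 1"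
    unfolding norm_scaleR real_norm_def
    by (rule mult_mono[OF s_le[OF j] norm_T_le[OF j]]) (use tau M in auto)
  ultimately have "norm (u j *\<^sub>R N j + s j *\<^sub>R T j) \<le> (6 * M\<^sup>2 * \<tau>) * 1 + (1776 * M^8 * \<tau>) * 1"
    by (rule norm_triangle_mono)
  moreover have "6 * M\<^sup>2 * \<tau> \<le> 6 * M^8 * \<tau>" using M tau by (intro mult_right_mono mult_left_mono power_increasing) auto
  moreover have "0 \<le> M^8 * \<tau>" using M tau by simp
  ultimately show ?thesis using decomp[OF j] by simp
qed

text \<open>Here \<open>g\<close> plays the role of the exact tangent derivative. Its product with
  \<open>N j\<close> is O(h), so differences of the rough coordinate \<open>u\<close> enter with an
  extra factor \<open>h\<close>; only the differences of \<open>s\<close>, which are better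
  controlled, appear at leading order.\<close>

lemma tangential_product_diff:
  assumes g: "\<And>j. j < J \<Longrightarrow> norm (g j) \<le> M" "\<And>j. j < J \<Longrightarrow> norm (g (nx j) - g j) \<le> M * h"
      "\<And>j. j < J \<Longrightarrow> \<bar>N j \<bullet> g j\<bar> \<le> 2 * M^3 * h"
    and j: "j < J"
  shows "\<bar>d (nx j) \<bullet> g (nx j) - d j \<bullet> g j\<bar> \<le> M * \<bar>s (nx j) - s j\<bar> + 6000 * M^11 * \<tau> * h"
proof -
  let ?i = "nx j"
  have i: "?i < J" using j by simp
  have Mh: "M * h \<le> M\<^sup>2 * h * M" "0 \<le> M\<^sup>2 * h * M"
  proof -
    have "M^1 * h \<le> M^3 * h" using M h by (intro mult_right_mono power_increasing) auto
    then show "M * h \<le> M\<^sup>2 * h * M" by (simp add: power2_eq_square power3_eq_cube mult_ac)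
  qed (use M h in simp)
  have Nd: "\<bar>N ?i \<bullet> g ?i - N j \<bullet> g j\<bar> \<le> 3 * M^3 * h"
  proof -
    have "\<bar>N ?i \<bullet> g ?i - N j \<bullet> g j\<bar> \<le> (2 * M\<^sup>2 * h) * M + 1 * (M * h)"
      using T_diff_le[OF j] g(1)[OF i] norm_T_le[OF j] g(2)[OF j] M h
      by (intro order_trans[OF inner_diff_le] add_mono mult_mono) (auto simp: perp_diff[symmetric])
    then show ?thesis using Mh by (simp add: power2_eq_square power3_eq_cube algebra_simps)
  qed
  have Td: "\<bar>T ?i \<bullet> g ?i - T j \<bullet> g j\<bar> \<le> 3 * M^3 * h"
  proof -
    have "\<bar>T ?i \<bullet> g ?i - T j \<bullet> g j\<bar> \<le> (2 * M\<^sup>2 * h) * M + 1 * (M * h)"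
      using T_diff_le[OF j] g(1)[OF i] norm_T_le[OF j] g(2)[OF j] M h
      by (intro order_trans[OF inner_diff_le] add_mono mult_mono) auto
    then show ?thesis using Mh by (simp add: power2_eq_square power3_eq_cube algebra_simps)
  qed
  have Tg: "\<bar>T ?i \<bullet> g ?i\<bar> \<le> 1 * M"
    using norm_T_le[OF i] g(1)[OF i] by (intro order_trans[OF Cauchy_Schwarz_ineq2] mult_mono) auto
  have "d ?i \<bullet> g ?i - d j \<bullet> g j = (u ?i - u j) * (N ?i \<bullet> g ?i) + u j * (N ?i \<bullet> g ?i - N j \<bullet> g j)
     + ((s ?i - s j) * (T ?i \<bullet> g ?i) + s j * (T ?i \<bullet> g ?i - T j \<bullet> g j))"
    unfolding decomp[OF j] decomp[OF i] by (simp add: inner_add_left algebra_simps)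
  moreover have "\<bar>(u ?i - u j) * (N ?i \<bullet> g ?i)\<bar> \<le> (12 * M\<^sup>2 * \<tau>) * (2 * M^3 * h)"
  proof -
    have "\<bar>u ?i - u j\<bar> \<le> 12 * M\<^sup>2 * \<tau>" using u_le[OF i] u_le[OF j] by linarith
    then show ?thesis unfolding abs_mult using g(3)[OF i] M tau by (intro mult_mono) auto
  qed
  moreover have "\<bar>u j * (N ?i \<bullet> g ?i - N j \<bullet> g j)\<bar> \<le> (6 * M\<^sup>2 * \<tau>) * (3 * M^3 * h)"
    unfolding abs_mult using u_le[OF j] Nd M tau by (intro mult_mono) auto
  moreover have "\<bar>s j * (T ?i \<bullet> g ?i - T j \<bullet> g j)\<bar> \<le> (1776 * M^8 * \<tau>) * (3 * M^3 * h)"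
    unfolding abs_mult using s_le[OF j] Td M tau by (intro mult_mono) auto
  moreover have "\<bar>(s ?i - s j) * (T ?i \<bullet> g ?i)\<bar> \<le> \<bar>s ?i - s j\<bar> * M"
    unfolding abs_mult using Tg by (intro mult_left_mono) auto
  ultimately have "\<bar>d ?i \<bullet> g ?i - d j \<bullet> g j\<bar> \<le> (12 * M\<^sup>2 * \<tau>) * (2 * M^3 * h) + (6 * M\<^sup>2 * \<tau>) * (3 * M^3 * h)
     + (\<bar>s ?i - s j\<bar> * M + (1776 * M^8 * \<tau>) * (3 * M^3 * h))" by linarith
  also have "\<dots> = M * \<bar>s ?i - s j\<bar> + 42 * (M^5 * (\<tau> * h)) + 5328 * (M^11 * (\<tau> * h))"
    by (simp add: power_eq_if)
  also have "M^5 * (\<tau> * h) \<le> M^11 * (\<tau> * h)"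
    using M tau h by (intro mult_right_mono power_increasing) auto
  finally have "\<bar>d ?i \<bullet> g ?i - d j \<bullet> g j\<bar> \<le> M * \<bar>s ?i - s j\<bar> + 5370 * (M^11 * (\<tau> * h))" by (simp add: mult_ac)
  moreover have "0 \<le> M^11 * (\<tau> * h)" using M tau h by simp
  ultimately show ?thesis by simp
qed

end

section \<open>The scheme in nodal form\<close>

lemma avg_normal_eq:
  assumes "\<nu> (prv J j) = \<sigma> *\<^sub>R perp (edge_tangent J q (prv J j))" "\<nu> j = \<sigma> *\<^sub>R perp (edge_tangent J q j)"
  shows "avg_normal J q \<nu> j = \<sigma> *\<^sub>R perp (node_tangent J q j)"
  unfolding avg_normal_def node_tangent_def assms
  by (simp add: perp_scaleR perp_add scaleR_add_right mult_ac)

text \<open>Subtracting the stiffness form of the identity on both sides replaces the new vertices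
  by the displacement, and leaves on the right minus the stiffness form of the identity with the
  normal part \<open>w\<close> of the test function. Every normal occurs in a product of two, so
  signs may vary from node to node.\<close>

lemma scheme_step_weak:
  assumes q: "simple_polygon J q" and \<tau>: "0 < \<tau>" and scheme: "scheme_step J \<tau> q \<nu> y"
    and nb: "\<And>j. j < J \<Longrightarrow> \<exists>\<sigma>. (\<sigma> = 1 \<or> \<sigma> = (-1::real)) \<and> avg_normal J q \<nu> j = \<sigma> *\<^sub>R perp (node_tangent J q j)"
  shows "(\<Sum>j<J. node_mass J q j * (((y j - q j) \<bullet> perp (node_tangent J q j)) * (\<phi> j \<bullet> perp (node_tangent J q j)))) / \<tau>
      + (\<Sum>j<J. (((y (nxt J j) - q (nxt J j)) - (y j - q j)) \<bullet> (\<phi> (nxt J j) - \<phi> j)) / elen J q j)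
    = (\<Sum>j<J. node_mass J q j * ((perp (node_tangent J q j) \<bullet> node_curvature J q j) * (\<phi> j \<bullet> perp (node_tangent J q j))))"
proof -
  let ?n = "avg_normal J q \<nu>" and ?N = "\<lambda>j. perp (node_tangent J q j)" and ?t = "edge_tangent J q"
  let ?D = "\<lambda>f j. f (nxt J j) - f j"
  have pos: "0 < elen J q j" if "j < J" for j using simple_polygon_elen_pos[OF q that] .
  have mpos: "0 < node_mass J q j" if "j < J" for j
    using pos[OF that] pos[of "prv J j"] that by (simp add: node_mass_def)
  have nn: "(v \<bullet> ?n j) * (w \<bullet> ?n j) = (v \<bullet> ?N j) * (w \<bullet> ?N j)" "(v \<bullet> ?n j) *\<^sub>R ?n j = (v \<bullet> ?N j) *\<^sub>R ?N j"
    if "j < J" for j v w using nb[OF that] by auto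
  define w where "w j = (\<phi> j \<bullet> ?N j) *\<^sub>R ?N j" for j
  have "lumped_int J q (\<lambda>j s. (fe J (\<lambda>i. (y i - q i) /\<^sub>R \<tau>) j s \<bullet> fe J ?n j s) * (fe J \<phi> j s \<bullet> fe J ?n j s))
      = (\<Sum>j<J. node_mass J q j * (((y j - q j) \<bullet> ?N j) * (\<phi> j \<bullet> ?N j)) / \<tau>)"
    unfolding lumped_int_nodal node_mass_def[symmetric]
  proof (rule sum.cong[OF refl])
    fix j assume "j \<in> {..<J}"
    then show "node_mass J q j * ((((y j - q j) /\<^sub>R \<tau>) \<bullet> ?n j) * (\<phi> j \<bullet> ?n j))
        = node_mass J q j * (((y j - q j) \<bullet> ?N j) * (\<phi> j \<bullet> ?N j)) / \<tau>"
      using nn(1)[of j "y j - q j" "\<phi> j"] by (simp add: divide_inverse mult_ac)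
  qed
  moreover have "poly_int J q (\<lambda>j s. tgrad J q y j \<bullet> tgrad J q \<phi> j) = (\<Sum>j<J. (?D y j \<bullet> ?D \<phi> j) / elen J q j)"
    unfolding poly_int_const
    by (rule sum.cong[OF refl]) (use pos in \<open>force simp: inner_tgrad power2_eq_square\<close>)
  moreover have "poly_int J q (\<lambda>j s. tgrad J q q j \<bullet> tgrad J q (\<lambda>i. \<phi> i - (\<phi> i \<bullet> ?n i) *\<^sub>R ?n i) j)
      = (\<Sum>j<J. (?D q j \<bullet> (?D \<phi> j - ?D w j)) / elen J q j)"
    unfolding poly_int_const
  proof (rule sum.cong[OF refl])
    fix j assume "j \<in> {..<J}"
    then have j: "j < J" by simp
    have D: "(\<phi> (nxt J j) - w (nxt J j)) - (\<phi> j - w j) = ?D \<phi> j - ?D w j" by simp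
    have "tgrad J q q j \<bullet> tgrad J q (\<lambda>i. \<phi> i - (\<phi> i \<bullet> ?n i) *\<^sub>R ?n i) j = (?D q j \<bullet> ((\<phi> (nxt J j) - w (nxt J j)) - (\<phi> j - w j))) / (elen J q j)\<^sup>2"
      using j nn(2)[OF j] nn(2)[of "nxt J j"] pos[OF j] by (simp add: inner_tgrad w_def)
    then have "tgrad J q q j \<bullet> tgrad J q (\<lambda>i. \<phi> i - (\<phi> i \<bullet> ?n i) *\<^sub>R ?n i) j = (?D q j \<bullet> (?D \<phi> j - ?D w j)) / (elen J q j)\<^sup>2"
      unfolding D .
    then show "elen J q j * (tgrad J q q j \<bullet> tgrad J q (\<lambda>i. \<phi> i - (\<phi> i \<bullet> ?n i) *\<^sub>R ?n i) j)
        = (?D q j \<bullet> (?D \<phi> j - ?D w j)) / elen J q j"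
      using pos[OF j] by (simp add: power2_eq_square)
  qed
  moreover have "lumped_int J q (\<lambda>j s. (fe J (\<lambda>i. (y i - q i) /\<^sub>R \<tau>) j s \<bullet> fe J ?n j s) * (fe J \<phi> j s \<bullet> fe J ?n j s))
        + poly_int J q (\<lambda>j s. tgrad J q y j \<bullet> tgrad J q \<phi> j)
      = poly_int J q (\<lambda>j s. tgrad J q q j \<bullet> tgrad J q (\<lambda>i. \<phi> i - (\<phi> i \<bullet> ?n i) *\<^sub>R ?n i) j)"
    using scheme unfolding scheme_step_def Let_def by blast
  ultimately have A: "(\<Sum>j<J. node_mass J q j * (((y j - q j) \<bullet> ?N j) * (\<phi> j \<bullet> ?N j)) / \<tau>)
      + (\<Sum>j<J. (?D y j \<bullet> ?D \<phi> j) / elen J q j) = (\<Sum>j<J. (?D q j \<bullet> (?D \<phi> j - ?D w j)) / elen J q j)"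
    by simp
  \<comment> \<open>Summation by parts: the gradient of the identity is the edge tangent, and its
    jumps at the vertices are mass times discrete curvature.\<close>
  have "(\<Sum>j<J. (?D q j \<bullet> ?D w j) / elen J q j) = (\<Sum>j<J. ?t j \<bullet> w (nxt J j)) - (\<Sum>j<J. ?t j \<bullet> w j)"
    unfolding sum_subtractf[symmetric]
    by (rule sum.cong[OF refl]) (simp add: edge_tangent_def inner_diff_right divide_inverse algebra_simps)
  also have "(\<Sum>j<J. ?t j \<bullet> w (nxt J j)) = (\<Sum>j<J. ?t (prv J j) \<bullet> w j)"
    using sum_nxt[of "\<lambda>j. ?t (prv J j) \<bullet> w j" J] by (simp cong: sum.cong_simp)
  also have "\<dots> - (\<Sum>j<J. ?t j \<bullet> w j)
      = - (\<Sum>j<J. node_mass J q j * ((?N j \<bullet> node_curvature J q j) * (\<phi> j \<bullet> ?N j)))"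
    unfolding sum_subtractf[symmetric] sum_negf[symmetric]
  proof (rule sum.cong[OF refl])
    fix j assume "j \<in> {..<J}"
    then have "?t j - ?t (prv J j) = node_mass J q j *\<^sub>R node_curvature J q j"
      using mpos[of j] by (simp add: node_curvature_def)
    then have *: "(?t j - ?t (prv J j)) \<bullet> w j = (node_mass J q j *\<^sub>R node_curvature J q j) \<bullet> w j"
      by (simp only:)
    have "?t (prv J j) \<bullet> w j - ?t j \<bullet> w j = - ((?t j - ?t (prv J j)) \<bullet> w j)" by (simp add: inner_diff_left)
    also have "\<dots> = - (node_mass J q j * ((?N j \<bullet> node_curvature J q j) * (\<phi> j \<bullet> ?N j)))"
      unfolding * by (simp add: w_def inner_commute mult_ac)
    finally show "?t (prv J j) \<bullet> w j - ?t j \<bullet> w j = - (node_mass J q j * ((?N j \<bullet> node_curvature J q j) * (\<phi> j \<bullet> ?N j)))" .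
  qed
  finally have Bw: "(\<Sum>j<J. (?D q j \<bullet> ?D w j) / elen J q j)
      = - (\<Sum>j<J. node_mass J q j * ((?N j \<bullet> node_curvature J q j) * (\<phi> j \<bullet> ?N j)))" .
  have "(\<Sum>j<J. (((y (nxt J j) - q (nxt J j)) - (y j - q j)) \<bullet> ?D \<phi> j) / elen J q j)
      = (\<Sum>j<J. (?D y j \<bullet> ?D \<phi> j) / elen J q j) - (\<Sum>j<J. (?D q j \<bullet> ?D \<phi> j) / elen J q j)"
    unfolding sum_subtractf[symmetric]
    by (rule sum.cong[OF refl]) (simp add: inner_diff_left diff_divide_distrib[symmetric] algebra_simps)
  moreover have "(\<Sum>j<J. (?D q j \<bullet> (?D \<phi> j - ?D w j)) / elen J q j)
      = (\<Sum>j<J. (?D q j \<bullet> ?D \<phi> j) / elen J q j) - (\<Sum>j<J. (?D q j \<bullet> ?D w j) / elen J q j)"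
    unfolding sum_subtractf[symmetric]
    by (rule sum.cong[OF refl]) (simp only: inner_diff_right[of _ "?D \<phi> _"] diff_divide_distrib)
  ultimately show ?thesis using A Bw unfolding sum_divide_distrib by linarith
qed

text \<open>\<open>M0\<close> collects the mesh constants and \<open>B\<close> those of the curve.
  The three error assumptions are what remains of the induction hypothesis; \<open>err_sum\<close>,
  with its third power of \<open>h\<close>, is the one that controls the curvature. The power 16 in
  \<open>h_small\<close> leaves room for all absorptions below.\<close>

locale one_step = evolving_curve +
  fixes t t' h M0 :: real and J :: nat and x x' \<nu> p :: nodal
  assumes times: "t \<in> {0..T}" "t' \<in> {0..T}" "t < t'"
    and M0: "1 \<le> M0" and h: "0 < h" and h_small: "1000000 * ((300 * B^6 * M0^3)^16 * h) \<le> 1"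
    and tau_le: "t' - t \<le> M0 * h\<^sup>2"
    and p: "\<And>j. j < J \<Longrightarrow> p j = closest_point (curve t) (x j)"
    and polygons: "simple_polygon J x" "simple_polygon J p" and normals: "outward_edge_normals J x \<nu>"
    and scheme: "scheme_step J (t' - t) x \<nu> x'" and inj: "inj_on (closest_point (curve t)) (polygon J p)"
    and len: "\<And>j. j < J \<Longrightarrow> h / M0 \<le> elen J p j" "\<And>j. j < J \<Longrightarrow> elen J p j \<le> M0 * h"
    and err: "\<And>j. j < J \<Longrightarrow> norm (x j - p j) \<le> h"
    and err_diff: "\<And>j. j < J \<Longrightarrow> norm ((x (nxt J j) - p (nxt J j)) - (x j - p j)) \<le> h * elen J p j"
    and err_sum: "(\<Sum>j<J. (norm ((x (nxt J j) - p (nxt J j)) - (x j - p j)))\<^sup>2 / elen J p j) \<le> h^3"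
begin

text \<open>Large enough to dominate 300 times every product of powers of \<open>B\<close> up to 6
  and of \<open>M0\<close> up to 3, so that the stability estimates can be run with this one
  constant.\<close>

definition M :: real where "M = 300 * B^6 * M0^3"

lemma powers_le_M: assumes "i \<le> 6" "k \<le> 3" shows "300 * (B^i * M0^k) \<le> M"
proof -
  have "B^i * M0^k \<le> B^6 * M0^3" using assms B M0 by (intro mult_mono power_increasing) auto
  then show ?thesis by (simp add: M_def)
qed

lemma BM_nonneg: "0 \<le> B^i * M0^k"
  using B M0 by simp

lemma M_ge: "300 \<le> M" "300 * B \<le> M" "300 * M0 \<le> M" "300 * (B * M0) \<le> M" "300 * B^6 \<le> M"
    "300 * (B^6 * M0) \<le> M" "300 * M0^3 \<le> M" "300 * B^3 \<le> M" "300 * (B^3 * M0) \<le> M" "300 * B\<^sup>2 \<le> M"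
    "300 * (B\<^sup>2 * M0) \<le> M" "300 * B^4 \<le> M" "300 * (B^6 * M0^3) \<le> M" "300 * B^5 \<le> M"
  using powers_le_M[of 0 0] powers_le_M[of 1 0] powers_le_M[of 0 1] powers_le_M[of 1 1] powers_le_M[of 6 0]
    powers_le_M[of 6 1] powers_le_M[of 0 3] powers_le_M[of 3 0] powers_le_M[of 3 1] powers_le_M[of 2 0]
    powers_le_M[of 2 1] powers_le_M[of 4 0] powers_le_M[of 6 3] powers_le_M[of 5 0] by auto

lemma M_h: assumes "k \<le> 16" shows "M^k * h \<le> 1 / 1000000"
proof -
  have "M^k * h \<le> M^16 * h" using M_ge(1) h assms by (intro mult_right_mono power_increasing) auto
  then show ?thesis using h_small by (simp add: M_def)
qed

lemma h_le: "h \<le> 1 / 1000000" using M_h[of 0] by simp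

definition e :: nodal where "e j = x j - p j"
definition L :: "nat \<Rightarrow> real" where "L = elen J p"
definition \<theta> :: "nat \<Rightarrow> real" where "\<theta> j = (SOME s. p j = G 0 s t)"
text \<open>The increment is chosen together with the chord bound, which selects a short arc to the
  next node independently of the parameter chosen for that node.\<close>

definition a :: "nat \<Rightarrow> real" where
  "a j = (SOME y. p (nxt J j) = G 0 (\<theta> j + y) t \<and> \<bar>y\<bar> \<le> B * norm (p (nxt J j) - G 0 (\<theta> j) t))"
text \<open>On the curve at \<open>t'\<close>, the old projected node is transported to parameter
  \<open>\<theta> j\<close>; \<eta> is the shift from there to the projection of the new
  vertex.\<close>

definition \<eta> :: "nat \<Rightarrow> real" where
  "\<eta> j = (SOME y. closest_point (curve t') (x' j) = G 0 (\<theta> j + y) t'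
      \<and> \<bar>y\<bar> \<le> B * norm (closest_point (curve t') (x' j) - G 0 (\<theta> j) t'))"

lemma theta: assumes "j < J" shows "p j = G 0 (\<theta> j) t"
proof -
  have "p j \<in> curve t" using p[OF assms] closest_point_in_curve(1)[OF times(1)] by simp
  then have "\<exists>s. p j = G 0 s t" by auto
  then show ?thesis unfolding \<theta>_def by (rule someI_ex)
qed

lemma L_pos: "j < J \<Longrightarrow> 0 < L j"
  unfolding L_def by (rule simple_polygon_elen_pos[OF polygons(2)])

lemma L_eq: assumes "j < J" shows "L j = norm (p (nxt J j) - p j)"
  by (simp add: L_def elen_def dist_norm norm_minus_commute)

lemma a: assumes j: "j < J"
  shows "p (nxt J j) = G 0 (\<theta> j + a j) t" "\<bar>a j\<bar> \<le> B * L j"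
proof -
  have "p (nxt J j) \<in> curve t" using p[of "nxt J j"] j closest_point_in_curve(1)[OF times(1)] by simp
  then obtain y where y: "p (nxt J j) = G 0 y t" "\<bar>y - \<theta> j\<bar> \<le> B * norm (p (nxt J j) - G 0 (\<theta> j) t)"
    using curve_lift[OF times(1)] by metis
  then have "\<exists>y. p (nxt J j) = G 0 (\<theta> j + y) t \<and> \<bar>y\<bar> \<le> B * norm (p (nxt J j) - G 0 (\<theta> j) t)"
    by (intro exI[of _ "y - \<theta> j"]) simp
  then have "p (nxt J j) = G 0 (\<theta> j + a j) t \<and> \<bar>a j\<bar> \<le> B * norm (p (nxt J j) - G 0 (\<theta> j) t)"
    unfolding a_def by (rule someI_ex)
  then show "p (nxt J j) = G 0 (\<theta> j + a j) t" "\<bar>a j\<bar> \<le> B * L j"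
    using theta[OF j] L_eq[OF j] by auto
qed

lemma a_le: assumes j: "j < J" shows "\<bar>a j\<bar> \<le> B * M0 * h" "\<bar>a j\<bar> \<le> M / 300 * h"
proof -
  have "B * L j \<le> B * (M0 * h)" using len(2)[OF j] B by (intro mult_left_mono) (auto simp: L_def)
  then show 1: "\<bar>a j\<bar> \<le> B * M0 * h" using a(2)[OF j] by simp
  have "B * M0 * h \<le> M / 300 * h" using M_ge(4) h by (intro mult_right_mono) auto
  with 1 show "\<bar>a j\<bar> \<le> M / 300 * h" by simp
qed

lemma a_ge: assumes j: "j < J" shows "h / (B * M0) \<le> \<bar>a j\<bar>" "a j \<noteq> 0"
proof -
  have "h / M0 \<le> L j" using len(1)[OF j] by (simp add: L_def)
  also have "\<dots> \<le> B * \<bar>a j\<bar>"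
    using lip[of 0 t "\<theta> j + a j" "\<theta> j"] times a(1)[OF j] theta[OF j] L_eq[OF j] by simp
  finally show "h / (B * M0) \<le> \<bar>a j\<bar>" using B M0 by (simp add: field_simps)
  moreover have "0 < h / (B * M0)" using B M0 h by simp
  ultimately show "a j \<noteq> 0" by auto
qed

sublocale ip: inscribed_polygon T B G t J p \<theta> a
proof unfold_locales
  fix j assume j: "j < J"
  have "3 * B^6 * \<bar>a j\<bar> \<le> M * (M / 300 * h)"
    using a_le(2)[OF j] M_ge(1,5) zero_le_power[of B 6] B by (intro mult_mono) linarith+
  also have "\<dots> = (M\<^sup>2 * h) / 300" by (simp add: power2_eq_square)
  also have "\<dots> < 1" using M_h[of 2] by simp
  finally show "3 * B^6 * \<bar>a j\<bar> < 1" .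
qed (use times theta a polygons inj in auto)

lemma Jh: "real J * h \<le> 2 * B * M0" "real J * h \<le> M"
proof -
  have "0 < h / (B * M0)" using B M0 h by simp
  then have "real J * (h / (B * M0)) \<le> 1 + h / (B * M0)"
    using a_ge(1) by (intro ip.number_of_nodes) auto
  then have "real J * h \<le> B * M0 + h" using B M0 by (simp add: field_simps)
  moreover have "1 * 1 \<le> B * M0" using B M0 by (intro mult_mono) auto
  ultimately show "real J * h \<le> 2 * B * M0" using h_le by simp
  moreover have "0 \<le> B * M0" using B M0 by simp
  ultimately show "real J * h \<le> M" using M_ge(4) by linarith
qed

lemma theta_nxt: assumes j: "j < J" obtains z where "\<theta> j + a j = \<theta> (nxt J j) + of_int z"
  using param_unique[OF times(1), of "\<theta> j + a j" "\<theta> (nxt J j)"] a(1)[OF j] theta[of "nxt J j"] j by auto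

text \<open>Relative change of an edge vector between the projected and the numerical
  polygon.\<close>

definition n :: "nat \<Rightarrow> real" where "n j = norm (e (nxt J j) - e j) / L j"

lemma n_bounds: assumes j: "j < J" shows "0 \<le> n j" "n j \<le> h" "norm (e (nxt J j) - e j) = n j * L j"
  using err_diff[OF j] L_pos[OF j] by (auto simp: n_def e_def L_def pos_divide_le_eq)

text \<open>With about 1/h edges, this makes \<open>n\<close> typically of size h^(3/2), better than
  the uniform bound \<open>h\<close>. The gain is just enough for the sum of the squares of
  \<open>n j / h\<close>, which are curvature errors, to stay bounded.\<close>

lemma n_sum: "(\<Sum>j<J. (n j)\<^sup>2) \<le> M0 * h\<^sup>2"
proof -
  have "h / M0 * (\<Sum>j<J. (n j)\<^sup>2) \<le> (\<Sum>j<J. L j * (n j)\<^sup>2)"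
    unfolding sum_distrib_left using len(1) by (intro sum_mono mult_right_mono) (auto simp: L_def)
  also have "\<dots> = (\<Sum>j<J. (norm ((x (nxt J j) - p (nxt J j)) - (x j - p j)))\<^sup>2 / elen J p j)"
    using L_pos by (intro sum.cong refl) (force simp: n_def e_def L_def power2_eq_square)
  also have "\<dots> \<le> h^3" by (rule err_sum)
  also have "\<dots> = h / M0 * (M0 * h\<^sup>2)" using M0 by (simp add: power2_eq_square power3_eq_cube)
  finally show ?thesis by (rule mult_left_le_imp_le) (use M0 h in simp)
qed

section \<open>The numerical polygon compared with the projected one\<close>

lemma edge_diff: assumes j: "j < J"
  shows "norm ((x (nxt J j) - x j) - (p (nxt J j) - p j)) \<le> n j * L j"
proof -
  have "(x (nxt J j) - x j) - (p (nxt J j) - p j) = e (nxt J j) - e j" by (simp add: e_def)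
  then show ?thesis using n_bounds(3)[OF j] by simp
qed

lemma elen_x: assumes j: "j < J"
  shows "elen J x j = norm (x (nxt J j) - x j)" "L j / 2 \<le> elen J x j" "elen J x j \<le> 2 * L j"
    "h / (2 * M0) \<le> elen J x j" "elen J x j \<le> 2 * M0 * h" "h / M \<le> elen J x j" "elen J x j \<le> M * h"
proof -
  show eq: "elen J x j = norm (x (nxt J j) - x j)" by (simp add: elen_def dist_norm norm_minus_commute)
  have "\<bar>elen J x j - L j\<bar> \<le> n j * L j"
    using edge_diff[OF j] norm_triangle_ineq3[of "x (nxt J j) - x j" "p (nxt J j) - p j"]
    unfolding eq L_eq[OF j] by linarith
  also have "\<dots> \<le> (1/2) * L j" using n_bounds[OF j] L_pos[OF j] h_le by (intro mult_right_mono) auto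
  finally have "\<bar>elen J x j - L j\<bar> \<le> L j / 2" by simp
  then show 1: "L j / 2 \<le> elen J x j" "elen J x j \<le> 2 * L j" using L_pos[OF j] by linarith+
  show 2: "h / (2 * M0) \<le> elen J x j" "elen J x j \<le> 2 * M0 * h"
    using 1 len[OF j] by (auto simp: L_def)
  have "h / M \<le> h / (2 * M0)" using M_ge(3) M0 h by (intro divide_left_mono) auto
  with 2 show "h / M \<le> elen J x j" by simp
  have "2 * M0 * h \<le> M * h" using M_ge(3) M0 h by (intro mult_right_mono) auto
  with 2 show "elen J x j \<le> M * h" by simp
qed

lemma node: assumes j: "j < J"
  obtains \<sigma> where "\<sigma> = 1 \<or> \<sigma> = (-1::real)"
    "norm (node_curvature J x j - curvature (\<theta> j) t) \<le> 16 * B^6 * M0^3 * h + 6 * M0 * (n j + n (prv J j)) / h"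
    "norm (edge_tangent J x j - \<sigma> *\<^sub>R tang (\<theta> j) t) \<le> M * h"
proof -
  let ?i = "prv J j"
  have i: "?i < J" "nxt J ?i = j" using j by auto
  \<comment> \<open>Direction of the outgoing arc; by \<open>same_orientation\<close> the incoming
    arc has the same sign, which the consistency estimate requires.\<close>
  define \<sigma> where "\<sigma> = (if 0 < a j then 1 else -1::real)"
  have sg: "\<sigma> = 1 \<or> \<sigma> = -1" by (simp add: \<sigma>_def)
  have "0 < a j * a ?i" using ip.same_orientation[OF j a_ge(2)[OF j] a_ge(2)[OF i(1)]] .
  then have sa: "0 < \<sigma> * a j" "0 < \<sigma> * a ?i"
    using a_ge(2)[OF j] by (auto simp: \<sigma>_def zero_less_mult_iff)
  obtain z where z: "\<theta> ?i + a ?i = \<theta> j + of_int z" using theta_nxt[OF i(1)] i(2) by metis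
  \<comment> \<open>The chosen parameters of neighbouring nodes may differ by an integer;
    periodicity allows the preceding node to be described relative to
    \<open>\<theta> j\<close>.\<close>
  have "\<theta> ?i = (\<theta> j - a ?i) + of_int z" using z by simp
  then have pi: "p ?i = G 0 (\<theta> j - a ?i) t" using theta[OF i(1)] periodic_int[OF times(1)] by simp
  have P1: "G 0 (\<theta> j + a j) t - G 0 (\<theta> j) t = p (nxt J j) - p j" using a(1)[OF j] theta[OF j] by simp
  have P2: "G 0 (\<theta> j) t - G 0 (\<theta> j - a ?i) t = p j - p ?i" using pi theta[OF j] by simp
  let ?E1 = "x (nxt J j) - x j" and ?E2 = "x j - x ?i"
  have l1: "norm (p (nxt J j) - p j) = L j" and l2: "norm (p j - p ?i) = L ?i"
    using L_eq[OF j] L_eq[OF i(1)] i(2) by simp_all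
  have e1: "norm ?E1 = elen J x j" and e2: "norm ?E2 = elen J x ?i"
    using elen_x(1)[OF j] elen_x(1)[OF i(1)] i(2) by simp_all
  have epos: "0 < elen J x k" if "k < J" for k using simple_polygon_elen_pos[OF polygons(1) that] .
  note cc = node_curvature_consistent[OF times(1) sg sa, of ?E1 ?E2 "\<theta> j" "n j" "n ?i" "node_mass J x j", unfolded P1 P2]
  have asm: "?E1 \<noteq> 0" "?E2 \<noteq> 0"
    "norm (?E1 - (p (nxt J j) - p j)) \<le> n j * norm (p (nxt J j) - p j)"
    "norm (?E2 - (p j - p ?i)) \<le> n ?i * norm (p j - p ?i)"
    "node_mass J x j = (norm ?E1 + norm ?E2) / 2"
    using epos[OF j] epos[OF i(1)] e1 e2 edge_diff[OF j] edge_diff[OF i(1)] l1 l2 i(2)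
    by (auto simp: node_mass_def)
  have t1: "?E1 /\<^sub>R norm ?E1 = edge_tangent J x j" and t2: "?E2 /\<^sub>R norm ?E2 = edge_tangent J x ?i"
    unfolding edge_tangent_def e1 e2 i(2) by simp_all
  have "norm (node_curvature J x j - curvature (\<theta> j) t)
      \<le> (4 * B^4 * ((a j)\<^sup>2 + (a ?i)\<^sup>2) + 2 * n j + 2 * n ?i + B^3 * (n j * L j + n ?i * L ?i)) / node_mass J x j"
    using cc(1)[OF asm] unfolding t1 t2 l1 l2 node_curvature_def .
  also have "\<dots> \<le> (8 * B^6 * M0\<^sup>2 * h\<^sup>2 + 3 * (n j + n ?i)) / (h / (2 * M0))"
  proof (rule frac_le)
    have sq: "(a k)\<^sup>2 \<le> (B * M0 * h)\<^sup>2" if "k < J" for k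
    proof -
      have "\<bar>a k\<bar>\<^sup>2 \<le> (B * M0 * h)\<^sup>2" using a_le(1)[OF that] by (intro power_mono) auto
      then show ?thesis by simp
    qed
    have "4 * B^4 * ((a j)\<^sup>2 + (a ?i)\<^sup>2) \<le> 4 * B^4 * ((B * M0 * h)\<^sup>2 + (B * M0 * h)\<^sup>2)"
      using sq[OF j] sq[OF i(1)] B by (intro mult_left_mono add_mono) auto
    then have 1: "4 * B^4 * ((a j)\<^sup>2 + (a ?i)\<^sup>2) \<le> 8 * B^6 * M0\<^sup>2 * h\<^sup>2" by (simp add: power_mult_distrib power_eq_if)
    have 2: "B^3 * (n k * L k) \<le> n k" if "k < J" for k
    proof -
      have "B^3 * L k \<le> B^3 * (M0 * h)" using len(2)[OF that] B by (intro mult_left_mono) (auto simp: L_def)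
      also have "\<dots> = (B^3 * M0) * h" by simp
      also have "\<dots> \<le> M * h" using M_ge(9) h B M0 by (intro mult_right_mono) (auto intro: order_trans[rotated])
      also have "\<dots> \<le> 1" using M_h[of 1] by simp
      finally have "n k * (B^3 * L k) \<le> n k * 1" using n_bounds(1)[OF that] by (intro mult_left_mono) auto
      then show ?thesis by (simp add: mult_ac)
    qed
    show "4 * B^4 * ((a j)\<^sup>2 + (a ?i)\<^sup>2) + 2 * n j + 2 * n ?i + B^3 * (n j * L j + n ?i * L ?i)
        \<le> 8 * B^6 * M0\<^sup>2 * h\<^sup>2 + 3 * (n j + n ?i)"
      using 1 2[OF j] 2[OF i(1)] by (simp add: distrib_left)
    show "h / (2 * M0) \<le> node_mass J x j"
      using elen_x(4)[OF j] elen_x(4)[OF i(1)] by (simp add: node_mass_def)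
    show "0 < h / (2 * M0)" using h M0 by simp
    show "0 \<le> 8 * B^6 * M0\<^sup>2 * h\<^sup>2 + 3 * (n j + n ?i)" using B n_bounds(1)[OF j] n_bounds(1)[OF i(1)] by simp
  qed
  also have "\<dots> = 16 * B^6 * M0^3 * h + 6 * M0 * (n j + n ?i) / h"
    using h M0 by (simp add: field_simps power2_eq_square power3_eq_cube)
  finally have 1: "norm (node_curvature J x j - curvature (\<theta> j) t) \<le> 16 * B^6 * M0^3 * h + 6 * M0 * (n j + n ?i) / h" .
  have "norm (edge_tangent J x j - \<sigma> *\<^sub>R tang (\<theta> j) t) \<le> B\<^sup>2 * (a j)\<^sup>2 / 2 + B\<^sup>2 * \<bar>a j\<bar> + 2 * n j"
    using cc(2)[OF asm] unfolding t1 .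
  also have "\<dots> \<le> M * h"
  proof -
    have "\<bar>a j\<bar> \<le> 1" using a_le(2)[OF j] M_h[of 1] by simp
    then have "(a j)\<^sup>2 \<le> \<bar>a j\<bar>" by (metis abs_ge_zero abs_mult_self_eq mult_left_le power2_eq_square)
    then have "B\<^sup>2 * (a j)\<^sup>2 \<le> B\<^sup>2 * \<bar>a j\<bar>" by (rule mult_left_mono) simp
    moreover have "B\<^sup>2 * \<bar>a j\<bar> \<le> B\<^sup>2 * (B * M0 * h)" using a_le(1)[OF j] by (intro mult_left_mono) auto
    moreover have "B\<^sup>2 * (B * M0 * h) = (B^3 * M0) * h" by (simp add: power2_eq_square power3_eq_cube)
    moreover have "300 * (B^3 * M0) * h \<le> M * h" using M_ge(9) h by (intro mult_right_mono) auto
    moreover have "300 * h \<le> M * h" using M_ge(1) h by (intro mult_right_mono) auto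
    ultimately show ?thesis using n_bounds(2)[OF j] h by linarith
  qed
  finally show ?thesis using that[OF sg 1] by blast
qed

lemma curvature_err: assumes j: "j < J"
  shows "norm (node_curvature J x j - curvature (\<theta> j) t) \<le> M / 2"
proof -
  obtain \<sigma> where *: "norm (node_curvature J x j - curvature (\<theta> j) t) \<le> 16 * B^6 * M0^3 * h + 6 * M0 * (n j + n (prv J j)) / h"
    using node[OF j] by metis
  have "16 * B^6 * M0^3 * h \<le> M * h"
    using M_ge(13) h BM_nonneg[of 6 3] by (intro mult_right_mono) linarith+
  moreover have "6 * M0 * (n j + n (prv J j)) / h \<le> 6 * M0 * (h + h) / h"
    using n_bounds[OF j] n_bounds[of "prv J j"] j M0 h by (intro divide_right_mono mult_left_mono add_mono) auto
  moreover have "6 * M0 * (h + h) / h = 12 * M0" using h by (simp add: field_simps)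
  ultimately show ?thesis using * M_h[of 1] M_ge(1,3) M0 by simp
qed

lemma turning: assumes j: "j < J"
  shows "9/10 \<le> edge_tangent J x (prv J j) \<bullet> edge_tangent J x j"
proof -
  let ?s = "edge_tangent J x (prv J j)" and ?t = "edge_tangent J x j"
  have norm1: "norm (edge_tangent J x k) = 1" if "k < J" for k
    using elen_x(1)[OF that] simple_polygon_elen_pos[OF polygons(1) that] by (simp add: edge_tangent_def)
  have pos: "0 < node_mass J x j"
    using simple_polygon_elen_pos[OF polygons(1), of j] simple_polygon_elen_pos[OF polygons(1), of "prv J j"] j
    by (simp add: node_mass_def)
  have m: "node_mass J x j \<le> M * h"
    using elen_x(7)[OF j] elen_x(7)[of "prv J j"] j by (simp add: node_mass_def)
  have "norm (node_curvature J x j) \<le> M / 2 + 2 * B^3"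
    using norm_triangle_mono[OF curvature_err[OF j] curvature_le[OF times(1), of "\<theta> j"]] by simp
  moreover have "0 \<le> B^3" using B by simp
  ultimately have kv: "norm (node_curvature J x j) \<le> M" using M_ge(8) by linarith
  have "?t - ?s = node_mass J x j *\<^sub>R node_curvature J x j" using pos by (simp add: node_curvature_def)
  then have "norm (?t - ?s) \<le> (M * h) * M" using m kv pos by (simp add: mult_mono)
  also have "\<dots> = M\<^sup>2 * h" by (simp add: power2_eq_square)
  also have "\<dots> \<le> 1 / 10" using M_h[of 2] by simp
  finally have "(norm (?t - ?s))\<^sup>2 \<le> (1/10)\<^sup>2" by (intro power_mono) auto
  moreover have "(norm (?t - ?s))\<^sup>2 = (norm ?t)\<^sup>2 + (norm ?s)\<^sup>2 - 2 * (?s \<bullet> ?t)"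
    unfolding power2_norm_eq_inner by (simp add: inner_diff_left inner_diff_right inner_commute)
  ultimately show ?thesis using norm1[OF j] norm1[of "prv J j"] j by (simp add: power2_eq_square)
qed

text \<open>The chord error O(h) at each of about 1/h nodes sums to something small, while the
  squares of \<open>n j / h\<close> sum to a constant by \<open>n_sum\<close>. This supplies the
  assumption \<open>K_err\<close> of the stability estimates.\<close>

lemma curvature_err_sum: "(\<Sum>j<J. (norm (node_curvature J x j - curvature (\<theta> j) t))\<^sup>2) \<le> M"
proof -
  let ?c = "16 * B^6 * M0^3"
  have "(norm (node_curvature J x j - curvature (\<theta> j) t))\<^sup>2 \<le> 2 * (?c * h)\<^sup>2 + 144 * M0\<^sup>2 / h\<^sup>2 * ((n j)\<^sup>2 + (n (prv J j))\<^sup>2)"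
    if j: "j < J" for j
  proof -
    let ?s = "n j + n (prv J j)"
    obtain \<sigma> where *: "norm (node_curvature J x j - curvature (\<theta> j) t) \<le> ?c * h + 6 * M0 * ?s / h"
      using node[OF j] by metis
    then have "(norm (node_curvature J x j - curvature (\<theta> j) t))\<^sup>2 \<le> (?c * h + 6 * M0 * ?s / h)\<^sup>2"
      by (intro power_mono) auto
    also have "\<dots> \<le> 2 * (?c * h)\<^sup>2 + 2 * (6 * M0 * ?s / h)\<^sup>2"
      using zero_le_power2[of "?c * h - 6 * M0 * ?s / h"] by (simp add: power2_sum power2_diff)
    also have "(6 * M0 * ?s / h)\<^sup>2 = 36 * M0\<^sup>2 / h\<^sup>2 * ?s\<^sup>2" by (simp add: power_mult_distrib power_divide)
    also have "\<dots> \<le> 36 * M0\<^sup>2 / h\<^sup>2 * (2 * ((n j)\<^sup>2 + (n (prv J j))\<^sup>2))"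
      using zero_le_power2[of "n j - n (prv J j)"] by (intro mult_left_mono) (auto simp: power2_sum power2_diff)
    finally show ?thesis by (simp add: algebra_simps add_divide_distrib)
  qed
  then have "(\<Sum>j<J. (norm (node_curvature J x j - curvature (\<theta> j) t))\<^sup>2)
      \<le> (\<Sum>j<J. 2 * (?c * h)\<^sup>2 + 144 * M0\<^sup>2 / h\<^sup>2 * ((n j)\<^sup>2 + (n (prv J j))\<^sup>2))"
    by (intro sum_mono) auto
  also have "\<dots> = real J * (2 * (?c * h)\<^sup>2) + 288 * M0\<^sup>2 / h\<^sup>2 * (\<Sum>j<J. (n j)\<^sup>2)"
    unfolding sum.distrib sum_distrib_left[symmetric] sum_prv[of "\<lambda>j. (n j)\<^sup>2" J] by simp
  also have "\<dots> \<le> 1 + 288 * M0\<^sup>2 / h\<^sup>2 * (M0 * h\<^sup>2)"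
  proof (intro add_mono mult_left_mono n_sum)
    have c: "0 \<le> ?c" "?c \<le> M" using M_ge(13) BM_nonneg[of 6 3] by linarith+
    have "real J * (2 * (?c * h)\<^sup>2) = (real J * h) * (2 * ?c\<^sup>2 * h)" by (simp add: power2_eq_square)
    also have "\<dots> \<le> M * (2 * M\<^sup>2 * h)"
      using Jh(2) c h M_ge(1) by (intro mult_mono mult_right_mono mult_left_mono power_mono) auto
    also have "\<dots> = 2 * (M^3 * h)" by (simp add: power2_eq_square power3_eq_cube)
    also have "\<dots> \<le> 1" using M_h[of 3] by simp
    finally show "real J * (2 * (?c * h)\<^sup>2) \<le> 1" .
  qed auto
  also have "\<dots> = 1 + 288 * M0^3" using h by (simp add: power2_eq_square power3_eq_cube)
  also have "\<dots> \<le> M" using M_ge(7) one_le_power[OF M0, of 3] by simp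
  finally show ?thesis .
qed

sublocale ps: polygon_step J x "\<lambda>j. curvature (\<theta> j) t" "\<lambda>j. x' j - x j" h "t' - t" M
proof unfold_locales
  show "1 \<le> M" using M_ge(1) by simp
  show "0 < h" "0 < t' - t" using h times by auto
  show "0 < J" using polygons by (simp add: simple_polygon_def)
  show "real J * h \<le> M" by (rule Jh)
  show "(\<Sum>j<J. (norm (node_curvature J x j - curvature (\<theta> j) t))\<^sup>2) \<le> M" by (rule curvature_err_sum)
  show "t' - t \<le> M * h\<^sup>2"
    using tau_le M_ge(3) M0 mult_right_mono[of M0 M "h\<^sup>2"] by simp
  show "100 * (M^4 * h) \<le> 1" using M_h[of 4] by simp
  fix j assume j: "j < J"
  show "h / M \<le> elen J x j" "elen J x j \<le> M * h" using elen_x[OF j] by auto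
  have "0 \<le> B^3" using B by simp
  then show "norm (curvature (\<theta> j) t) \<le> M" using curvature_le[OF times(1), of "\<theta> j"] M_ge(8) by linarith
  obtain z where z: "\<theta> j + a j = \<theta> (nxt J j) + of_int z" using theta_nxt[OF j] .
  have "curvature (\<theta> (nxt J j)) t = curvature (\<theta> j + a j) t" using curvature_periodic[OF times(1)] z by simp
  then have "norm (curvature (\<theta> (nxt J j)) t - curvature (\<theta> j) t) \<le> 10 * B^5 * \<bar>a j\<bar>"
    using curvature_lip[OF times(1), of "\<theta> j + a j" "\<theta> j"] by simp
  also have "\<dots> \<le> 10 * B^5 * (B * M0 * h)" using a_le(1)[OF j] B by (intro mult_left_mono) auto
  also have "\<dots> = 10 * (B^6 * M0) * h" by (simp add: power_eq_if)
  also have "\<dots> \<le> M * h"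
  proof (rule mult_right_mono)
    have "0 \<le> B^6 * M0" using B M0 by simp
    then show "10 * (B^6 * M0) \<le> M" using M_ge(6) by linarith
  qed (use h in simp)
  finally show "norm (curvature (\<theta> (nxt J j)) t - curvature (\<theta> j) t) \<le> M * h" .
next
  fix \<phi> :: nodal
  show "(\<Sum>j<J. node_mass J x j * (((x' j - x j) \<bullet> perp (node_tangent J x j)) * (\<phi> j \<bullet> perp (node_tangent J x j)))) / (t' - t)
      + (\<Sum>j<J. ((x' (nxt J j) - x (nxt J j) - (x' j - x j)) \<bullet> (\<phi> (nxt J j) - \<phi> j)) / elen J x j)
    = (\<Sum>j<J. node_mass J x j * ((perp (node_tangent J x j) \<bullet> node_curvature J x j) * (\<phi> j \<bullet> perp (node_tangent J x j))))"
  proof (rule scheme_step_weak[OF polygons(1) _ scheme])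
    show "0 < t' - t" using times by simp
    fix j assume j: "j < J"
    \<comment> \<open>The sign is obtained vertex by vertex; a common sign for the two edges meeting
      at each vertex is all that the nodal form needs.\<close>
    obtain \<sigma> where "\<sigma> = 1 \<or> \<sigma> = (-1::real)" "\<nu> (prv J j) = \<sigma> *\<^sub>R perp (edge_tangent J x (prv J j))"
        "\<nu> j = \<sigma> *\<^sub>R perp (edge_tangent J x j)"
      using outward_normals_consistent[OF polygons(1) normals j turning[OF j]] by metis
    then show "\<exists>\<sigma>. (\<sigma> = 1 \<or> \<sigma> = (-1::real)) \<and> avg_normal J x \<nu> j = \<sigma> *\<^sub>R perp (node_tangent J x j)"
      using avg_normal_eq by blast
  qed
qed

section \<open>The parameter shift in one step\<close>

lemma e_orthogonal: assumes j: "j < J" shows "e j \<bullet> G 1 (\<theta> j) t = 0"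
  using closest_point_orthogonal[OF times(1), of "x j" "\<theta> j"] p[OF j] theta[OF j] by (simp add: e_def)

lemma eta: assumes j: "j < J"
  shows "closest_point (curve t') (x' j) = G 0 (\<theta> j + \<eta> j) t'"
    "\<bar>\<eta> j\<bar> \<le> B * norm (closest_point (curve t') (x' j) - G 0 (\<theta> j) t')"
proof -
  let ?p = "closest_point (curve t') (x' j)"
  obtain y where "?p = G 0 y t'" "\<bar>y - \<theta> j\<bar> \<le> B * norm (?p - G 0 (\<theta> j) t')"
    using curve_lift[OF times(2) closest_point_in_curve(1)[OF times(2)]] by metis
  then have "\<exists>y. ?p = G 0 (\<theta> j + y) t' \<and> \<bar>y\<bar> \<le> B * norm (?p - G 0 (\<theta> j) t')"
    by (intro exI[of _ "y - \<theta> j"]) simp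
  then have "?p = G 0 (\<theta> j + \<eta> j) t' \<and> \<bar>\<eta> j\<bar> \<le> B * norm (?p - G 0 (\<theta> j) t')"
    unfolding \<eta>_def by (rule someI_ex)
  then show "?p = G 0 (\<theta> j + \<eta> j) t'" "\<bar>\<eta> j\<bar> \<le> B * norm (?p - G 0 (\<theta> j) t')" by auto
qed

definition \<tau> :: real where "\<tau> = t' - t"
definition d :: nodal where "d j = x' j - x j"

lemma tau_pos: "0 < \<tau>" "\<bar>t' - t\<bar> = \<tau>" using times by (auto simp: \<tau>_def)

lemma tau_h: assumes "k \<le> 15" shows "M^k * \<tau> \<le> h / 1000000"
proof -
  have "\<tau> \<le> M * h\<^sup>2" using tau_le M_ge(3) M0 mult_right_mono[of M0 M "h\<^sup>2"] by (simp add: \<tau>_def)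
  then have "M^k * \<tau> \<le> M^k * (M * h\<^sup>2)" using M_ge(1) by (intro mult_left_mono) auto
  also have "\<dots> = (M^(Suc k) * h) * h" by (simp add: power2_eq_square)
  also have "\<dots> \<le> 1 / 1000000 * h" using M_h[of "Suc k"] assms h by (intro mult_right_mono) auto
  finally show ?thesis by simp
qed

lemma d_bound: assumes j: "j < J" shows "norm (d j) \<le> 2000 * M^8 * \<tau>" "norm (d j) \<le> h / 500"
proof -
  show "norm (d j) \<le> 2000 * M^8 * \<tau>" using ps.d_le[OF j] by (simp add: d_def \<tau>_def)
  then show "norm (d j) \<le> h / 500" using tau_h[of 8] by simp
qed

lemma e_bound: "j < J \<Longrightarrow> norm (e j) \<le> h" using err by (simp add: e_def)

text \<open>A crude O(h) bound from minimality of the distance. Its purpose is to meet the smallness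
  conditions of the shift estimates, which then improve it to O(\<tau>).\<close>

lemma eta_small: assumes j: "j < J" shows "\<bar>\<eta> j\<bar> \<le> 6 * B * h" "16 * B^4 * \<bar>\<eta> j\<bar> \<le> 1"
proof -
  let ?p = "closest_point (curve t') (x' j)" and ?g = "G 0 (\<theta> j) t'"
  have "x' j - ?g = (e j + d j) + (G 0 (\<theta> j) t - G 0 (\<theta> j) t')"
    using theta[OF j] by (simp add: e_def d_def)
  moreover have "norm (e j + d j) \<le> h + h / 500" by (rule norm_triangle_mono[OF e_bound[OF j] d_bound(2)[OF j]])
  moreover have "norm (G 0 (\<theta> j) t - G 0 (\<theta> j) t') \<le> B * \<tau>"
    using time[of 0 t' t "\<theta> j"] times tau_pos by (simp add: abs_minus_commute)
  ultimately have "norm (x' j - ?g) \<le> h + h / 500 + B * \<tau>" by (metis norm_triangle_mono)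
  moreover have "B * \<tau> \<le> M * \<tau>" using M_ge(2) B tau_pos by (intro mult_right_mono) auto
  ultimately have 1: "norm (x' j - ?g) \<le> 3 / 2 * h" using tau_h[of 1] h by simp
  have "norm (x' j - ?p) \<le> norm (x' j - ?g)"
    using closest_point_in_curve(2)[OF times(2), of ?g "x' j"] by (simp add: dist_norm)
  then have "norm (?p - ?g) \<le> 3 * h"
    using 1 norm_triangle_ineq4[of "x' j - ?g" "x' j - ?p"] by simp
  then have "B * norm (?p - ?g) \<le> B * (3 * h)" using B by (intro mult_left_mono) auto
  moreover have "0 \<le> B * h" using B h by simp
  ultimately show 2: "\<bar>\<eta> j\<bar> \<le> 6 * B * h" using eta(2)[OF j] by linarith
  have "16 * B^4 * \<bar>\<eta> j\<bar> \<le> 16 * B^4 * (6 * B * h)" using 2 B by (intro mult_left_mono) auto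
  also have "\<dots> = 96 * B^5 * h" by (simp add: power_eq_if)
  also have "\<dots> \<le> M * h"
  proof (rule mult_right_mono)
    have "0 \<le> B^5" using B by simp
    then show "96 * B^5 \<le> M" using M_ge(14) by linarith
  qed (use h in simp)
  also have "\<dots> \<le> 1" using M_h[of 1] by simp
  finally show "16 * B^4 * \<bar>\<eta> j\<bar> \<le> 1" .
qed

lemma new_orthogonal: assumes j: "j < J"
  shows "(e j + d j - (G 0 (\<theta> j + \<eta> j) t' - G 0 (\<theta> j) t)) \<bullet> G 1 (\<theta> j + \<eta> j) t' = 0"
proof -
  have "e j + d j - (G 0 (\<theta> j + \<eta> j) t' - G 0 (\<theta> j) t) = x' j - G 0 (\<theta> j + \<eta> j) t'"
    using theta[OF j] by (simp add: e_def d_def)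
  then show ?thesis using closest_point_orthogonal[OF times(2) eta(1)[OF j]] by (simp only:)
qed

lemma small_norms: assumes j: "j < J" shows "16 * B^3 * norm (e j) \<le> 1" "16 * B^3 * norm (d j) \<le> 1" "16 * B^4 * \<tau> \<le> 1"
proof -
  have nn: "0 \<le> B^3" "0 \<le> B^4" using B by auto
  have "16 * B^3 * norm (e j) \<le> M * h" "16 * B^3 * norm (d j) \<le> M * h"
    using e_bound[OF j] d_bound(2)[OF j] h nn M_ge(1,8) by (auto intro!: mult_mono)
  then show "16 * B^3 * norm (e j) \<le> 1" "16 * B^3 * norm (d j) \<le> 1" using M_h[of 1] by auto
  have "16 * B^4 * \<tau> \<le> M * \<tau>" using nn M_ge(12) tau_pos by (intro mult_right_mono) linarith+
  then show "16 * B^4 * \<tau> \<le> 1" using tau_h[of 1] h_le h by simp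
qed

lemma eta_le: assumes j: "j < J" shows "\<bar>\<eta> j\<bar> \<le> 27 * M^9 * \<tau>"
proof -
  have nn: "0 \<le> B^3" "0 \<le> B^4" using B by auto
  have "0 \<le> B^3 * norm (e j)" "0 \<le> B^4 * \<bar>\<eta> j\<bar>" using nn by auto
  then have small: "4 * B^3 * norm (e j) \<le> 1" "4 * B^4 * \<bar>\<eta> j\<bar> \<le> 1"
    using small_norms(1)[OF j] eta_small(2)[OF j] by linarith+
  have "\<bar>\<eta> j\<bar> \<le> 4 * B^4 * (norm (d j) + \<bar>t' - t\<bar>)"
    by (rule tangential_shift_le[OF times(1,2) e_orthogonal[OF j] new_orthogonal[OF j] small])
  also have "\<dots> \<le> 4 * (M / 300) * (2000 * M^8 * \<tau> + M^8 * \<tau>)"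
  proof (rule mult_mono[OF _ add_mono[OF d_bound(1)[OF j]]])
    show "4 * B^4 \<le> 4 * (M / 300)" using M_ge(12) by simp
    show "\<bar>t' - t\<bar> \<le> M^8 * \<tau>"
      using tau_pos one_le_power[of M 8] M_ge(1) mult_right_mono[of 1 "M^8" \<tau>] by simp
  qed (use M_ge(1) in auto)
  also have "\<dots> = 8004 / 300 * (M^9 * \<tau>)" by (simp add: power_eq_if)
  also have "\<dots> \<le> 27 * (M^9 * \<tau>)" using M_ge(1) tau_pos by (intro mult_right_mono) auto
  finally show ?thesis by simp
qed

text \<open>\<open>tangential_product_diff\<close> with the exact tangent derivative as
  \<open>g\<close>. The discrete normal is almost orthogonal to it because the node tangent is
  within O(h) of the unit tangent, up to sign.\<close>

lemma tangential_part_diff: assumes j: "j < J"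
  shows "\<bar>d (nxt J j) \<bullet> G 1 (\<theta> (nxt J j)) t - d j \<bullet> G 1 (\<theta> j) t\<bar>
    \<le> M * \<bar>ps.s (nxt J j) - ps.s j\<bar> + 6000 * M^11 * \<tau> * h"
  unfolding d_def \<tau>_def
proof (rule ps.tangential_product_diff[OF _ _ _ j])
  fix j assume j: "j < J"
  show g: "norm (G 1 (\<theta> j) t) \<le> M" using bound[of 1 t "\<theta> j"] times M_ge(1,2) B by simp
  obtain z where z: "\<theta> j + a j = \<theta> (nxt J j) + of_int z" using theta_nxt[OF j] .
  have "G 1 (\<theta> (nxt J j)) t = G 1 (\<theta> j + a j) t" using periodic_int[OF times(1)] z by simp
  then have "norm (G 1 (\<theta> (nxt J j)) t - G 1 (\<theta> j) t) \<le> B * \<bar>a j\<bar>"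
    using lip[of 1 t "\<theta> j + a j" "\<theta> j"] times by simp
  also have "\<dots> \<le> B * (B * M0 * h)" using a_le(1)[OF j] B by (intro mult_left_mono) auto
  also have "\<dots> = (B\<^sup>2 * M0) * h" by (simp add: power2_eq_square)
  also have "\<dots> \<le> M * h"
  proof (rule mult_right_mono)
    have "0 \<le> B\<^sup>2 * M0" using M0 by simp
    then show "B\<^sup>2 * M0 \<le> M" using M_ge(11) by linarith
  qed (use h in simp)
  finally show "norm (G 1 (\<theta> (nxt J j)) t - G 1 (\<theta> j) t) \<le> M * h" .
  obtain \<sigma> where sg: "norm (edge_tangent J x j - \<sigma> *\<^sub>R tang (\<theta> j) t) \<le> M * h" using node[OF j] by metis
  have "norm ((node_tangent J x j - edge_tangent J x j) + (edge_tangent J x j - \<sigma> *\<^sub>R tang (\<theta> j) t)) \<le> M\<^sup>2 * h + M * h"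
    by (rule norm_triangle_mono[OF ps.T_t[OF j] sg])
  also have "\<dots> \<le> M\<^sup>2 * h + M\<^sup>2 * h"
    using M_ge(1) h power_increasing[of 1 2 M] by (intro add_left_mono mult_right_mono) auto
  finally have T: "norm (perp (node_tangent J x j - \<sigma> *\<^sub>R tang (\<theta> j) t)) \<le> 2 * M\<^sup>2 * h" by (simp add: mult_ac)
  have "perp (tang (\<theta> j) t) \<bullet> G 1 (\<theta> j) t = 0" by (simp add: tang_def perp_scaleR)
  then have "perp (node_tangent J x j) \<bullet> G 1 (\<theta> j) t = perp (node_tangent J x j - \<sigma> *\<^sub>R tang (\<theta> j) t) \<bullet> G 1 (\<theta> j) t"
    by (simp add: perp_diff perp_scaleR inner_diff_left)
  also have "\<bar>\<dots>\<bar> \<le> (2 * M\<^sup>2 * h) * M"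
    using T g h by (intro order_trans[OF Cauchy_Schwarz_ineq2] mult_mono) auto
  finally show "\<bar>perp (node_tangent J x j) \<bullet> G 1 (\<theta> j) t\<bar> \<le> 2 * M^3 * h"
    by (simp add: power2_eq_square power3_eq_cube mult_ac)
qed

lemma eta_diff: assumes j: "j < J"
  shows "\<bar>\<eta> (nxt J j) - \<eta> j\<bar> \<le> M\<^sup>2 * \<bar>ps.s (nxt J j) - ps.s j\<bar> + 41 * M^12 * \<tau> * h"
proof -
  let ?i = "nxt J j"
  have i: "?i < J" using j by simp
  obtain z where z: "\<theta> j + a j = \<theta> ?i + of_int z" using theta_nxt[OF j] .
  have per: "G k (\<theta> j + a j) t = G k (\<theta> ?i) t" for k using periodic_int[OF times(1)] z by simp
  have shift: "\<theta> j + a j + \<eta> ?i = (\<theta> ?i + \<eta> ?i) + of_int z" using z by simp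
  have per': "G k (\<theta> j + a j + \<eta> ?i) t' = G k (\<theta> ?i + \<eta> ?i) t'" for k
    unfolding shift by (rule periodic_int[OF times(2)])
  let ?Df = "\<bar>d ?i \<bullet> G 1 (\<theta> ?i) t - d j \<bullet> G 1 (\<theta> j) t\<bar>"
  \<comment> \<open>The neighbour is given the parameter \<open>\<theta> j + a j\<close>, congruent
    to its own modulo one, so that the parameter difference is O(h) for every edge.\<close>
  have "\<bar>\<eta> ?i - \<eta> j\<bar> \<le> 2 * B\<^sup>2 * (\<bar>d ?i \<bullet> G 1 (\<theta> j + a j) t - d j \<bullet> G 1 (\<theta> j) t\<bar>
     + B\<^sup>2 * (\<bar>\<eta> j\<bar> + \<bar>t' - t\<bar>) * (3 * \<bar>\<theta> j + a j - \<theta> j\<bar> + norm (d ?i - d j) + norm (e ?i - e j)))"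
  proof (rule tangential_shift_diff[OF times(1,2) e_orthogonal[OF j] new_orthogonal[OF j]])
    show "e ?i \<bullet> G 1 (\<theta> j + a j) t = 0" unfolding per by (rule e_orthogonal[OF i])
    show "(e ?i + d ?i - (G 0 (\<theta> j + a j + \<eta> ?i) t' - G 0 (\<theta> j + a j) t)) \<bullet> G 1 (\<theta> j + a j + \<eta> ?i) t' = 0"
      unfolding per per' by (rule new_orthogonal[OF i])
  qed (use eta_small(2)[OF j] eta_small(2)[OF i] small_norms[OF i] tau_pos in auto)
  then have 1: "\<bar>\<eta> ?i - \<eta> j\<bar> \<le> 2 * B\<^sup>2 * (?Df + B\<^sup>2 * (\<bar>\<eta> j\<bar> + \<tau>) * (3 * \<bar>a j\<bar> + norm (d ?i - d j) + norm (e ?i - e j)))"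
    unfolding per tau_pos(2) by simp
  have inc: "3 * \<bar>a j\<bar> + norm (d ?i - d j) + norm (e ?i - e j) \<le> M * h"
  proof -
    have "norm (d ?i - d j) \<le> h / 500 + h / 500"
      by (rule order_trans[OF norm_triangle_ineq4 add_mono[OF d_bound(2)[OF i] d_bound(2)[OF j]]])
    moreover have "norm (e ?i - e j) \<le> h * (M0 * h)"
      using n_bounds[OF j] len(2)[OF j] L_pos[OF j] h by (simp add: L_def mult_mono)
    moreover have "M0 * h \<le> M * h" using M_ge(3) M0 h by (intro mult_right_mono) auto
    then have "M0 * h \<le> 1" using M_h[of 1] unfolding power_one_right by linarith
    then have "h * (M0 * h) \<le> h * 1" using h by (intro mult_left_mono) auto
    moreover have "300 * h \<le> M * h" using M_ge(1) h by (intro mult_right_mono) auto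
    ultimately show ?thesis using a_le(2)[OF j] h by linarith
  qed
  have "1 * \<tau> \<le> M^9 * \<tau>" using M_ge(1) tau_pos by (intro mult_right_mono one_le_power) auto
  then have et: "\<bar>\<eta> j\<bar> + \<tau> \<le> 28 * M^9 * \<tau>" using eta_le[OF j] by linarith
  have "B\<^sup>2 * (\<bar>\<eta> j\<bar> + \<tau>) * (3 * \<bar>a j\<bar> + norm (d ?i - d j) + norm (e ?i - e j))
      \<le> (M / 300) * (28 * M^9 * \<tau>) * (M * h)"
    using M_ge(1,10) et inc tau_pos by (intro mult_mono) auto
  also have "\<dots> = 28 / 300 * (M^11 * \<tau> * h)" by (simp add: power_eq_if)
  also have "\<dots> \<le> 1 * (M^11 * \<tau> * h)" using M_ge(1) tau_pos h by (intro mult_right_mono) auto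
  finally have "?Df + B\<^sup>2 * (\<bar>\<eta> j\<bar> + \<tau>) * (3 * \<bar>a j\<bar> + norm (d ?i - d j) + norm (e ?i - e j))
      \<le> M * \<bar>ps.s ?i - ps.s j\<bar> + 6001 * (M^11 * \<tau> * h)"
    using tangential_part_diff[OF j] by simp
  then have "2 * B\<^sup>2 * (?Df + B\<^sup>2 * (\<bar>\<eta> j\<bar> + \<tau>) * (3 * \<bar>a j\<bar> + norm (d ?i - d j) + norm (e ?i - e j)))
      \<le> 2 * (M / 300) * (M * \<bar>ps.s ?i - ps.s j\<bar> + 6001 * (M^11 * \<tau> * h))"
    using M_ge(1,10) tau_pos by (intro mult_mono) auto
  also have "\<dots> = 2 / 300 * (M\<^sup>2 * \<bar>ps.s ?i - ps.s j\<bar>) + 12002 / 300 * (M^12 * \<tau> * h)"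
    by (simp add: power_eq_if algebra_simps)
  also have "\<dots> \<le> 1 * (M\<^sup>2 * \<bar>ps.s ?i - ps.s j\<bar>) + 41 * (M^12 * \<tau> * h)"
    using M_ge(1) tau_pos h by (intro add_mono mult_right_mono) auto
  finally show ?thesis using 1 by simp
qed

text \<open>The factor \<open>h\<close> is inherited from the differences of \<open>s\<close>; the
  remainder is O(\<tau> h) at each node and gives the same order after summation, since
  \<open>real J * h\<close> is bounded.\<close>

lemma eta_diff_sum: "(\<Sum>j<J. (\<eta> (nxt J j) - \<eta> j)\<^sup>2) \<le> 300000000 * M^25 * h * \<tau>\<^sup>2"
proof -
  have "(\<eta> (nxt J j) - \<eta> j)\<^sup>2 \<le> 2 * M^4 * (ps.s (nxt J j) - ps.s j)\<^sup>2 + 3362 * M^24 * \<tau>\<^sup>2 * h\<^sup>2" if j: "j < J" for j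
  proof -
    let ?s = "\<bar>ps.s (nxt J j) - ps.s j\<bar>"
    have "\<bar>\<eta> (nxt J j) - \<eta> j\<bar>\<^sup>2 \<le> (M\<^sup>2 * ?s + 41 * M^12 * \<tau> * h)\<^sup>2"
      using eta_diff[OF j] by (intro power_mono) auto
    also have "\<dots> \<le> 2 * (M\<^sup>2 * ?s)\<^sup>2 + 2 * (41 * M^12 * \<tau> * h)\<^sup>2"
      using zero_le_power2[of "M\<^sup>2 * ?s - 41 * M^12 * \<tau> * h"] by (simp add: power2_sum power2_diff)
    also have "(M\<^sup>2 * ?s)\<^sup>2 = M^4 * (ps.s (nxt J j) - ps.s j)\<^sup>2"
      by (simp add: power_mult_distrib flip: power_mult)
    also have "(41 * M^12 * \<tau> * h)\<^sup>2 = 1681 * M^24 * \<tau>\<^sup>2 * h\<^sup>2"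
      by (simp add: power_mult_distrib flip: power_mult)
    finally show ?thesis by simp
  qed
  then have "(\<Sum>j<J. (\<eta> (nxt J j) - \<eta> j)\<^sup>2) \<le> (\<Sum>j<J. 2 * M^4 * (ps.s (nxt J j) - ps.s j)\<^sup>2 + 3362 * M^24 * \<tau>\<^sup>2 * h\<^sup>2)"
    by (intro sum_mono) auto
  also have "\<dots> = 2 * M^4 * (\<Sum>j<J. (ps.s (nxt J j) - ps.s j)\<^sup>2) + 3362 * M^24 * \<tau>\<^sup>2 * h * (real J * h)"
    by (simp add: sum.distrib sum_distrib_left power2_eq_square)
  also have "\<dots> \<le> 2 * M^4 * (110000000 * M^21 * h * \<tau>\<^sup>2) + 3362 * M^24 * \<tau>\<^sup>2 * h * M"
    using ps.s_diff_sq_sum[folded \<tau>_def] Jh(2) M_ge(1) h by (intro add_mono mult_left_mono) auto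
  also have "\<dots> = 220003362 * (M^25 * h * \<tau>\<^sup>2)" by (simp add: power_eq_if)
  also have "\<dots> \<le> 300000000 * (M^25 * h * \<tau>\<^sup>2)" using M_ge(1) h by (intro mult_right_mono) auto
  finally show ?thesis by simp
qed

end

section \<open>Norms of the normal jump\<close>

text \<open>A non-integrable integrand has integral 0, so nonnegativity needs no
  integrability.\<close>

lemma poly_int_nonneg:
  assumes "\<And>j s. 0 \<le> f j s"
  shows "0 \<le> poly_int J q f"
proof -
  have "0 \<le> integral {0..1} (f j)" for j
    using assms by (cases "f j integrable_on {0..1}") (auto intro: integral_nonneg simp: not_integrable_integral)
  then show ?thesis by (auto simp: poly_int_def elen_def intro!: sum_nonneg)
qed

lemma L2_nrm_nonneg: "0 \<le> L2_nrm J q u"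
  by (simp add: L2_nrm_def poly_int_nonneg)

lemma H1_nrm_nonneg: "0 \<le> H1_nrm J q u"
  by (simp add: H1_nrm_def poly_int_nonneg)

lemma H1_nrm_ge:
  assumes "\<And>j. j < J \<Longrightarrow> 0 < elen J q j"
  shows "(\<Sum>j<J. (norm (u (nxt J j) - u j))\<^sup>2 / elen J q j) \<le> (H1_nrm J q u)\<^sup>2"
proof -
  have "poly_int J q (\<lambda>j s. (norm (tgrad J q u j))\<^sup>2)
      = (\<Sum>j<J. (norm (u (nxt J j) - u j))\<^sup>2 / elen J q j)"
    unfolding poly_int_const using assms
    by (intro sum.cong refl) (force simp: norm_tgrad power_divide power2_eq_square)
  moreover have "0 \<le> poly_int J q (\<lambda>j s. (norm (tgrad J q u j))\<^sup>2)" by (rule poly_int_nonneg) simp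
  ultimately show ?thesis by (simp add: H1_nrm_def)
qed

lemma H1_nrm_cong:
  assumes "\<And>j. j < J \<Longrightarrow> u j = w j"
  shows "H1_nrm J q u = H1_nrm J q w"
proof -
  have "fe J u j = fe J w j" "tgrad J q u j = tgrad J q w j" if "j < J" for j
    using assms[OF that] assms[of "nxt J j"] that by (auto simp: fe_def tgrad_def fun_eq_iff)
  then show ?thesis by (simp add: H1_nrm_def L2_nrm_def poly_int_def)
qed

lemma H1_nrm_minus: "H1_nrm J q (\<lambda>j. - u j) = H1_nrm J q u"
proof -
  have "fe J (\<lambda>j. - u j) j s = - fe J u j s" for j s by (simp add: fe_def)
  moreover have "norm (tgrad J q (\<lambda>j. - u j) j) = norm (tgrad J q u j)" for j
    by (simp add: tgrad_def norm_outer norm_minus_commute)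
  ultimately show ?thesis by (simp add: H1_nrm_def L2_nrm_def)
qed

text \<open>The supremum is finite because convexity bounds all values by the sum of the nodal
  norms; the parameter 0 on edge \<open>j\<close> then gives the nodal value.\<close>

lemma Linf_nrm_ge:
  assumes "j < J"
  shows "norm (u j) \<le> Linf_nrm J u"
proof -
  have "norm (fe J u k s) \<le> (\<Sum>i<J. norm (u i))" if "k < J" "s \<in> {0..1}" for k s
  proof -
    have le: "norm (u i) \<le> (\<Sum>i<J. norm (u i))" if "i < J" for i
      using that by (intro member_le_sum) auto
    have "norm (fe J u k s) \<le> (1 - s) * norm (u k) + s * norm (u (nxt J k))"
      unfolding fe_def using that by (intro norm_triangle_le) auto
    also have "\<dots> \<le> (1 - s) * (\<Sum>i<J. norm (u i)) + s * (\<Sum>i<J. norm (u i))"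
      using that le by (intro add_mono mult_left_mono) auto
    finally show ?thesis by (simp add: algebra_simps)
  qed
  then have "bdd_above ((\<lambda>(j, s). norm (fe J u j s)) ` ({..<J} \<times> {0..1}))"
    by (intro bdd_aboveI[of _ "\<Sum>i<J. norm (u i)"]) auto
  then have "(\<lambda>(j, s). norm (fe J u j s)) (j, 0) \<le> Linf_nrm J u"
    unfolding Linf_nrm_def using assms by (intro cSUP_upper) auto
  then show ?thesis by simp
qed

lemma W1inf_nrm_ge:
  assumes "j < J" "0 < elen J q j"
  shows "norm (u (nxt J j) - u j) \<le> W1inf_nrm J q u * elen J q j"
proof -
  have "norm (tgrad J q u j) \<le> (SUP j\<in>{..<J}. norm (tgrad J q u j))"
    using assms(1) by (intro cSUP_upper) auto
  then have "norm (tgrad J q u j) \<le> W1inf_nrm J q u" by (simp add: W1inf_nrm_def)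
  then show ?thesis using assms by (simp add: norm_tgrad pos_divide_le_eq)
qed

section \<open>The jump as a finite element function\<close>

context evolving_curve
begin

text \<open>The projector onto the normal line is insensitive to the sign of the normal, so the
  rotated tangent may replace the outward normal.\<close>

definition normal_part :: "real \<Rightarrow> real \<Rightarrow> real^2 \<Rightarrow> real^2" where
  "normal_part \<theta> t w = (perp (tang \<theta> t) \<bullet> w) *\<^sub>R perp (tang \<theta> t)"

lemma normal_part_jump:
  "normal_part \<theta> t (G 0 (\<theta> + \<eta>) t' - G 0 \<theta> t')
    = (inverse (norm (G 1 \<theta> t)) * normal_jump t t' \<theta> \<eta>) *\<^sub>R perp (tang \<theta> t)"
  by (simp add: normal_part_def tang_def normal_jump_def perp_scaleR)

lemma normal_part_eq:
  assumes t: "t \<in> {0..T}" and \<nu>: "norm \<nu> = 1" "\<nu> \<bullet> G 1 \<theta> t = 0"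
  shows "outer \<nu> \<nu> *v w = normal_part \<theta> t w"
proof -
  have "\<nu> = perp (tang \<theta> t) \<or> \<nu> = - perp (tang \<theta> t)"
    using \<nu> norm_tang[OF t] by (intro orthogonal_unit_cases) (auto simp: tang_def)
  then show ?thesis by (auto simp: outer_mult_vec normal_part_def)
qed

text \<open>Nodal values are O(\<tau>^2). Their differences are O(h \<tau>^2) plus \<tau> times the
  difference of \<eta>; after squaring and dividing by edge lengths the first part sums to
  O(\<tau>^4) because \<open>real J * h\<close> is bounded, and in the second the factor
  \<open>h\<close> of the hypothesis on \<eta> cancels the inverse length. Times, shifts and
  increments are free, so that both curves of a step are covered.\<close>

lemma normal_jump_H1:
  assumes t: "t \<in> {0..T}" "t' \<in> {0..T}" and M: "B \<le> M" and h: "0 < h" and \<tau>: "\<bar>t' - t\<bar> \<le> \<tau>"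
    and len: "\<And>j. j < J \<Longrightarrow> h / M \<le> elen J p j" "\<And>j. j < J \<Longrightarrow> elen J p j \<le> M * h"
    and Jh: "real J * h \<le> M" and a: "\<And>j. j < J \<Longrightarrow> \<bar>a j\<bar> \<le> M * h"
    and nxt: "\<And>j. j < J \<Longrightarrow> \<exists>z. \<theta> j + a j = \<theta> (nxt J j) + of_int z"
    and \<eta>: "\<And>j. j < J \<Longrightarrow> \<bar>\<eta> j\<bar> \<le> M * \<tau>" and \<eta>_sum: "(\<Sum>j<J. (\<eta> (nxt J j) - \<eta> j)\<^sup>2) \<le> M * h * \<tau>\<^sup>2"
  shows "H1_nrm J p (\<lambda>j. normal_part (\<theta> j) t (G 0 (\<theta> j + \<eta> j) t' - G 0 (\<theta> j) t')) \<le> 17 * M^9 * \<tau>\<^sup>2"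
proof -
  have M1: "1 \<le> M" using B M by simp
  have tau0: "0 \<le> \<tau>" using \<tau> by simp
  have MM: "\<tau> \<le> M * \<tau>" using M1 tau0 mult_right_mono[of 1 M \<tau>] by simp
  let ?c = "\<lambda>x y. inverse (norm (G 1 x t)) * normal_jump t t' x y"
  define U where "U x y = ?c x y *\<^sub>R perp (tang x t)" for x y
  define u where "u j = U (\<theta> j) (\<eta> j)" for j
  have prod: "\<bar>y\<bar> * (\<bar>y\<bar> + \<bar>t' - t\<bar>) \<le> 2 * M\<^sup>2 * \<tau>\<^sup>2" if "\<bar>y\<bar> \<le> M * \<tau>" for y
  proof -
    have "\<bar>y\<bar> * (\<bar>y\<bar> + \<bar>t' - t\<bar>) \<le> (M * \<tau>) * (M * \<tau> + M * \<tau>)"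
      using that \<tau> MM by (intro mult_mono add_mono) auto
    then show ?thesis by (simp add: power2_eq_square mult_ac)
  qed
  have NJ: "\<bar>normal_jump t t' x y\<bar> \<le> 2 * M^4 * \<tau>\<^sup>2" if "\<bar>y\<bar> \<le> M * \<tau>" for x y
  proof -
    have "\<bar>normal_jump t t' x y\<bar> \<le> M\<^sup>2 * (2 * M\<^sup>2 * \<tau>\<^sup>2)"
      using B M by (intro order_trans[OF normal_jump_le[OF t]] mult_mono[OF _ prod[OF that]] power_mono) auto
    then show ?thesis by (simp add: power_eq_if)
  qed
  have c: "\<bar>?c x y\<bar> \<le> 2 * M^5 * \<tau>\<^sup>2" if "\<bar>y\<bar> \<le> M * \<tau>" for x y
  proof -
    have "\<bar>?c x y\<bar> \<le> M * (2 * M^4 * \<tau>\<^sup>2)"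
      unfolding abs_mult using NJ[OF that, of x] inverse_norm_le[OF t(1), of x] M M1 by (intro mult_mono) auto
    then show ?thesis by (simp add: power_eq_if)
  qed
  have u_le: "norm (u j) \<le> 2 * M^5 * \<tau>\<^sup>2" if "j < J" for j
    using c[OF \<eta>[OF that], of "\<theta> j"] norm_tang[OF t(1)] by (simp add: u_def U_def)
  have u_diff: "norm (u (nxt J j) - u j) \<le> 10 * M^8 * h * \<tau>\<^sup>2 + 6 * M^4 * \<tau> * \<bar>\<eta> (nxt J j) - \<eta> j\<bar>" if j: "j < J" for j
  proof -
    let ?x = "\<theta> j + a j" and ?y = "\<eta> (nxt J j)" and ?xa = "\<theta> j" and ?ya = "\<eta> j"
    let ?r = "\<lambda>x. inverse (norm (G 1 x t))" and ?N = "normal_jump t t'"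
    have y: "\<bar>?y\<bar> \<le> M * \<tau>" "\<bar>?ya\<bar> \<le> M * \<tau>" using \<eta> j by auto
    have BM: "B\<^sup>2 \<le> M\<^sup>2" "B^3 \<le> M^3" using B M by (auto intro: power_mono)
    obtain z where z: "?x = \<theta> (nxt J j) + of_int z" using nxt[OF j] by blast
    have shift: "?x + ?y = (\<theta> (nxt J j) + ?y) + of_int z" using z by simp
    have "G k ?x t = G k (\<theta> (nxt J j)) t" "G k ?x t' = G k (\<theta> (nxt J j)) t'"
      "G k (?x + ?y) t' = G k (\<theta> (nxt J j) + ?y) t'" for k
      unfolding shift unfolding z by (rule periodic_int[OF t(1)] periodic_int[OF t(2)])+
    then have "U ?x ?y = u (nxt J j)"
      unfolding U_def u_def normal_jump_def tang_def by (simp only:)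
    then have eq: "u (nxt J j) - u j = ?c ?x ?y *\<^sub>R perp (tang ?x t) - ?c ?xa ?ya *\<^sub>R perp (tang ?xa t)"
      by (simp add: U_def u_def)
    have N: "\<bar>?N ?x ?y - ?N ?xa ?ya\<bar> \<le> M\<^sup>2 * (2 * (M * h) * (2 * M\<^sup>2 * \<tau>\<^sup>2) + 2 * \<bar>?y - ?ya\<bar> * (3 * M * \<tau>))"
    proof -
      have "\<bar>?y\<bar> + \<bar>?ya\<bar> + \<bar>t' - t\<bar> \<le> 3 * M * \<tau>" using y \<tau> MM by linarith
      then have "2 * \<bar>?x - ?xa\<bar> * (\<bar>?ya\<bar> * (\<bar>?ya\<bar> + \<bar>t' - t\<bar>)) + 2 * \<bar>?y - ?ya\<bar> * (\<bar>?y\<bar> + \<bar>?ya\<bar> + \<bar>t' - t\<bar>)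
          \<le> 2 * (M * h) * (2 * M\<^sup>2 * \<tau>\<^sup>2) + 2 * \<bar>?y - ?ya\<bar> * (3 * M * \<tau>)"
        using a[OF j] M1 h by (intro add_mono mult_mono[OF _ prod[OF y(2)]] mult_left_mono) auto
      then show ?thesis using BM M1 h tau0
        by (intro order_trans[OF normal_jump_diff[OF t]] mult_mono) auto
    qed
    have "?c ?x ?y - ?c ?xa ?ya = ?r ?x * (?N ?x ?y - ?N ?xa ?ya) + (?r ?x - ?r ?xa) * ?N ?xa ?ya"
      by (simp add: algebra_simps)
    moreover have "\<bar>?r ?x * (?N ?x ?y - ?N ?xa ?ya)\<bar> \<le> M * (M\<^sup>2 * (2 * (M * h) * (2 * M\<^sup>2 * \<tau>\<^sup>2) + 2 * \<bar>?y - ?ya\<bar> * (3 * M * \<tau>)))"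
      unfolding abs_mult[of "?r ?x"] using N inverse_norm_le[OF t(1), of ?x] M M1 by (intro mult_mono) auto
    moreover have "\<bar>(?r ?x - ?r ?xa) * ?N ?xa ?ya\<bar> \<le> (M^3 * (M * h)) * (2 * M^4 * \<tau>\<^sup>2)"
    proof -
      have "B^3 * \<bar>?x - ?xa\<bar> \<le> M^3 * (M * h)" using BM a[OF j] M1 by (intro mult_mono) auto
      then have "\<bar>?r ?x - ?r ?xa\<bar> \<le> M^3 * (M * h)" using inverse_norm_lip[OF t(1), of ?x ?xa] by linarith
      then show ?thesis unfolding abs_mult using NJ[OF y(2)] M1 h by (intro mult_mono) auto
    qed
    ultimately have "\<bar>?c ?x ?y - ?c ?xa ?ya\<bar> \<le> M * (M\<^sup>2 * (2 * (M * h) * (2 * M\<^sup>2 * \<tau>\<^sup>2) + 2 * \<bar>?y - ?ya\<bar> * (3 * M * \<tau>)))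
        + (M^3 * (M * h)) * (2 * M^4 * \<tau>\<^sup>2)" by linarith
    also have "\<dots> = 4 * (M^6 * (h * \<tau>\<^sup>2)) + 6 * M^4 * \<tau> * \<bar>?y - ?ya\<bar> + 2 * (M^8 * (h * \<tau>\<^sup>2))"
      by (simp add: power_eq_if algebra_simps)
    also have "M^6 * (h * \<tau>\<^sup>2) \<le> M^8 * (h * \<tau>\<^sup>2)"
      using M1 h by (intro mult_right_mono power_increasing) auto
    finally have dc: "\<bar>?c ?x ?y - ?c ?xa ?ya\<bar> \<le> 6 * (M^8 * (h * \<tau>\<^sup>2)) + 6 * M^4 * \<tau> * \<bar>?y - ?ya\<bar>" by (simp add: mult_ac)
    have "norm (perp (tang ?x t) - perp (tang ?xa t)) \<le> 2 * B\<^sup>2 * \<bar>?x - ?xa\<bar>"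
      unfolding perp_diff[symmetric] norm_perp by (rule tang_lip[OF t(1)])
    also have "\<dots> \<le> 2 * M\<^sup>2 * (M * h)" using BM a[OF j] by (intro mult_mono) auto
    finally have dq: "norm (perp (tang ?x t) - perp (tang ?xa t)) \<le> 2 * M\<^sup>2 * (M * h)" .
    have "norm (u (nxt J j) - u j) \<le> \<bar>?c ?x ?y - ?c ?xa ?ya\<bar> * 1 + (2 * M^5 * \<tau>\<^sup>2) * (2 * M\<^sup>2 * (M * h))"
      unfolding eq using dq c[OF y(2), of ?xa] norm_tang[OF t(1)] M1
      by (intro order_trans[OF scaleR_diff_le] add_mono mult_mono) auto
    also have "\<dots> = \<bar>?c ?x ?y - ?c ?xa ?ya\<bar> + 4 * (M^8 * (h * \<tau>\<^sup>2))" by (simp add: power_eq_if)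
    finally show ?thesis using dc by simp
  qed
  have pos: "0 < elen J p j" if "j < J" for j
    using len(1)[OF that] h M1 by (smt (verit) divide_pos_pos)
  have "(norm (u (nxt J j) - u j))\<^sup>2 / elen J p j \<le> (M / h) * (200 * M^16 * h\<^sup>2 * \<tau>^4 + 72 * M^8 * \<tau>\<^sup>2 * (\<eta> (nxt J j) - \<eta> j)\<^sup>2)"
    if j: "j < J" for j
  proof -
    let ?P = "10 * M^8 * h * \<tau>\<^sup>2" and ?Q = "6 * M^4 * \<tau> * \<bar>\<eta> (nxt J j) - \<eta> j\<bar>"
    have "(norm (u (nxt J j) - u j))\<^sup>2 \<le> (?P + ?Q)\<^sup>2" using u_diff[OF j] by (intro power_mono) auto
    also have "\<dots> \<le> 2 * ?P\<^sup>2 + 2 * ?Q\<^sup>2"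
      using zero_le_power2[of "?P - ?Q"] by (simp add: power2_sum power2_diff)
    also have "\<dots> = 200 * M^16 * h\<^sup>2 * \<tau>^4 + 72 * M^8 * \<tau>\<^sup>2 * (\<eta> (nxt J j) - \<eta> j)\<^sup>2"
      by (simp add: power_mult_distrib flip: power_mult)
    finally have "(norm (u (nxt J j) - u j))\<^sup>2 / elen J p j \<le> (200 * M^16 * h\<^sup>2 * \<tau>^4 + 72 * M^8 * \<tau>\<^sup>2 * (\<eta> (nxt J j) - \<eta> j)\<^sup>2) / (h / M)"
      using len(1)[OF j] h M1 by (intro frac_le) auto
    then show ?thesis by (simp add: field_simps)
  qed
  then have "(\<Sum>j<J. (norm (u (nxt J j) - u j))\<^sup>2 / elen J p j)
      \<le> (\<Sum>j<J. (M / h) * (200 * M^16 * h\<^sup>2 * \<tau>^4 + 72 * M^8 * \<tau>\<^sup>2 * (\<eta> (nxt J j) - \<eta> j)\<^sup>2))"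
    by (intro sum_mono) auto
  also have "\<dots> = (M / h) * (real J * (200 * M^16 * h\<^sup>2 * \<tau>^4) + 72 * M^8 * \<tau>\<^sup>2 * (\<Sum>j<J. (\<eta> (nxt J j) - \<eta> j)\<^sup>2))"
    unfolding sum_distrib_left[symmetric] sum.distrib by simp
  also have "\<dots> \<le> (M / h) * (h * (200 * M^16 * \<tau>^4 * M) + 72 * M^8 * \<tau>\<^sup>2 * (M * h * \<tau>\<^sup>2))"
  proof (intro mult_left_mono add_mono \<eta>_sum)
    have "real J * (200 * M^16 * h\<^sup>2 * \<tau>^4) = (h * (200 * M^16 * \<tau>^4)) * (real J * h)" by (simp add: power2_eq_square)
    also have "\<dots> \<le> (h * (200 * M^16 * \<tau>^4)) * M" using Jh h M1 by (intro mult_left_mono) auto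
    finally show "real J * (200 * M^16 * h\<^sup>2 * \<tau>^4) \<le> h * (200 * M^16 * \<tau>^4 * M)" by simp
  qed (use M1 h in auto)
  also have "\<dots> = 200 * M^18 * \<tau>^4 + 72 * M^10 * \<tau>^4" using h by (simp add: power_eq_if field_simps)
  finally have D: "(\<Sum>j<J. (norm (u (nxt J j) - u j))\<^sup>2 / elen J p j) \<le> 200 * M^18 * \<tau>^4 + 72 * M^10 * \<tau>^4" .
  have "(\<Sum>j<J. elen J p j) \<le> (\<Sum>j<J. M * h)" using len by (intro sum_mono) auto
  also have "\<dots> = M * (real J * h)" by simp
  also have "\<dots> \<le> M * M" using Jh M1 by (intro mult_left_mono) auto
  finally have L: "(\<Sum>j<J. elen J p j) \<le> M\<^sup>2" by (simp add: power2_eq_square)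
  have "H1_nrm J p u \<le> sqrt (M\<^sup>2 * (2 * M^5 * \<tau>\<^sup>2)\<^sup>2 + (200 * M^18 * \<tau>^4 + 72 * M^10 * \<tau>^4))"
    by (rule H1_nrm_le[OF u_le pos L D])
  also have "\<dots> \<le> sqrt ((17 * M^9 * \<tau>\<^sup>2)\<^sup>2)"
  proof (rule real_sqrt_le_mono)
    have "M\<^sup>2 * (2 * M^5 * \<tau>\<^sup>2)\<^sup>2 + (200 * M^18 * \<tau>^4 + 72 * M^10 * \<tau>^4) = 4 * (M^12 * \<tau>^4) + 200 * (M^18 * \<tau>^4) + 72 * (M^10 * \<tau>^4)"
      by (simp add: power_eq_if)
    also have "M^12 * \<tau>^4 \<le> M^18 * \<tau>^4" using M1 by (intro mult_right_mono power_increasing) auto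
    also have "M^10 * \<tau>^4 \<le> M^18 * \<tau>^4" using M1 by (intro mult_right_mono power_increasing) auto
    \<comment> \<open>289 is the square of 17 and exceeds the total 276 of the coefficients.\<close>
    also have "4 * (M^18 * \<tau>^4) + 200 * (M^18 * \<tau>^4) + 72 * (M^18 * \<tau>^4) \<le> 289 * (M^18 * \<tau>^4)" using M1 by simp
    also have "\<dots> = (17 * M^9 * \<tau>\<^sup>2)\<^sup>2" by (simp add: power_mult_distrib flip: power_mult)
    finally show "M\<^sup>2 * (2 * M^5 * \<tau>\<^sup>2)\<^sup>2 + (200 * M^18 * \<tau>^4 + 72 * M^10 * \<tau>^4) \<le> (17 * M^9 * \<tau>\<^sup>2)\<^sup>2" by simp
  qed
  also have "\<dots> = 17 * M^9 * \<tau>\<^sup>2" using M1 by simp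
  finally show ?thesis unfolding u_def U_def normal_part_jump .
qed

end

section \<open>The jump on the old and on the new projected polygon\<close>

context one_step
begin

text \<open>The constant of \<open>eta_diff_sum\<close>; it also dominates \<open>M\<close> and the
  constant of the pointwise bound for \<eta>.\<close>

definition C :: real where "C = 300000000 * M^25"

lemma C_ge: "B \<le> C" "M0 \<le> C" "M \<le> C" "27 * M^9 \<le> C" "0 < C"
proof -
  have M1: "1 \<le> M" using M_ge(1) by simp
  have "M^k \<le> M^25" if "k \<le> 25" for k using that M1 by (rule power_increasing)
  from this[of 1] this[of 9] have "M \<le> M^25" "M^9 \<le> M^25" by auto
  moreover have "0 \<le> M^25" using M1 by simp
  ultimately show M: "M \<le> C" "27 * M^9 \<le> C" unfolding C_def by linarith+
  then show "B \<le> C" "M0 \<le> C" "0 < C" using M_ge(1-3) B M0 by linarith+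
qed

lemma len_C: assumes "h / M0 \<le> y" "y \<le> M0 * h" shows "h / C \<le> y" "y \<le> C * h"
proof -
  have "h / C \<le> h / M0" using C_ge M0 h by (intro divide_left_mono) auto
  then show "h / C \<le> y" using assms by linarith
  have "M0 * h \<le> C * h" using C_ge h by (intro mult_right_mono) auto
  then show "y \<le> C * h" using assms by linarith
qed

lemma eta_C: assumes "j < J" shows "\<bar>\<eta> j\<bar> \<le> C * \<tau>"
proof -
  have "27 * M^9 * \<tau> \<le> C * \<tau>" using C_ge(4) tau_pos by (intro mult_right_mono) auto
  then show ?thesis using eta_le[OF assms] by linarith
qed

lemma eta_sum_C: "(\<Sum>j<J. (\<eta> (nxt J j) - \<eta> j)\<^sup>2) \<le> C * h * \<tau>\<^sup>2"
  using eta_diff_sum by (simp add: C_def)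

lemma Jh_C: "real J * h \<le> C" using Jh(2) C_ge(3) by linarith

lemma normal_jump_at_old_curve:
  "H1_nrm J p (\<lambda>j. normal_part (\<theta> j) t (G 0 (\<theta> j + \<eta> j) t' - G 0 (\<theta> j) t')) \<le> 17 * C^9 * \<tau>\<^sup>2"
proof (rule normal_jump_H1[OF times(1,2) C_ge(1) h _ _ _ Jh_C _ _ eta_C eta_sum_C])
  show "\<bar>t' - t\<bar> \<le> \<tau>" using tau_pos by simp
  fix j assume j: "j < J"
  show "h / C \<le> elen J p j" "elen J p j \<le> C * h" using len_C len j by auto
  have "M / 300 * h \<le> C * h" using C_ge M_ge(1) h by (intro mult_right_mono) auto
  then show "\<bar>a j\<bar> \<le> C * h" using a_le(2)[OF j] by linarith
  show "\<exists>z. \<theta> j + a j = \<theta> (nxt J j) + of_int z" using theta_nxt[OF j] by metis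
qed

text \<open>The same estimate with both times equal to \<open>t'\<close>, base points at the new
  projected nodes and shifts \<open>- \<eta> j\<close> back to the transported ones. Arc increments
  become \<open>a j\<close> plus the difference of \<eta>, still O(h); the edge lengths of the new
  polygon enter as a hypothesis.\<close>

lemma normal_jump_at_new_curve:
  assumes len': "\<And>j. j < J \<Longrightarrow> h / M0 \<le> elen J p' j" "\<And>j. j < J \<Longrightarrow> elen J p' j \<le> M0 * h"
  shows "H1_nrm J p' (\<lambda>j. normal_part (\<theta> j + \<eta> j) t' (G 0 (\<theta> j) t' - G 0 (\<theta> j + \<eta> j) t')) \<le> 17 * C^9 * \<tau>\<^sup>2"
proof -
  have "H1_nrm J p' (\<lambda>j. normal_part (\<theta> j + \<eta> j) t' (G 0 ((\<theta> j + \<eta> j) + (- \<eta> j)) t' - G 0 (\<theta> j + \<eta> j) t')) \<le> 17 * C^9 * \<tau>\<^sup>2"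
  proof (rule normal_jump_H1[OF times(2,2) C_ge(1) h _ _ _ Jh_C])
    show "\<bar>t' - t'\<bar> \<le> \<tau>" using tau_pos by simp
    show "(\<Sum>j<J. (- \<eta> (nxt J j) - - \<eta> j)\<^sup>2) \<le> C * h * \<tau>\<^sup>2"
      using eta_sum_C by (simp add: power2_commute)
    fix j assume j: "j < J"
    then have i: "nxt J j < J" by simp
    show "h / C \<le> elen J p' j" "elen J p' j \<le> C * h" using len_C len' j by auto
    show "\<bar>- \<eta> j\<bar> \<le> C * \<tau>" using eta_C[OF j] by simp
    show "\<bar>a j + (\<eta> (nxt J j) - \<eta> j)\<bar> \<le> C * h"
    proof -
      have "\<bar>a j + (\<eta> (nxt J j) - \<eta> j)\<bar> \<le> M / 300 * h + 54 * (M^9 * \<tau>)"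
        using a_le(2)[OF j] eta_le[OF j] eta_le[OF i] by linarith
      also have "\<dots> \<le> M / 300 * h + h" using tau_h[of 9] h by simp
      also have "\<dots> = (M / 300 + 1) * h" by (simp add: algebra_simps)
      also have "\<dots> \<le> C * h" using C_ge(3) M_ge(1) h by (intro mult_right_mono) auto
      finally show ?thesis .
    qed
    obtain z where z: "\<theta> j + a j = \<theta> (nxt J j) + of_int z" using theta_nxt[OF j] .
    then show "\<exists>z. \<theta> j + \<eta> j + (a j + (\<eta> (nxt J j) - \<eta> j)) = \<theta> (nxt J j) + \<eta> (nxt J j) + of_int z"
      by (intro exI[of _ z]) simp
  qed
  then show ?thesis by simp
qed

end

section \<open>From the exact flow to one step\<close>

text \<open>All bounds come from compactness of one period times the time interval. Only the chord
  condition needs two regimes: linearization for close parameters, and a positive minimum of the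
  chord length for separated ones.\<close>

lemma exact_flow_curve:
  assumes T: "0 < T" and flow: "exact_flow T \<delta> c X n H v kap"
  obtains B G where "evolving_curve T B G" "\<And>\<theta> t. G 0 \<theta> t = X (c \<theta>) t"
    "\<And>\<theta> t. t \<in> {0..T} \<Longrightarrow> norm (n t (G 0 \<theta> t)) = 1 \<and> n t (G 0 \<theta> t) \<bullet> G 1 \<theta> t = 0"
    "\<And>t. t \<in> {0..T} \<Longrightarrow> inj_on (\<lambda>p. X p t) (range c)"
proof -
  have "smooth_family T (\<lambda>\<theta> t. X (c \<theta>) t)" using flow by (simp add: exact_flow_def)
  then obtain D where D: "D 0 0 = (\<lambda>\<theta> t. X (c \<theta>) t) \<and>
       (\<forall>i j. continuous_on (UNIV \<times> {0..T}) (\<lambda>(\<theta>, t). D i j \<theta> t) \<and>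
         (\<forall>\<theta>. \<forall>t\<in>{0..T}.
            ((\<lambda>\<theta>'. D i j \<theta>' t) has_vector_derivative D (Suc i) j \<theta> t) (at \<theta>) \<and>
            ((\<lambda>t'. D i j \<theta> t') has_vector_derivative D i (Suc j) \<theta> t) (at t within {0..T})))"
    unfolding smooth_family_def by (elim exE)
  then have D0: "D 0 0 = (\<lambda>\<theta> t. X (c \<theta>) t)"
    and cont: "\<And>i j. continuous_on (UNIV \<times> {0..T}) (\<lambda>(\<theta>, t). D i j \<theta> t)"
    and d\<theta>: "\<And>i j \<theta> t. t \<in> {0..T} \<Longrightarrow> ((\<lambda>\<theta>'. D i j \<theta>' t) has_vector_derivative D (Suc i) j \<theta> t) (at \<theta>)"
    and dt: "\<And>i j \<theta> t. t \<in> {0..T} \<Longrightarrow> ((\<lambda>t'. D i j \<theta> t') has_vector_derivative D i (Suc j) \<theta> t) (at t within {0..T})"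
    by auto
  have c_per: "c (\<theta> + 1) = c \<theta>" and c_inj: "c \<theta> = c \<theta>' \<Longrightarrow> \<theta> - \<theta>' \<in> \<int>" for \<theta> \<theta>'
    using flow unfolding exact_flow_def by blast+
  have inj: "inj_on (\<lambda>p. X p t) (range c)"
    and nz: "vector_derivative (\<lambda>\<theta>. X (c \<theta>) t) (at \<theta>) \<noteq> 0"
    and normal: "outward_unit_normal (curve_at c X t) (vector_derivative (\<lambda>\<theta>. X (c \<theta>) t) (at \<theta>)) (X (c \<theta>) t) (n t (X (c \<theta>) t))"
    if "t \<in> {0..T}" for t \<theta>
    using flow that unfolding exact_flow_def Let_def by blast+
  define G where "G k = D k 0" for k
  have G0: "G 0 \<theta> t = X (c \<theta>) t" for \<theta> t by (simp add: G_def D0)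
  have der: "((\<lambda>\<theta>. G k \<theta> t) has_vector_derivative G (Suc k) \<theta> t) (at \<theta>)" if "t \<in> {0..T}" for k \<theta> t
    using d\<theta>[OF that] by (simp add: G_def)
  have G1: "vector_derivative (\<lambda>\<theta>. X (c \<theta>) t) (at \<theta>) = G 1 \<theta> t" if "t \<in> {0..T}" for \<theta> t
    using vector_derivative_at[OF der[OF that, of 0 \<theta>]] by (simp add: G0)
  have per1: "G k (\<theta> + 1) t = G k \<theta> t" if t: "t \<in> {0..T}" for k \<theta> t
  proof (induction k arbitrary: \<theta>)
    case 0
    then show ?case by (simp add: G0 c_per)
  next
    case (Suc k)
    have "((\<lambda>x. G k (1 + 1 * x) t) has_vector_derivative 1 *\<^sub>R G (Suc k) (1 + 1 * \<theta>) t) (at \<theta>)"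
      by (rule affine_vector_chain[OF der[OF t]])
    then have "((\<lambda>x. G k x t) has_vector_derivative G (Suc k) (\<theta> + 1) t) (at \<theta>)"
      by (simp add: add.commute[of 1] Suc.IH)
    then show ?case using vector_derivative_unique_at der[OF t] by blast
  qed
  have per: "G k \<theta> t = G k (frac \<theta>) t" if "t \<in> {0..T}" for k \<theta> t
    using periodic_of_int[of "\<lambda>\<theta>. G k \<theta> t" "frac \<theta>" "\<lfloor>\<theta>\<rfloor>"] per1[OF that] by (simp add: frac_def)
  have frac01: "frac \<theta> \<in> {0..1}" for \<theta> :: real using frac_lt_1[of \<theta>] by (simp add: less_imp_le)
  have "\<exists>b. \<forall>\<theta>\<in>{0..1}. \<forall>t\<in>{0..T}. norm (D i j \<theta> t) \<le> b" for i j
  proof -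
    have "compact ((\<lambda>(\<theta>, t). D i j \<theta> t) ` ({0..1} \<times> {0..T}))"
      by (intro compact_continuous_image continuous_on_subset[OF cont] compact_Times) auto
    then obtain b where "\<forall>y\<in>(\<lambda>(\<theta>, t). D i j \<theta> t) ` ({0..1} \<times> {0..T}). norm y \<le> b"
      using compact_imp_bounded bounded_iff by metis
    then show ?thesis by (intro exI[of _ b]) auto
  qed
  then obtain b where b: "\<And>i j \<theta> t. \<theta> \<in> {0..1} \<Longrightarrow> t \<in> {0..T} \<Longrightarrow> norm (D i j \<theta> t) \<le> b i j" by metis
  have "\<exists>x\<in>{0..1} \<times> {0..T}. \<forall>y\<in>{0..1} \<times> {0..T}. (\<lambda>(\<theta>, t). norm (G 1 \<theta> t)) x \<le> (\<lambda>(\<theta>, t). norm (G 1 \<theta> t)) y"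
  proof (rule continuous_attains_inf)
    have "continuous_on ({0..1} \<times> {0..T}) (\<lambda>(\<theta>, t). G 1 \<theta> t)"
      unfolding G_def by (rule continuous_on_subset[OF cont]) auto
    from continuous_on_norm[OF this]
    show "continuous_on ({0..1} \<times> {0..T}) (\<lambda>(\<theta>, t). norm (G 1 \<theta> t))"
      by (simp add: case_prod_unfold)
  qed (use T in \<open>auto intro: compact_Times\<close>)
  then obtain z1 where z1: "z1 \<in> {0..1} \<times> {0..T}"
    "\<And>y. y \<in> {0..1} \<times> {0..T} \<Longrightarrow> (\<lambda>(\<theta>, t). norm (G 1 \<theta> t)) z1 \<le> (\<lambda>(\<theta>, t). norm (G 1 \<theta> t)) y" by blast
  define \<theta>1 t1 where "\<theta>1 = fst z1" and "t1 = snd z1"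
  have min1: "t1 \<in> {0..T}"
    "\<And>\<theta> t. \<theta> \<in> {0..1} \<Longrightarrow> t \<in> {0..T} \<Longrightarrow> norm (G 1 \<theta>1 t1) \<le> norm (G 1 \<theta> t)"
    using z1(1) z1(2)[of "(_, _)"] by (auto simp: \<theta>1_def t1_def case_prod_unfold)
  define \<rho> where "\<rho> = norm (G 1 \<theta>1 t1)"
  have \<rho>: "0 < \<rho>" using nz[OF min1(1)] G1[OF min1(1)] by (simp add: \<rho>_def)
  define B1 where "B1 = 1 + 1 / \<rho> + (\<Sum>i\<le>3. \<bar>b i 0\<bar>) + (\<Sum>i\<le>2. \<bar>b i 1\<bar>)"
  have b_le: "b i 0 \<le> B1" if "i \<le> 3" for i
  proof -
    have "\<bar>b i 0\<bar> \<le> (\<Sum>i\<le>3. \<bar>b i 0\<bar>)" using that by (intro member_le_sum) auto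
    moreover have "0 \<le> (\<Sum>i\<le>2. \<bar>b i 1\<bar>)" by (simp add: sum_nonneg)
    moreover have "0 \<le> 1 / \<rho>" using \<rho> by simp
    ultimately show ?thesis unfolding B1_def by linarith
  qed
  have b_le': "b i 1 \<le> B1" if "i \<le> 2" for i
  proof -
    have "\<bar>b i 1\<bar> \<le> (\<Sum>i\<le>2. \<bar>b i 1\<bar>)" using that by (intro member_le_sum) auto
    moreover have "0 \<le> (\<Sum>i\<le>3. \<bar>b i 0\<bar>)" by (simp add: sum_nonneg)
    moreover have "0 \<le> 1 / \<rho>" using \<rho> by simp
    ultimately show ?thesis unfolding B1_def by linarith
  qed
  have B1: "1 \<le> B1" "1 / \<rho> \<le> B1"
  proof -
    have "0 \<le> (\<Sum>i\<le>3. \<bar>b i 0\<bar>)" "0 \<le> (\<Sum>i\<le>2. \<bar>b i 1\<bar>)" by (auto simp: sum_nonneg)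
    moreover have "0 \<le> 1 / \<rho>" using \<rho> by simp
    ultimately show "1 \<le> B1" "1 / \<rho> \<le> B1" unfolding B1_def by linarith+
  qed
  have bound1: "norm (G k \<theta> t) \<le> B1" if "k \<le> 3" "t \<in> {0..T}" for k \<theta> t
    using b[OF frac01 that(2), of k 0 \<theta>] b_le[OF that(1)] per[OF that(2), of k \<theta>] by (simp add: G_def)
  have time1: "norm (G k \<theta> t' - G k \<theta> t) \<le> B1 * \<bar>t' - t\<bar>" if k: "k \<le> 2" and t: "t \<in> {0..T}" "t' \<in> {0..T}" for k \<theta> t t'
  proof -
    have "norm (D k 0 (frac \<theta>) t' - D k 0 (frac \<theta>) t) \<le> B1 * norm (t' - t)"
    proof (rule differentiable_bound[of "{0..T}" _ "\<lambda>s h. h *\<^sub>R D k 1 (frac \<theta>) s"])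
      fix s assume s: "s \<in> {0..T}"
      show "((\<lambda>s. D k 0 (frac \<theta>) s) has_derivative (\<lambda>h. h *\<^sub>R D k 1 (frac \<theta>) s)) (at s within {0..T})"
        using dt[OF s, of k 0 "frac \<theta>"] by (simp add: has_vector_derivative_def)
      have "norm (D k 1 (frac \<theta>) s) \<le> B1" using b[OF frac01 s, of k 1 \<theta>] b_le'[OF k] by linarith
      then show "onorm (\<lambda>h. h *\<^sub>R D k 1 (frac \<theta>) s) \<le> B1"
        by (intro onorm_le) (simp add: mult.commute[of B1] mult_left_mono)
    qed (use t in auto)
    then show ?thesis using per[OF t(1), of k \<theta>] per[OF t(2), of k \<theta>] by (simp add: G_def)
  qed
  have regular1: "1 / B1 \<le> norm (G 1 \<theta> t)" if "t \<in> {0..T}" for \<theta> t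
  proof -
    have "1 / B1 \<le> \<rho>" using B1 \<rho> by (simp add: field_simps)
    also have "\<dots> \<le> norm (G 1 \<theta> t)" using min1(2)[OF frac01 that, of \<theta>] per[OF that, of 1 \<theta>] by (simp add: \<rho>_def)
    finally show ?thesis .
  qed
  \<comment> \<open>At distance up to \<open>r\<close> the quadratic remainder costs at most half of
    the linear term.\<close>
  define r where "r = 1 / (2 * B1\<^sup>2)"
  have "1 \<le> B1\<^sup>2" using B1 by (simp add: power2_eq_square mult_ge1_I)
  then have r: "0 < r" "r \<le> 1 / 2" by (auto simp: r_def divide_simps)
  have near: "\<bar>x - y\<bar> \<le> 2 * B1 * norm (G 0 x t - G 0 y t)" if t: "t \<in> {0..T}" and xy: "\<bar>x - y\<bar> \<le> r" for x y t
  proof -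
    have "norm (G 0 x t - G 0 y t - (x - y) *\<^sub>R G (Suc 0) y t) \<le> B1 * (x - y)\<^sup>2"
    proof (rule vector_linearization_bound[OF der[OF t]])
      fix x y
      show "norm (G (Suc 0) x t - G (Suc 0) y t) \<le> B1 * \<bar>x - y\<bar>"
        using der[OF t, of "Suc 0"] bound1[OF _ t, of "Suc (Suc 0)"]
        by (intro vector_mean_value_bound[where f = "\<lambda>\<theta>. G (Suc 0) \<theta> t"]) auto
    qed (use B1 in simp)
    then have "norm ((x - y) *\<^sub>R G 1 y t) \<le> norm (G 0 x t - G 0 y t) + B1 * (x - y)\<^sup>2"
      using norm_triangle_ineq2[of "(x - y) *\<^sub>R G 1 y t" "G 0 x t - G 0 y t"] by (simp add: norm_minus_commute)
    moreover have "\<bar>x - y\<bar> * (1 / B1) \<le> norm ((x - y) *\<^sub>R G 1 y t)"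
      unfolding norm_scaleR real_norm_def using regular1[OF t] by (intro mult_left_mono) auto
    moreover have "B1 * (x - y)\<^sup>2 \<le> \<bar>x - y\<bar> * (1 / B1) / 2"
    proof -
      have "B1 * (x - y)\<^sup>2 = \<bar>x - y\<bar> * (B1 * \<bar>x - y\<bar>)" by (simp add: power2_eq_square)
      also have "\<dots> \<le> \<bar>x - y\<bar> * (B1 * r)" using xy B1 by (intro mult_left_mono) auto
      also have "B1 * r = 1 / B1 / 2" using B1 by (simp add: r_def power2_eq_square)
      finally show ?thesis by simp
    qed
    ultimately have "\<bar>x - y\<bar> * (1 / B1) / 2 \<le> norm (G 0 x t - G 0 y t)" by linarith
    then have "\<bar>x - y\<bar> / (2 * B1) \<le> norm (G 0 x t - G 0 y t)" by (simp add: mult.commute)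
    then show ?thesis using B1 by (simp add: pos_divide_le_eq mult.commute)
  qed
  let ?f = "\<lambda>z. norm (D 0 0 (fst z + fst (snd z)) (snd (snd z)) - D 0 0 (fst z) (snd (snd z)))"
  let ?K = "{0..1} \<times> {r..1/2} \<times> {0..T} :: (real \<times> real \<times> real) set"
  have "\<exists>x\<in>?K. \<forall>y\<in>?K. ?f x \<le> ?f y"
  proof (rule continuous_attains_inf)
    show "continuous_on ?K ?f"
    proof (intro continuous_on_norm continuous_on_diff)
      have "continuous_on ?K (\<lambda>z. (\<lambda>(\<theta>, t). D 0 0 \<theta> t) (fst z + fst (snd z), snd (snd z)))"
        by (rule continuous_on_compose2[OF cont[of 0 0]]) (auto intro!: continuous_intros)
      then show "continuous_on ?K (\<lambda>z. D 0 0 (fst z + fst (snd z)) (snd (snd z)))" by simp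
      have "continuous_on ?K (\<lambda>z. (\<lambda>(\<theta>, t). D 0 0 \<theta> t) (fst z, snd (snd z)))"
        by (rule continuous_on_compose2[OF cont[of 0 0]]) (auto intro!: continuous_intros)
      then show "continuous_on ?K (\<lambda>z. D 0 0 (fst z) (snd (snd z)))" by simp
    qed
  qed (use T r in \<open>auto intro!: compact_Times\<close>)
  then obtain z where z: "z \<in> ?K" "\<And>y. y \<in> ?K \<Longrightarrow> ?f z \<le> ?f y" by blast
  define \<mu> where "\<mu> = ?f z"
  have \<mu>: "0 < \<mu>"
  proof -
    obtain \<theta> \<eta> t where zt: "z = (\<theta>, \<eta>, t)" by (cases z)
    have t: "t \<in> {0..T}" and \<eta>: "r \<le> \<eta>" "\<eta> \<le> 1 / 2" using z(1) zt by auto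
    \<comment> \<open>Equality would make \<eta> an integer by injectivity of the flow map and of
      \<open>c\<close> modulo one, but \<eta> lies between \<open>r\<close> and 1/2.\<close>
    have "X (c (\<theta> + \<eta>)) t \<noteq> X (c \<theta>) t"
    proof
      assume "X (c (\<theta> + \<eta>)) t = X (c \<theta>) t"
      then have "c (\<theta> + \<eta>) = c \<theta>" using inj_onD[OF inj[OF t]] by blast
      then have "\<eta> \<in> \<int>" using c_inj[of "\<theta> + \<eta>" \<theta>] by simp
      then obtain k :: int where "\<eta> = of_int k" by (auto elim: Ints_cases)
      then have "0 < k" "real_of_int k \<le> 1 / 2" using \<eta> r by auto
      then show False by linarith
    qed
    then show ?thesis by (simp add: \<mu>_def zt D0)
  qed
  have far: "\<mu> \<le> norm (G 0 (\<theta> + \<eta>) t - G 0 \<theta> t)" if t: "t \<in> {0..T}" and \<eta>: "r \<le> \<eta>" "\<eta> \<le> 1 / 2" for \<theta> \<eta> t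
  proof -
    have "\<mu> \<le> ?f (frac \<theta>, \<eta>, t)" unfolding \<mu>_def using t \<eta> frac01 by (intro z(2)) auto
    also have "\<dots> = norm (G 0 (frac \<theta> + \<eta>) t - G 0 (frac \<theta>) t)" by (simp add: G_def)
    also have "G 0 (frac \<theta> + \<eta>) t = G 0 (frac \<theta> + \<eta> + of_int \<lfloor>\<theta>\<rfloor>) t"
      using periodic_of_int[of "\<lambda>\<theta>. G 0 \<theta> t" "frac \<theta> + \<eta>" "\<lfloor>\<theta>\<rfloor>"] per1[OF t] by simp
    also have "frac \<theta> + \<eta> + of_int \<lfloor>\<theta>\<rfloor> = \<theta> + \<eta>" by (simp add: frac_def)
    also have "G 0 (frac \<theta>) t = G 0 \<theta> t" using per[OF t] by simp
    finally show ?thesis .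
  qed
  define B where "B = max (2 * B1) (1 / \<mu>)"
  have BB: "B1 \<le> B" "2 * B1 \<le> B" "1 / \<mu> \<le> B" using B1 by (auto simp: B_def)
  have "evolving_curve T B G"
  proof
    show "1 \<le> B" using BB B1 by simp
    show "((\<lambda>\<theta>. G k \<theta> t) has_vector_derivative G (Suc k) \<theta> t) (at \<theta>)" if "t \<in> {0..T}" for k \<theta> t
      by (rule der[OF that])
    show "norm (G k \<theta> t) \<le> B" if "k \<le> 3" "t \<in> {0..T}" for k \<theta> t
      using bound1[OF that, of \<theta>] BB by linarith
    show "norm (G k \<theta> t' - G k \<theta> t) \<le> B * \<bar>t' - t\<bar>" if "k \<le> 2" "t \<in> {0..T}" "t' \<in> {0..T}" for k \<theta> t t'
      using time1[OF that, of \<theta>] mult_right_mono[OF BB(1), of "\<bar>t' - t\<bar>"] by linarith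
    show "1 / B \<le> norm (G 1 \<theta> t)" if "t \<in> {0..T}" for \<theta> t
    proof -
      have "1 / B \<le> 1 / B1" using BB B1 by (intro divide_left_mono) auto
      then show ?thesis using regular1[OF that, of \<theta>] by linarith
    qed
    show "G k (\<theta> + 1) t = G k \<theta> t" if "t \<in> {0..T}" for k \<theta> t by (rule per1[OF that])
    show "\<bar>x - y\<bar> \<le> B * norm (G 0 x t - G 0 y t)" if t: "t \<in> {0..T}" and xy: "\<bar>x - y\<bar> \<le> 1 / 2" for x y t
    proof (cases "\<bar>x - y\<bar> \<le> r")
      case True
      then show ?thesis using near[OF t True] mult_right_mono[OF BB(2) norm_ge_zero[of "G 0 x t - G 0 y t"]] by linarith
    next
      case False
      have "\<mu> \<le> norm (G 0 (min x y + \<bar>x - y\<bar>) t - G 0 (min x y) t)" using False xy by (intro far[OF t]) auto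
      also have "\<dots> = norm (G 0 x t - G 0 y t)"
        by (cases "x \<le> y") (auto simp: min_def norm_minus_commute)
      finally have "1 / \<mu> * \<mu> \<le> B * norm (G 0 x t - G 0 y t)" using BB B1 \<mu> by (intro mult_mono) (linarith | simp)+
      then show ?thesis using \<mu> xy by simp
    qed
  qed
  moreover have "norm (n t (G 0 \<theta> t)) = 1 \<and> n t (G 0 \<theta> t) \<bullet> G 1 \<theta> t = 0" if "t \<in> {0..T}" for \<theta> t
    using normal[OF that, of \<theta>] G1[OF that, of \<theta>] by (simp add: outward_unit_normal_def G0)
  ultimately show ?thesis using that G0 inj by blast
qed

lemma standing_level:
  assumes std: "standing_assumptions T c X c0 cq Cq Csh h \<tau> l J x \<nu>" and mesh: "mesh_const c X \<tau> J x l \<le> Kl"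
    and h1: "h \<le> 1" and m: "m \<le> l" and cq: "0 < cq" and Cq: "0 < Cq"
  defines "p \<equiv> proj_nodes c X \<tau> x m"
  shows "real m * \<tau> \<in> {0..T}" "real (Suc m) * \<tau> \<in> {0..T}" "0 < \<tau>" "0 < h" "\<tau> \<le> c0 * h\<^sup>2"
    "simple_polygon J (x m)" "simple_polygon J p" "outward_edge_normals J (x m) (\<nu> m)"
    "scheme_step J \<tau> (x m) (\<nu> m) (x (Suc m))"
    "inj_on (retr c X \<tau> m) (polygon J p)"
    "\<And>j. j < J \<Longrightarrow> elen J p j \<le> \<bar>Kl\<bar> * Cq * h" "\<And>j. j < J \<Longrightarrow> cq * h \<le> \<bar>Kl\<bar> * elen J p j"
    "\<And>j. j < J \<Longrightarrow> norm (x m j - p j) \<le> h"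
    "\<And>j. j < J \<Longrightarrow> norm ((x m (nxt J j) - p (nxt J j)) - (x m j - p j)) \<le> h * elen J p j"
    "(\<Sum>j<J. (norm ((x m (nxt J j) - p (nxt J j)) - (x m j - p j)))\<^sup>2 / elen J p j) \<le> h^3"
proof -
  note s = std[unfolded standing_assumptions_def]
  show tau: "0 < \<tau>" and h: "0 < h" and "\<tau> \<le> c0 * h\<^sup>2" using s by auto
  have "simple_polygon J (x m) \<and> outward_edge_normals J (x m) (\<nu> m) \<and>
        scheme_step J \<tau> (x m) (\<nu> m) (x (Suc m)) \<and> simple_polygon J p \<and>
        bij_betw (retr c X \<tau> m) (polygon J p) (curve_at c X (real m * \<tau>)) \<and> induction_hyp c X h \<tau> J x m"
    using s m unfolding p_def by blast
  then show sx: "simple_polygon J (x m)" and sp: "simple_polygon J p" and "outward_edge_normals J (x m) (\<nu> m)"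
    "scheme_step J \<tau> (x m) (\<nu> m) (x (Suc m))" "inj_on (retr c X \<tau> m) (polygon J p)"
    by (auto simp: bij_betw_def)
  \<comment> \<open>The last admissible level is one below the number of steps, so the curve reached
    by the last step still lies in the time interval.\<close>
  have "real (Suc l) \<le> T / \<tau>" using s by linarith
  then have "real (Suc l) * \<tau> \<le> T" using tau by (simp add: pos_le_divide_eq)
  moreover have "real (Suc m) * \<tau> \<le> real (Suc l) * \<tau>"
    using m tau by (intro mult_right_mono) auto
  ultimately have *: "real (Suc m) * \<tau> \<le> T" by linarith
  have m_le: "real m * \<tau> \<le> real (Suc m) * \<tau>" using tau by (intro mult_right_mono) auto
  show "real m * \<tau> \<in> {0..T}" unfolding atLeastAtMost_iff using tau by (intro conjI order_trans[OF m_le *]) simp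
  show "real (Suc m) * \<tau> \<in> {0..T}" unfolding atLeastAtMost_iff using * tau by (intro conjI) simp
  have pp: "0 < elen J p j" if "j < J" for j by (rule simple_polygon_elen_pos[OF sp that])
  have "simple_polygon J (x 0)" using s by blast
  then have p0: "0 < elen J (x 0) j" if "j < J" for j by (rule simple_polygon_elen_pos[OF _ that])
  have J: "0 < J" using sx by (simp add: simple_polygon_def)
  have Linf0: "0 \<le> Linf_nrm J u" for u using Linf_nrm_ge[OF J, of u] norm_ge_zero[of "u 0"] by linarith
  have W0: "0 \<le> W1inf_nrm J q u" for q u using Linf0[of u] by (simp add: W1inf_nrm_def)
  have "W1inf_nrm J (x 0) p + W1inf_nrm J p (x 0) \<le> mesh_const c X \<tau> J x l"
    unfolding mesh_const_def p_def using m by (intro Max_ge) auto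
  then have K: "W1inf_nrm J (x 0) p \<le> \<bar>Kl\<bar>" "W1inf_nrm J p (x 0) \<le> \<bar>Kl\<bar>"
    using mesh W0[of "x 0" p] W0[of p "x 0"] by linarith+
  fix j assume j: "j < J"
  have l0: "cq * h \<le> elen J (x 0) j" "elen J (x 0) j \<le> Cq * h" using s j by auto
  have el: "elen J q j = norm (q (nxt J j) - q j)" for q by (simp add: elen_def dist_norm norm_minus_commute)
  \<comment> \<open>Edges of the projected polygon are increments of the map from the initial
    polygon, so its gradient bounds them above; the gradient of the inverse map gives the lower
    bound below.\<close>
  have "elen J p j \<le> W1inf_nrm J (x 0) p * elen J (x 0) j" using W1inf_nrm_ge[OF j p0[OF j], of p] by (simp add: el)
  also have "\<dots> \<le> \<bar>Kl\<bar> * (Cq * h)" using K l0 p0[OF j] by (intro mult_mono) auto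
  finally show "elen J p j \<le> \<bar>Kl\<bar> * Cq * h" by simp
  have "elen J (x 0) j \<le> W1inf_nrm J p (x 0) * elen J p j" using W1inf_nrm_ge[OF j pp[OF j], of "x 0"] by (simp add: el)
  also have "\<dots> \<le> \<bar>Kl\<bar> * elen J p j" using K pp[OF j] by (intro mult_right_mono) auto
  finally show "cq * h \<le> \<bar>Kl\<bar> * elen J p j" using l0 by linarith
next
  note s = std[unfolded standing_assumptions_def]
  have h: "0 < h" using s by auto
  have sp: "simple_polygon J p" and ih: "induction_hyp c X h \<tau> J x m" using s m unfolding p_def by blast+
  have pp: "0 < elen J p j" if "j < J" for j by (rule simple_polygon_elen_pos[OF sp that])
  have J: "0 < J" using sp by (simp add: simple_polygon_def)
  have Linf0: "0 \<le> Linf_nrm J u" for u using Linf_nrm_ge[OF J, of u] norm_ge_zero[of "u 0"] by linarith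
  have W0: "0 \<le> W1inf_nrm J q u" for q u using Linf0[of u] by (simp add: W1inf_nrm_def)
  define e where "e = proj_err c X \<tau> x m"
  define e' where "e' = traj_err c X \<tau> x m"
  have e: "e j = x m j - p j" for j by (simp add: e_def p_def proj_err_def)
  have "L2_nrm J p e + L2_nrm J p e' + Linf_nrm J e + Linf_nrm J e' + H1_nrm J p e + H1_nrm J p e'
      + h powr (1/2) * (W1inf_nrm J p e + W1inf_nrm J p e') \<le> h powr (7/4)"
    using ih unfolding induction_hyp_def Let_def p_def e_def e'_def .
  moreover have "0 \<le> h powr (1/2) * W1inf_nrm J p e" "0 \<le> h powr (1/2) * W1inf_nrm J p e'"
    using W0 by simp_all
  ultimately have b: "Linf_nrm J e \<le> h powr (7/4)" "H1_nrm J p e \<le> h powr (7/4)"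
      "h powr (1/2) * W1inf_nrm J p e \<le> h powr (7/4)"
    using L2_nrm_nonneg[of J p e] L2_nrm_nonneg[of J p e'] Linf0[of e] Linf0[of e'] H1_nrm_nonneg[of J p e] H1_nrm_nonneg[of J p e']
    unfolding distrib_left by linarith+
  have pw: "h powr y \<le> h powr x" if "x \<le> y" for x y
    using that h h1 by (intro powr_mono') auto
  \<comment> \<open>Removing the weight would leave exponent 5/4; a single power of \<open>h\<close>
    is enough here.\<close>
  have "h powr (1/2) * W1inf_nrm J p e \<le> h powr (1/2) * h"
  proof -
    have "h powr (7/4) \<le> h powr (1/2 + 1)" by (rule pw) simp
    also have "\<dots> = h powr (1/2) * h" unfolding powr_add using h by simp
    finally show ?thesis using b(3) by linarith
  qed
  then have W: "W1inf_nrm J p e \<le> h" using h by simp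
  \<comment> \<open>The square has exponent 7/2, of which 3 is kept; this is the bound from which
    \<open>n_sum\<close> is derived.\<close>
  have "(H1_nrm J p e)\<^sup>2 \<le> (h powr (7/4))\<^sup>2" using b(2) H1_nrm_nonneg by (intro power_mono) auto
  also have "\<dots> = h powr (7/2)" using h by (simp add: powr_powr flip: powr_numeral)
  also have "\<dots> \<le> h powr 3" by (rule pw) simp
  also have "\<dots> = h^3" using h by (simp flip: powr_numeral)
  finally show "(\<Sum>j<J. (norm ((x m (nxt J j) - p (nxt J j)) - (x m j - p j)))\<^sup>2 / elen J p j) \<le> h^3"
    using H1_nrm_ge[of J p e] pp by (simp add: e)
  fix j assume j: "j < J"
  have "h powr (7/4) \<le> h powr 1" by (rule pw) simp
  then show "norm (x m j - p j) \<le> h" using Linf_nrm_ge[OF j, of e] b(1) h by (simp add: e)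
  have "norm (e (nxt J j) - e j) \<le> W1inf_nrm J p e * elen J p j" by (rule W1inf_nrm_ge[OF j pp[OF j]])
  also have "\<dots> \<le> h * elen J p j" using W pp[OF j] by (intro mult_right_mono) auto
  finally show "norm ((x m (nxt J j) - p (nxt J j)) - (x m j - p j)) \<le> h * elen J p j" by (simp add: e)
qed

theorem lemma6p6:
  fixes T \<delta> c0 cq Cq Csh Kl :: real
    and c :: "real \<Rightarrow> real^2"
    and X :: "real^2 \<Rightarrow> real \<Rightarrow> real^2"
    and n v :: "real \<Rightarrow> real^2 \<Rightarrow> real^2"
    and H kap :: "real \<Rightarrow> real^2 \<Rightarrow> real"
  assumes "0 < T" and "0 < \<delta>" and "exact_flow T \<delta> c X n H v kap"
    and "0 < c0" and "0 < cq" and "0 < Cq" and "0 < Csh"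
  shows "\<exists>h0>0. \<exists>C>0. \<forall>h \<tau> l J x \<nu>.
    h \<le> h0 \<longrightarrow>
    standing_assumptions T c X c0 cq Cq Csh h \<tau> l J x \<nu> \<longrightarrow>
    mesh_const c X \<tau> J x l \<le> Kl \<longrightarrow>
    (\<forall>m\<le>l.
      H1_nrm J (proj_nodes c X \<tau> x m)
        (Ih_N c X n \<tau> x m (\<lambda>j. traj_err c X \<tau> x (Suc m) j - proj_err c X \<tau> x (Suc m) j
                               - \<tau> *\<^sub>R Ih_Tv c X n v \<tau> x m j)) \<le> C * \<tau>\<^sup>2 \<and>
      H1_nrm J (proj_nodes c X \<tau> x m)
        (Ih_N c X n \<tau> x m (\<lambda>j. traj_err c X \<tau> x m j - proj_err c X \<tau> x m j
                               - \<tau> *\<^sub>R Ih_Tv c X n v \<tau> x m j)) \<le> C * \<tau>\<^sup>2 \<and>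
      H1_nrm J (proj_nodes c X \<tau> x m)
        (\<lambda>j. Ih_N c X n \<tau> x m (traj_err c X \<tau> x m) j - proj_err c X \<tau> x m j) \<le> C * \<tau>\<^sup>2)"
proof -
  obtain B G where ec: "evolving_curve T B G" and G0: "\<And>\<theta> t. G 0 \<theta> t = X (c \<theta>) t"
    and nG: "\<And>\<theta> t. t \<in> {0..T} \<Longrightarrow> norm (n t (G 0 \<theta> t)) = 1 \<and> n t (G 0 \<theta> t) \<bullet> G 1 \<theta> t = 0"
    and injX: "\<And>t. t \<in> {0..T} \<Longrightarrow> inj_on (\<lambda>p. X p t) (range c)"
    using exact_flow_curve[OF assms(1,3)] by blast
  interpret evolving_curve T B G by (rule ec)
  \<comment> \<open>One summand for each use: at least one, upper and lower edge lengths from the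
    mesh constant, and the step restriction. The absolute value keeps it meaningful for every real
    \<open>Kl\<close>.\<close>
  define M0 where "M0 = 1 + \<bar>Kl\<bar> * Cq + \<bar>Kl\<bar> / cq + c0"
  have nn: "0 \<le> \<bar>Kl\<bar> * Cq" "0 \<le> \<bar>Kl\<bar> / cq" using assms by auto
  have M0: "1 \<le> M0" "\<bar>Kl\<bar> * Cq \<le> M0" "\<bar>Kl\<bar> / cq \<le> M0" "c0 \<le> M0"
    using nn assms(4) by (auto simp: M0_def)
  define M where "M = 300 * B^6 * M0^3"
  have "1 * (1 * 1) \<le> 300 * (B^6 * M0^3)" using B M0 by (intro mult_mono one_le_power) auto
  then have M: "1 \<le> M" by (simp add: M_def)
  define C where "C = 300000000 * M^25"
  define h0 where "h0 = 1 / (1000000 * M^16)"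
  have curve: "curve_at c X t = range (\<lambda>\<theta>. G 0 \<theta> t)" for t by (auto simp: curve_at_def G0)
  have retr: "retr c X \<tau> m = closest_point (curve (real m * \<tau>))" for \<tau> m by (simp add: retr_def curve)
  have h0_small: "1000000 * (M^16 * h) \<le> 1" if "h \<le> h0" for h
  proof -
    have "1000000 * M^16 * h \<le> 1000000 * M^16 * h0" using that M by (intro mult_left_mono) auto
    then show ?thesis using M by (simp add: h0_def)
  qed
  have "1 * 1 \<le> 1000000 * M^16" using M by (intro mult_mono one_le_power) auto
  then have h0_le: "h0 \<le> 1" by (simp add: h0_def divide_le_eq)
  have pos: "0 < h0" "0 < 17 * C^9" using M by (auto simp: h0_def C_def)
  show ?thesis
  proof (rule exI[of _ h0], rule conjI[OF pos(1)], rule exI[of _ "17 * C^9"], rule conjI[OF pos(2)],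
      intro allI impI conjI)
    fix h \<tau> l J x \<nu> m
    assume h: "h \<le> h0" and std: "standing_assumptions T c X c0 cq Cq Csh h \<tau> l J x \<nu>"
      and mesh: "mesh_const c X \<tau> J x l \<le> Kl" and m: "m \<le> l"
    define p where "p = proj_nodes c X \<tau> x"
    have h1: "h \<le> 1" using h h0_le by simp
    note lev = standing_level[OF std mesh h1 _ assms(5,6), folded p_def]
    have p_eq: "p k j = closest_point (curve (real k * \<tau>)) (x k j)" for k j
      by (simp add: p_def proj_nodes_def retr)
    have len: "h / M0 \<le> elen J (p k) j" "elen J (p k) j \<le> M0 * h" if "k \<le> l" "j < J" for k j
    proof -
      have "elen J (p k) j \<le> (\<bar>Kl\<bar> * Cq) * h" using lev(11)[OF that] by simp
      also have "\<dots> \<le> M0 * h" using M0 lev(4)[OF that(1)] by (intro mult_right_mono) auto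
      finally show "elen J (p k) j \<le> M0 * h" .
      have "h \<le> (\<bar>Kl\<bar> / cq) * elen J (p k) j" using lev(12)[OF that] assms(5) by (simp add: field_simps)
      also have "\<dots> \<le> M0 * elen J (p k) j" using M0 by (intro mult_right_mono) (auto simp: elen_def)
      finally show "h / M0 \<le> elen J (p k) j" using M0 by (simp add: pos_divide_le_eq mult.commute)
    qed
    have step: "one_step T B G (real k * \<tau>) (real (Suc k) * \<tau>) h M0 J (x k) (x (Suc k)) (\<nu> k) (p k)" if k: "k \<le> l" for k
    proof (intro one_step.intro ec one_step_axioms.intro)
      have dt: "real (Suc k) * \<tau> - real k * \<tau> = \<tau>" by (simp add: algebra_simps)
      show "real (Suc k) * \<tau> - real k * \<tau> \<le> M0 * h\<^sup>2"
        unfolding dt using lev(5)[OF k] M0 mult_right_mono[of c0 M0 "h\<^sup>2"] by simp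
      show "scheme_step J (real (Suc k) * \<tau> - real k * \<tau>) (x k) (\<nu> k) (x (Suc k))"
        unfolding dt by (rule lev(9)[OF k])
      show "real k * \<tau> < real (Suc k) * \<tau>" using lev(3)[OF k] by simp
      show "1000000 * ((300 * B^6 * M0^3)^16 * h) \<le> 1" using h0_small[OF h] by (simp only: M_def)
      show "inj_on (closest_point (curve (real k * \<tau>))) (polygon J (p k))"
        using lev(10)[OF k] by (simp only: retr)
      show "p k j = closest_point (curve (real k * \<tau>)) (x k j)" for j by (rule p_eq)
    qed (use lev[OF k] len[OF k] M0 in auto)
    \<comment> \<open>A projected node is its own closest point, so the nodal matrix is the
      projector onto the normal line there and annihilates the range of
      \<open>T_star\<close>.\<close>
    have N: "N_star c X n \<tau> k q *v w = normal_part \<theta> (real k * \<tau>) w"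
        "N_star c X n \<tau> k q *v (w - r *\<^sub>R (T_star c X n \<tau> k q *v w')) = normal_part \<theta> (real k * \<tau>) w"
      if t: "real k * \<tau> \<in> {0..T}" and q: "q = G 0 \<theta> (real k * \<tau>)" for k q \<theta> w w' r
    proof -
      have "closest_point (curve (real k * \<tau>)) q = q" using q by (intro closest_point_self) auto
      then have NN: "N_star c X n \<tau> k q = outer (n (real k * \<tau>) q) (n (real k * \<tau>) q)"
        by (simp add: N_star_def retr Let_def)
      have unit: "norm (n (real k * \<tau>) q) = 1" "n (real k * \<tau>) q \<bullet> G 1 \<theta> (real k * \<tau>) = 0"
        using nG[OF t, of \<theta>] q by auto
      show 1: "N_star c X n \<tau> k q *v w = normal_part \<theta> (real k * \<tau>) w" for w
        unfolding NN by (rule normal_part_eq[OF t unit])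
      have "N_star c X n \<tau> k q *v (w - r *\<^sub>R (T_star c X n \<tau> k q *v w')) = N_star c X n \<tau> k q *v w"
        using unit(1) unfolding NN T_star_def outer_mult_vec matrix_vector_mult_diff_rdistrib
        by (simp add: inner_diff_right outer_mult_vec dot_square_norm)
      then show "N_star c X n \<tau> k q *v (w - r *\<^sub>R (T_star c X n \<tau> k q *v w')) = normal_part \<theta> (real k * \<tau>) w"
        by (simp only: 1)
    qed
    have Ih: "Ih_N c X n \<tau> x k (\<lambda>j. f j - \<tau> *\<^sub>R Ih_Tv c X n v \<tau> x k j) j = normal_part \<theta> (real k * \<tau>) (f j)"
      if "real k * \<tau> \<in> {0..T}" "p k j = G 0 \<theta> (real k * \<tau>)" for k j \<theta> f
      using N(2)[OF that] unfolding Ih_N_def Ih_Tv_def Let_def p_def[symmetric] by simp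
    have step_map: "step_map c X \<tau> k (G 0 \<theta> (real k * \<tau>)) = G 0 \<theta> (real (Suc k) * \<tau>)"
      if "real k * \<tau> \<in> {0..T}" for k \<theta>
      unfolding step_map_def o_def G0 by (subst inv_into_f_f[OF injX[OF that]]) auto
    \<comment> \<open>The numerical vertex cancels from the difference of the errors; the new
      projected node minus the transported old one remains.\<close>
    have err: "traj_err c X \<tau> x (Suc k) j - proj_err c X \<tau> x (Suc k) j = p (Suc k) j - G 0 \<theta> (real (Suc k) * \<tau>)"
      if "real k * \<tau> \<in> {0..T}" "p k j = G 0 \<theta> (real k * \<tau>)" for k j \<theta>
      using step_map[OF that(1), of \<theta>] that(2) by (simp add: proj_err_def p_def del: of_nat_Suc)

    interpret now: one_step T B G "real m * \<tau>" "real (Suc m) * \<tau>" h M0 J "x m" "x (Suc m)" "\<nu> m" "p m"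
      by (rule step[OF m])
    have C_now: "now.C = C" "now.\<tau> = \<tau>"
      unfolding now.C_def now.M_def C_def M_def now.\<tau>_def by (simp_all add: distrib_right)
    show "H1_nrm J (proj_nodes c X \<tau> x m)
        (Ih_N c X n \<tau> x m (\<lambda>j. traj_err c X \<tau> x (Suc m) j - proj_err c X \<tau> x (Suc m) j
                               - \<tau> *\<^sub>R Ih_Tv c X n v \<tau> x m j)) \<le> 17 * C^9 * \<tau>\<^sup>2"
    proof -
      have "Ih_N c X n \<tau> x m (\<lambda>j. traj_err c X \<tau> x (Suc m) j - proj_err c X \<tau> x (Suc m) j - \<tau> *\<^sub>R Ih_Tv c X n v \<tau> x m j) j
          = normal_part (now.\<theta> j) (real m * \<tau>) (G 0 (now.\<theta> j + now.\<eta> j) (real (Suc m) * \<tau>) - G 0 (now.\<theta> j) (real (Suc m) * \<tau>))"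
        if j: "j < J" for j
        unfolding Ih[OF now.times(1) now.theta[OF j]] err[OF now.times(1) now.theta[OF j]]
        unfolding p_eq now.eta(1)[OF j] ..
      from H1_nrm_cong[of J, OF this] show ?thesis
        using now.normal_jump_at_old_curve unfolding C_now p_def by simp
    qed
    show second: "H1_nrm J (proj_nodes c X \<tau> x m)
        (Ih_N c X n \<tau> x m (\<lambda>j. traj_err c X \<tau> x m j - proj_err c X \<tau> x m j
                               - \<tau> *\<^sub>R Ih_Tv c X n v \<tau> x m j)) \<le> 17 * C^9 * \<tau>\<^sup>2"
    proof (cases m)
      \<comment> \<open>At level 0 the trajectory error is defined as the projection error, and the
        nodal values vanish.\<close>
      case 0
      have "Ih_N c X n \<tau> x m (\<lambda>j. traj_err c X \<tau> x m j - proj_err c X \<tau> x m j - \<tau> *\<^sub>R Ih_Tv c X n v \<tau> x m j) j = 0"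
        if j: "j < J" for j
        unfolding Ih[OF now.times(1) now.theta[OF j]] by (simp add: 0 normal_part_def)
      then have "H1_nrm J (p m) (Ih_N c X n \<tau> x m (\<lambda>j. traj_err c X \<tau> x m j - proj_err c X \<tau> x m j - \<tau> *\<^sub>R Ih_Tv c X n v \<tau> x m j))
          = H1_nrm J (p m) (\<lambda>j. 0)" by (rule H1_nrm_cong)
      also have "\<dots> \<le> sqrt ((\<Sum>j<J. elen J (p m) j) * 0\<^sup>2 + 0)"
        using now.L_pos by (intro H1_nrm_le) (auto simp: now.L_def)
      also have "\<dots> \<le> 17 * C^9 * \<tau>\<^sup>2" using M by (simp add: C_def)
      finally show ?thesis by (simp add: p_def)
    next
      case (Suc k)
      then have k: "k \<le> l" using m by simp
      \<comment> \<open>For positive \<open>m\<close> both errors at level \<open>m\<close> arise in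
        the preceding step. They are projected with the normals at the end of that step, which is
        the case of the new curve.\<close>
      interpret old: one_step T B G "real k * \<tau>" "real (Suc k) * \<tau>" h M0 J "x k" "x (Suc k)" "\<nu> k" "p k"
        by (rule step[OF k])
      have C_old: "old.C = C" "old.\<tau> = \<tau>"
        unfolding old.C_def old.M_def C_def M_def old.\<tau>_def by (simp_all add: distrib_right)
      have pm: "p (Suc k) j = G 0 (old.\<theta> j + old.\<eta> j) (real (Suc k) * \<tau>)" if "j < J" for j
        by (rule trans[OF p_eq old.eta(1)[OF that]])
      have "Ih_N c X n \<tau> x (Suc k) (\<lambda>j. traj_err c X \<tau> x (Suc k) j - proj_err c X \<tau> x (Suc k) j - \<tau> *\<^sub>R Ih_Tv c X n v \<tau> x (Suc k) j) j
          = - normal_part (old.\<theta> j + old.\<eta> j) (real (Suc k) * \<tau>) (G 0 (old.\<theta> j) (real (Suc k) * \<tau>) - G 0 (old.\<theta> j + old.\<eta> j) (real (Suc k) * \<tau>))"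
        if j: "j < J" for j
        unfolding Ih[OF old.times(2) pm[OF j]] err[OF old.times(1) old.theta[OF j]] pm[OF j]
        by (simp add: normal_part_def inner_diff_right algebra_simps)
      then have "H1_nrm J (p m) (Ih_N c X n \<tau> x m (\<lambda>j. traj_err c X \<tau> x m j - proj_err c X \<tau> x m j - \<tau> *\<^sub>R Ih_Tv c X n v \<tau> x m j))
          = H1_nrm J (p m) (\<lambda>j. - normal_part (old.\<theta> j + old.\<eta> j) (real (Suc k) * \<tau>) (G 0 (old.\<theta> j) (real (Suc k) * \<tau>) - G 0 (old.\<theta> j + old.\<eta> j) (real (Suc k) * \<tau>)))"
        unfolding Suc by (rule H1_nrm_cong)
      also have "\<dots> \<le> 17 * C^9 * \<tau>\<^sup>2"
        unfolding H1_nrm_minus using old.normal_jump_at_new_curve[OF len[OF m]] by (simp only: C_old)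
      finally show ?thesis by (simp add: p_def)
    qed
    \<comment> \<open>Pointwise identity with the second estimate: the projection error is
      orthogonal to the tangent at the projected node, so the normal projection leaves it
      unchanged.\<close>
    have "Ih_N c X n \<tau> x m (traj_err c X \<tau> x m) j - proj_err c X \<tau> x m j
        = Ih_N c X n \<tau> x m (\<lambda>j. traj_err c X \<tau> x m j - proj_err c X \<tau> x m j - \<tau> *\<^sub>R Ih_Tv c X n v \<tau> x m j) j"
      if j: "j < J" for j
    proof -
      let ?e = "proj_err c X \<tau> x m j"
      have e: "?e = now.e j" unfolding proj_err_def now.e_def by (simp add: p_def)
      have "?e \<bullet> tang (now.\<theta> j) (real m * \<tau>) = 0"
        using now.e_orthogonal[OF j] by (simp add: e tang_def)
      moreover have "tang (now.\<theta> j) (real m * \<tau>) \<noteq> 0" using norm_tang[OF now.times(1), of "now.\<theta> j"] by auto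
      ultimately have "?e = normal_part (now.\<theta> j) (real m * \<tau>) ?e"
        using perp_decomposition[of "tang (now.\<theta> j) (real m * \<tau>)" ?e] norm_tang[OF now.times(1)]
        by (simp add: normal_part_def inner_commute)
      moreover have "Ih_N c X n \<tau> x m (traj_err c X \<tau> x m) j = normal_part (now.\<theta> j) (real m * \<tau>) (traj_err c X \<tau> x m j)"
        unfolding Ih_N_def p_def[symmetric] by (rule N(1)[OF now.times(1) now.theta[OF j]])
      ultimately show ?thesis
        unfolding Ih[OF now.times(1) now.theta[OF j]]
        by (metis (no_types, lifting) inner_diff_right normal_part_def scaleR_diff_left)
    qed
    from H1_nrm_cong[of J, OF this] show "H1_nrm J (proj_nodes c X \<tau> x m)
        (\<lambda>j. Ih_N c X n \<tau> x m (traj_err c X \<tau> x m) j - proj_err c X \<tau> x m j) \<le> 17 * C^9 * \<tau>\<^sup>2"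
      using second by simp
  qed
qed

end
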